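(* Let $\gamma\in\mathbb{R}$ and $\lambda(\varepsilon)=1+\gamma\varepsilon$. For any $\varepsilon>0$, $t\ge0$ and $x\in\mathbb{R}^3$, the $C([0,\infty),\mathbb{R}^3)$-valued process $W^{\varepsilon,t,x}$ has the law $\mu_{\varepsilon,t,x}$.
   Context: On $\mathbb{R}^3$: $p_t(x)=(2\pi t)^{-3/2}e^{-|x|^2/(2t)}$, $p_t(x,y)=p_t(x-y)$, $H(a,x)=\int_a^\infty p_t(x)\,\mathrm{d}t$, $h^\varepsilon(x)=H(\varepsilon^2,x)$, $V^\varepsilon(x)=-p_{\varepsilon^2}(x)/h^\varepsilon(x)$. $\mathrm{E}^x$ is expectation for three-dimensional Brownian motion $B$ started at $x$, and $G_{\varepsilon,t}(x)=\mathrm{E}^x\big[\exp(-\lambda(\varepsilon)\int_0^tV^\varepsilon(B_s)\mathrm{d}s)\big]$. Gibbs measure: $\mu_{\varepsilon,t,x}(\mathrm{d}\omega)=\frac{1}{G_{\varepsilon,t}(x)}\exp\big(-\lambda(\varepsilon)\int_0^tV^\varepsilon(\omega_s)\mathrm{d}s\big)\mu(\mathrm{d}\omega)$ on $C([0,\infty),\mathbb{R}^3)$, where $\mu$ is Wiener measure started at $x$. Kernel: $p^{h,\varepsilon}_t(x,y)=-\frac{1}{h^\varepsilon(x)}p_t(x,y)V^\varepsilon(y)h^\varepsilon(y)=\frac{p_t(x,y)p_{\varepsilon^2}(y)}{h^\varepsilon(x)}$; for each $x$ it is a probability density in $(t,y)\in(0,\infty)\times\mathbb{R}^3$. Let $(T_n^{\varepsilon,x},S_n^{\varepsilon,x})_{n\ge0}$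 be the Markov chain on $[0,\infty)\times\mathbb{R}^3$ started at $(0,x)$ with transition law $(s,z)\mapsto(s+\mathrm{d}t,\mathrm{d}y)$ of density $p^{h,\varepsilon}_t(z,y)\,\mathrm{d}t\,\mathrm{d}y$. Construction of $W^{\varepsilon,t,x}$. Let $U$ be an $\mathbb{N}_0$-valued random variable with $\mathbb{P}(U=0)=\frac{1}{G_{\varepsilon,t}(x)}$ and $\mathbb{P}(U=n)=\frac{1}{G_{\varepsilon,t}(x)}\lambda(\varepsilon)^nh^\varepsilon(x)\,\mathbb{E}\Big[\frac{1\{T_n^{\varepsilon,x}\le t\}}{h^\varepsilon(S_n^{\varepsilon,x})}\Big]$ for $n\ge1$. Given $U=n\geq 1$, let $(t_1,x_1),\dots,(t_n,x_n)$ be random points whose conditional joint density on $\{0\le t_1<\dots<t_n<t\}\times(\mathbb{R}^3)^n$ is $$\frac{1}{\mathbb{P}(U=n)}\,\frac{\lambda(\varepsilon)^nh^\varepsilon(x)}{G_{\varepsilon,t}(x)h^\varepsilon(x_n)}\,p^{h,\varepsilon}_{t_1}(x,x_1)\prod_{k=1}^{n-1}p^{h,\varepsilon}_{t_{k+1}-t_k}(x_k,x_{k+1}).$$ Put $(t_0,x_0)=(0,x)$. Let $B$ be a standard Brownian motion in $\mathbb{R}^3$ from $0$ and $(B_k^{\mathrm{Bri}})_{k}$ i.i.d. standard Brownian bridges in $\mathbb{R}^3$ on $[0,1]$ from $0$ to $0$, independent of each other and of $U$ and the points. On $\{U=n\}$ define, for $0\le k\le n-1$ and $t_k\le s\le t_{k+1}$,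 $$W^{\varepsilon,t,x}(s)=x_k\Big(1-\tfrac{s-t_k}{t_{k+1}-t_k}\Big)+x_{k+1}\tfrac{s-t_k}{t_{k+1}-t_k}+\sqrt{t_{k+1}-t_k}\,B_k^{\mathrm{Bri}}\Big(\tfrac{s-t_k}{t_{k+1}-t_k}\Big),$$ and $W^{\varepsilon,t,x}(s)=x_n+B(s-t_n)$ for $s\ge t_n$ (so $W^{\varepsilon,t,x}(s)=x+B(s)$ if $n=0$). *)

theory Defs
  imports "HOL-Probability.Probability"
begin

type_synonym R3 = "real ^ 3"

definition heat :: "real \<Rightarrow> R3 \<Rightarrow> real" where
  "heat t x = (2 * pi * t) powr (- 3 / 2) * exp (- (norm x)\<^sup>2 / (2 * t))"

definition H :: "real \<Rightarrow> R3 \<Rightarrow> real" where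
  "H a x = (LBINT t:{a..}. heat t x)"

definition h :: "real \<Rightarrow> R3 \<Rightarrow> real" where
  "h \<epsilon> x = H (\<epsilon>\<^sup>2) x"

definition V :: "real \<Rightarrow> R3 \<Rightarrow> real" where
  "V \<epsilon> x = - heat (\<epsilon>\<^sup>2) x / h \<epsilon> x"

definition ph :: "real \<Rightarrow> real \<Rightarrow> R3 \<Rightarrow> R3 \<Rightarrow> real" where
  "ph \<epsilon> t x y = - (1 / h \<epsilon> x) * heat t (x - y) * V \<epsilon> y * h \<epsilon> y"

text \<open>The space of continuous paths on the half-line. Paths are extensional functions on the
  half-line, and the cylinder sigma-algebra is the Borel sigma-algebra of locally uniform
  convergence.\<close>

definition path_space :: "(real \<Rightarrow> R3) measure" where
  "path_space = restrict_space (Pi\<^sub>M {0..} (\<lambda>_. borel)) {w. continuous_on {0..} w}"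

definition gaussian_increments :: "'w measure \<Rightarrow> (real \<Rightarrow> 'w \<Rightarrow> R3) \<Rightarrow> bool" where
  "gaussian_increments M B \<longleftrightarrow>
     (\<forall>s u. 0 \<le> s \<and> s < u \<longrightarrow>
        distributed M lborel (\<lambda>\<omega>. B u \<omega> - B s \<omega>) (\<lambda>y. ennreal (heat (u - s) y))) \<and>
     (\<forall>n (r :: nat \<Rightarrow> real). 0 \<le> r 0 \<and> strict_mono_on {..n} r \<longrightarrow>
        prob_space.indep_vars M (\<lambda>_. borel) (\<lambda>k \<omega>. B (r (Suc k)) \<omega> - B (r k) \<omega>) {..<n})"

definition is_wiener :: "R3 \<Rightarrow> (real \<Rightarrow> R3) measure \<Rightarrow> bool" where
  "is_wiener x \<mu> \<longleftrightarrow> prob_space \<mu> \<and> sets \<mu> = sets path_space \<and> (AE w in \<mu>. w 0 = x) \<and>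
     gaussian_increments \<mu> (\<lambda>s w. w s)"

text \<open>Such a measure exists by Wiener's theorem; it is unique because the increments and the
  starting point determine all finite-dimensional distributions.\<close>

definition wiener :: "R3 \<Rightarrow> (real \<Rightarrow> R3) measure" where
  "wiener x = (THE \<mu>. is_wiener x \<mu>)"

definition gibbs_weight :: "real \<Rightarrow> real \<Rightarrow> real \<Rightarrow> (real \<Rightarrow> R3) \<Rightarrow> real" where
  "gibbs_weight \<epsilon> l t w = exp (- l * (LBINT s:{0..t}. V \<epsilon> (w s)))"

definition G :: "real \<Rightarrow> real \<Rightarrow> real \<Rightarrow> R3 \<Rightarrow> real" where
  "G \<epsilon> l t x = (\<integral>w. gibbs_weight \<epsilon> l t w \<partial>wiener x)"

definition gibbs :: "real \<Rightarrow> real \<Rightarrow> real \<Rightarrow> R3 \<Rightarrow> (real \<Rightarrow> R3) measure" where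
  "gibbs \<epsilon> l t x =
     density (wiener x) (\<lambda>w. ennreal (1 / G \<epsilon> l t x * gibbs_weight \<epsilon> l t w))"

definition standard_brownian_motion :: "'w measure \<Rightarrow> (real \<Rightarrow> 'w \<Rightarrow> R3) \<Rightarrow> bool" where
  "standard_brownian_motion M B \<longleftrightarrow> prob_space M \<and>
     (\<forall>s\<ge>0. B s \<in> borel_measurable M) \<and>
     (\<forall>\<omega>\<in>space M. B 0 \<omega> = 0 \<and> continuous_on {0..} (\<lambda>s. B s \<omega>)) \<and>
     gaussian_increments M B"

text \<open>The density below is that of Brownian motion from 0 at the times
  \<open>r 1 < \<dots> < r n\<close>, conditioned to be at 0 at time 1.\<close>

definition bridge_density :: "nat \<Rightarrow> (nat \<Rightarrow> real) \<Rightarrow> (nat \<Rightarrow> R3) \<Rightarrow> real" where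
  "bridge_density n r z =
     (let y = z(0 := 0) in
       (\<Prod>k<n. heat (r (Suc k) - r k) (y (Suc k) - y k)) * heat (1 - r n) (0 - y n) / heat 1 0)"

definition standard_brownian_bridge :: "'w measure \<Rightarrow> (real \<Rightarrow> 'w \<Rightarrow> R3) \<Rightarrow> bool" where
  "standard_brownian_bridge M b \<longleftrightarrow> prob_space M \<and>
     (\<forall>s\<in>{0..1}. b s \<in> borel_measurable M) \<and>
     (\<forall>\<omega>\<in>space M. b 0 \<omega> = 0 \<and> b 1 \<omega> = 0 \<and> continuous_on {0..1} (\<lambda>s. b s \<omega>)) \<and>
     (\<forall>n (r :: nat \<Rightarrow> real). r 0 = 0 \<and> strict_mono_on {..n} r \<and> r n < 1 \<longrightarrow>
        distributed M (Pi\<^sub>M {1..n} (\<lambda>_. lborel)) (\<lambda>\<omega>. \<lambda>k\<in>{1..n}. b (r k) \<omega>)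
          (\<lambda>z. ennreal (bridge_density n r z)))"

definition ph_kernel :: "real \<Rightarrow> real \<times> R3 \<Rightarrow> (real \<times> R3) measure" where
  "ph_kernel \<epsilon> = (\<lambda>(s, z).
     distr (density lborel (\<lambda>(u, y). ennreal (indicator {0<..} u * ph \<epsilon> u z y)))
       borel (\<lambda>(u, y). (s + u, y)))"

definition markov_chain ::
  "'v measure \<Rightarrow> 'a measure \<Rightarrow> ('a \<Rightarrow> 'a measure) \<Rightarrow> 'a \<Rightarrow> (nat \<Rightarrow> 'v \<Rightarrow> 'a) \<Rightarrow> bool" where
  "markov_chain N S K a X \<longleftrightarrow> prob_space N \<and>
     (\<forall>n. X n \<in> measurable N S) \<and>
     (AE \<omega> in N. X 0 \<omega> = a) \<and>
     (\<forall>n. \<forall>A\<in>sets S. AE \<omega> in N.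
        real_cond_exp N
          (vimage_algebra (space N) (\<lambda>\<omega>. \<lambda>k\<in>{..n}. X k \<omega>) (Pi\<^sub>M {..n} (\<lambda>_. S)))
          (indicator (X (Suc n) -` A \<inter> space N)) \<omega>
        = measure (K (X n \<omega>)) A)"

definition U_weight ::
  "real \<Rightarrow> real \<Rightarrow> real \<Rightarrow> R3 \<Rightarrow> 'v measure \<Rightarrow> (nat \<Rightarrow> 'v \<Rightarrow> real) \<Rightarrow> (nat \<Rightarrow> 'v \<Rightarrow> R3) \<Rightarrow> nat \<Rightarrow> real"
  where
  "U_weight \<epsilon> l t x N T S n =
     (if n = 0 then 1 / G \<epsilon> l t x
      else 1 / G \<epsilon> l t x * l ^ n * h \<epsilon> x *
        (\<integral>\<omega>. indicator {..t} (T n \<omega>) / h \<epsilon> (S n \<omega>) \<partial>N))"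

text \<open>For \<open>n \<ge> 1\<close>, the joint density of the points \<open>z k = (t\<^sub>k, x\<^sub>k)\<close>, \<open>1 \<le> k \<le> n\<close>,
  given \<open>U = n\<close>; the argument \<open>q\<close> is the probability of \<open>U = n\<close>.\<close>

definition points_density ::
  "real \<Rightarrow> real \<Rightarrow> real \<Rightarrow> R3 \<Rightarrow> real \<Rightarrow> nat \<Rightarrow> (nat \<Rightarrow> real \<times> R3) \<Rightarrow> real" where
  "points_density \<epsilon> l t x q n z =
     (if 0 \<le> fst (z 1) \<and> (\<forall>k\<in>{1..<n}. fst (z k) < fst (z (k + 1))) \<and> fst (z n) < t
      then 1 / q * (l ^ n * h \<epsilon> x / (G \<epsilon> l t x * h \<epsilon> (snd (z n)))) *
        ph \<epsilon> (fst (z 1)) x (snd (z 1)) *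
        (\<Prod>k=1..n-1. ph \<epsilon> (fst (z (k + 1)) - fst (z k)) (snd (z k)) (snd (z (k + 1))))
      else 0)"

text \<open>The points are given as random sequences of which only the entries with index at most \<open>U\<close> are
  meaningful; the other ones are masked, so that nothing is required of them.\<close>

definition skeleton ::
  "('w \<Rightarrow> nat) \<Rightarrow> (nat \<Rightarrow> 'w \<Rightarrow> real) \<Rightarrow> (nat \<Rightarrow> 'w \<Rightarrow> R3) \<Rightarrow> 'w \<Rightarrow> nat \<times> (nat \<Rightarrow> real \<times> R3)" where
  "skeleton U \<tau> \<xi> \<omega> = (U \<omega>, \<lambda>k. if 1 \<le> k \<and> k \<le> U \<omega> then (\<tau> k \<omega>, \<xi> k \<omega>) else (0, 0))"

datatype part = Skeleton | Tail | Bridge nat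

definition part_sigma ::
  "'w measure \<Rightarrow> ('w \<Rightarrow> nat) \<Rightarrow> (nat \<Rightarrow> 'w \<Rightarrow> real) \<Rightarrow> (nat \<Rightarrow> 'w \<Rightarrow> R3) \<Rightarrow>
   (real \<Rightarrow> 'w \<Rightarrow> R3) \<Rightarrow> (nat \<Rightarrow> real \<Rightarrow> 'w \<Rightarrow> R3) \<Rightarrow> part \<Rightarrow> 'w set set" where
  "part_sigma M U \<tau> \<xi> B b i = (case i of
     Skeleton \<Rightarrow> sets (vimage_algebra (space M) (skeleton U \<tau> \<xi>)
       (count_space UNIV \<Otimes>\<^sub>M Pi\<^sub>M UNIV (\<lambda>_. borel)))
   | Tail \<Rightarrow> sets (vimage_algebra (space M) (\<lambda>\<omega>. \<lambda>s\<in>{0..}. B s \<omega>) (Pi\<^sub>M {0..} (\<lambda>_. borel)))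
   | Bridge k \<Rightarrow> sets (vimage_algebra (space M) (\<lambda>\<omega>. \<lambda>s\<in>{0..1}. b k s \<omega>)
       (Pi\<^sub>M {0..1} (\<lambda>_. borel))))"

text \<open>On \<open>0 = \<tau> 0 < \<dots> < \<tau> n\<close> exactly one summand or the last term is switched on at each time,
  and the pieces agree at the common endpoints. The times can fail to be strictly increasing only on
  a null event, where the path is set to 0 to keep it continuous.\<close>

definition W ::
  "('w \<Rightarrow> nat) \<Rightarrow> (nat \<Rightarrow> 'w \<Rightarrow> real) \<Rightarrow> (nat \<Rightarrow> 'w \<Rightarrow> R3) \<Rightarrow> (real \<Rightarrow> 'w \<Rightarrow> R3) \<Rightarrow>
   (nat \<Rightarrow> real \<Rightarrow> 'w \<Rightarrow> R3) \<Rightarrow> 'w \<Rightarrow> real \<Rightarrow> R3" where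
  "W U \<tau> \<xi> B b \<omega> =
     (\<lambda>s\<in>{0..}.
        if \<forall>k<U \<omega>. \<tau> k \<omega> < \<tau> (k + 1) \<omega> then
          (\<Sum>k<U \<omega>. if \<tau> k \<omega> \<le> s \<and> s < \<tau> (k + 1) \<omega> then
             (let d = \<tau> (k + 1) \<omega> - \<tau> k \<omega>; v = (s - \<tau> k \<omega>) / d in
               (1 - v) *\<^sub>R \<xi> k \<omega> + v *\<^sub>R \<xi> (k + 1) \<omega> + sqrt d *\<^sub>R b k v \<omega>) else 0)
          + (if \<tau> (U \<omega>) \<omega> \<le> s then \<xi> (U \<omega>) \<omega> + B (s - \<tau> (U \<omega>) \<omega>) \<omega> else 0)
        else 0)"

end

theory Submission
  imports Defs
begin

text \<open>
  Write \<open>q = - V \<epsilon>\<close>, a bounded nonnegative function. The Feynman--Kac series expands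
  \<open>exp (l * \<integral>\<^bsub>0\<^esub>\<^bsup>t\<^esup> q (w s) ds)\<close> into the integrals of \<open>l\<^sup>n * q (w t\<^sub>1) * \<dots> * q (w t\<^sub>n)\<close> over
  \<open>0 < t\<^sub>1 < \<dots> < t\<^sub>n < t\<close>. Since \<open>ph \<epsilon> t x y = heat t (x - y) * q y * h \<epsilon> y / h \<epsilon> x\<close>, the factors \<open>h\<close> in the
  density of the points telescope, and the law of the skeleton on \<open>U = n\<close> is the \<open>n\<close>-th term of this
  series, divided by \<open>G\<close>, at the positions of the Brownian path at the times \<open>t\<^sub>k\<close>. Filling in bridges
  between these positions, and a free Brownian motion after \<open>t\<^sub>n\<close>, gives back the Brownian path. All
  this is tested against products \<open>f\<^sub>1 (w s\<^sub>1) * \<dots> * f\<^sub>m (w s\<^sub>m)\<close>, for which each side is an iterated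
  integral of heat kernels.
\<close>

section \<open>The heat kernel and the potential\<close>

text \<open>The comparison takes place in \<open>ennreal\<close>, where sums and integrals can be
  exchanged without integrability conditions. This needs \<open>l \<ge> 0\<close>, whereas
  \<open>1 + \<gamma> * \<epsilon>\<close> can have either sign. If \<open>l < 0\<close> and
  \<open>t > 0\<close>, the mass prescribed for \<open>U = 1\<close> is negative, so no such
  \<open>U\<close> exists; at \<open>t = 0\<close> the coupling has no influence. The obstacle in
  matching the two sides is that the fixed test times interleave with the integration variables:
  which tests fall between two consecutive points changes with the points. The operators therefore
  carry the list of pending tests, filtered by times that are themselves integrated, and the key
  identities hold only when no point falls on a test time, which is almost everywhere.
  \<open>wiener\<close> is a definite description: uniqueness comes from the finite-dimensional
  distributions, existence from the given Brownian motion \<open>B\<close>, shifted to start at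
  \<open>x\<close>. The bound on \<open>q\<close> rests on a Gaussian lower bound for
  \<open>h \<epsilon>\<close> with the same variance as the numerator of
  \<open>V \<epsilon>\<close>; it makes \<open>G\<close> finite and positive.\<close>

lemma heat_nonneg: "heat t x \<ge> 0"
  by (simp add: heat_def)

lemma heat_pos: "t > 0 \<Longrightarrow> heat t x > 0"
  by (simp add: heat_def)

lemma heat_zero: "heat 0 x = 0"
  by (simp add: heat_def)

lemma heat_commute: "heat t (x - y) = heat t (y - x)"
  by (simp add: heat_def norm_minus_commute)

lemma measurable_heat[measurable (raw)]:
  assumes [measurable]: "f \<in> borel_measurable M" "g \<in> borel_measurable M"
  shows "(\<lambda>x. heat (f x) (g x)) \<in> borel_measurable M"
  unfolding heat_def by measurable

lemma continuous_heat: "t > 0 \<Longrightarrow> continuous_on UNIV (heat t)"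
  unfolding heat_def by (intro continuous_intros) auto

lemma heat_le:
  assumes "t > 0"
  shows "heat t x \<le> (2 * pi * t) powr (- 3 / 2)"
  unfolding heat_def using assms by (simp add: mult_le_cancel_left2)

text \<open>The exponent of dimension three makes the prefactor of the heat kernel integrable at
  infinity. The bound does not involve the space variable, so it also serves as dominating function
  in \<open>continuous_H\<close>.\<close>

lemma set_integrable_heat_bound:
  fixes a :: real
  assumes "a > 0"
  shows "set_integrable lborel {a..} (\<lambda>t. (2 * pi * t) powr (- 3 / 2))"
proof -
  have "(\<lambda>t. t powr (- 3 / 2)) integrable_on {a..}"
    using has_integral_powr_to_inf[of "-3/2" a] assms by (auto simp: integrable_on_def)
  then have "(\<lambda>t::real. t powr (- 3 / 2)) absolutely_integrable_on {a..}"
    by (intro nonnegative_absolutely_integrable_1) auto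
  then have "set_integrable lborel {a..} (\<lambda>t. t powr (- 3 / 2))"
    unfolding set_integrable_def by (subst (asm) integrable_completion) auto
  then have "set_integrable lborel {a..} (\<lambda>t. (2 * pi) powr (- 3 / 2) * t powr (- 3 / 2))"
    by (rule set_integrable_mult_right)
  then show ?thesis
    by (rule set_integrable_cong[THEN iffD1, rotated -1]) (use assms in \<open>auto simp: powr_mult\<close>)
qed

lemma set_integrable_heat:
  assumes "a > 0"
  shows "set_integrable lborel {a..} (\<lambda>t. heat t x)"
  by (rule set_integrable_bound[OF set_integrable_heat_bound[OF assms]])
     (use assms heat_le in \<open>auto simp: set_borel_measurable_def heat_nonneg\<close>)

lemma continuous_H:
  assumes "a > 0"
  shows "continuous_on UNIV (H a)"
proof (rule continuous_on_sequentiallyI)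
  fix u :: "nat \<Rightarrow> R3" and x assume u: "u \<longlonglongrightarrow> x"
  have "(\<lambda>n. \<integral>t. indicator {a..} t *\<^sub>R heat t (u n) \<partial>lborel) \<longlonglongrightarrow> (\<integral>t. indicator {a..} t *\<^sub>R heat t x \<partial>lborel)"
  proof (rule integral_dominated_convergence)
    show "integrable lborel (\<lambda>t. indicator {a..} t *\<^sub>R (2 * pi * t) powr (- 3 / 2))"
      using set_integrable_heat_bound[OF assms] by (simp add: set_integrable_def)
    show "AE t in lborel. (\<lambda>n. indicator {a..} t *\<^sub>R heat t (u n)) \<longlonglongrightarrow> indicator {a..} t *\<^sub>R heat t x"
    proof (rule AE_I2)
      fix t :: real
      show "(\<lambda>n. indicator {a..} t *\<^sub>R heat t (u n)) \<longlonglongrightarrow> indicator {a..} t *\<^sub>R heat t x"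
        using continuous_on_tendsto_compose[OF continuous_heat[of t] u] assms
        by (cases "t \<ge> a") auto
    qed
    show "AE t in lborel. norm (indicator {a..} t *\<^sub>R heat t (u n))
        \<le> indicator {a..} t *\<^sub>R (2 * pi * t) powr (- 3 / 2)" for n
      using assms heat_le heat_nonneg by (auto simp: indicator_def)
  qed measurable
  then show "(\<lambda>n. H a (u n)) \<longlonglongrightarrow> H a x"
    by (simp add: H_def set_lebesgue_integral_def)
qed

text \<open>Only the times in \<open>{a..2*a}\<close> are kept. On this interval of length
  \<open>a\<close> the power is smallest at \<open>2*a\<close>, which gives
  \<open>4 * pi * a\<close>, and the exponential is smallest at \<open>a\<close>. The resulting
  Gaussian factor is that of \<open>heat a x\<close> itself.\<close>

lemma H_lower:
  assumes "a > 0"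
  shows "a * ((4 * pi * a) powr (- 3 / 2) * exp (- (norm x)\<^sup>2 / (2 * a))) \<le> H a x"
proof -
  let ?c = "(4 * pi * a) powr (- 3 / 2) * exp (- (norm x)\<^sup>2 / (2 * a))"
  have "a * ?c = (LBINT t:{a..2*a}. ?c)"
    using assms by (simp add: set_lebesgue_integral_def)
  also have "\<dots> = (\<integral>t. indicator {a..2*a} t *\<^sub>R ?c \<partial>lborel)"
    by (simp add: set_lebesgue_integral_def)
  also have "\<dots> \<le> (\<integral>t. indicator {a..} t *\<^sub>R heat t x \<partial>lborel)"
  proof (rule integral_mono)
    show "integrable lborel (\<lambda>t. indicator {a..} t *\<^sub>R heat t x)"
      using set_integrable_heat[OF assms] by (simp add: set_integrable_def)
    show "indicator {a..2*a} t *\<^sub>R ?c \<le> indicator {a..} t *\<^sub>R heat t x" for t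
    proof (cases "t \<in> {a..2*a}")
      case True
      then have t: "a \<le> t" "t \<le> 2 * a" "t > 0" using assms by auto
      have "(4 * pi * a) powr (- 3 / 2) \<le> (2 * pi * t) powr (- 3 / 2)"
        using t assms by (intro powr_mono2') auto
      moreover have "exp (- (norm x)\<^sup>2 / (2 * a)) \<le> exp (- (norm x)\<^sup>2 / (2 * t))"
        using t assms by (auto intro!: divide_left_mono)
      ultimately show ?thesis
        using True unfolding heat_def by (auto intro!: mult_mono)
    qed (auto simp: heat_nonneg indicator_def)
    show "integrable lborel (\<lambda>t. indicator {a..2*a} t *\<^sub>R ?c)"
      by (intro integrable_scaleR_left) (use assms in \<open>simp add: integrable_indicator_iff\<close>)
  qed
  finally show ?thesis by (simp add: H_def set_lebesgue_integral_def)
qed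

lemma h_pos:
  assumes "\<epsilon> > 0" shows "h \<epsilon> x > 0"
proof -
  have "0 < \<epsilon>\<^sup>2 * ((4 * pi * \<epsilon>\<^sup>2) powr (- 3 / 2) * exp (- (norm x)\<^sup>2 / (2 * \<epsilon>\<^sup>2)))"
    using assms by simp
  also have "\<dots> \<le> h \<epsilon> x" unfolding h_def using assms by (intro H_lower) auto
  finally show ?thesis .
qed

lemma continuous_h: "\<epsilon> > 0 \<Longrightarrow> continuous_on UNIV (h \<epsilon>)"
  unfolding h_def using continuous_H[of "\<epsilon>\<^sup>2"] by auto

lemma continuous_V:
  assumes "\<epsilon> > 0" shows "continuous_on UNIV (V \<epsilon>)"
  unfolding V_def using assms h_pos[OF assms] continuous_h[OF assms] continuous_heat[of "\<epsilon>\<^sup>2"]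
  by (intro continuous_intros) (auto simp: less_imp_neq[symmetric])

lemma V_neg:
  assumes "\<epsilon> > 0" shows "V \<epsilon> x < 0"
  unfolding V_def using heat_pos[of "\<epsilon>\<^sup>2" x] h_pos[OF assms, of x] assms by simp

text \<open>The Gaussian factor of the numerator cancels against the one in \<open>H_lower\<close>
  at \<open>a = \<epsilon>\<^sup>2\<close>; the quotient of the remaining constants is the
  bound.\<close>

lemma V_bounded:
  assumes "\<epsilon> > 0"
  obtains C where "C > 0" "\<And>x. - V \<epsilon> x \<le> C"
proof -
  let ?k = "\<epsilon>\<^sup>2 * (4 * pi * \<epsilon>\<^sup>2) powr (- 3 / 2)"
  let ?C = "(2 * pi * \<epsilon>\<^sup>2) powr (- 3 / 2) / ?k"
  have k: "?k > 0" using assms by simp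
  have "- V \<epsilon> x \<le> ?C" for x
  proof -
    let ?e = "exp (- (norm x)\<^sup>2 / (2 * \<epsilon>\<^sup>2))"
    have "- V \<epsilon> x = (2 * pi * \<epsilon>\<^sup>2) powr (- 3 / 2) * ?e / h \<epsilon> x"
      by (simp add: V_def heat_def)
    also have "\<dots> \<le> (2 * pi * \<epsilon>\<^sup>2) powr (- 3 / 2) * ?e / (?k * ?e)"
      using H_lower[of "\<epsilon>\<^sup>2" x] h_pos[OF assms, of x] assms k
      by (intro divide_left_mono mult_pos_pos) (auto simp: h_def mult.assoc)
    also have "\<dots> = ?C" by simp
    finally show ?thesis .
  qed
  moreover have "?C > 0" using k assms by simp
  ultimately show thesis using that by blast
qed

lemma measurable_V[measurable]: "\<epsilon> > 0 \<Longrightarrow> V \<epsilon> \<in> borel_measurable borel"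
  using continuous_V by (rule borel_measurable_continuous_onI)

lemma measurable_h[measurable]: "\<epsilon> > 0 \<Longrightarrow> h \<epsilon> \<in> borel_measurable borel"
  using continuous_h by (rule borel_measurable_continuous_onI)

section \<open>Iterated heat kernels\<close>

text \<open>The expectation of \<open>f\<^sub>1 (w u\<^sub>1) * \<dots> * f\<^sub>m (w u\<^sub>m) * g u\<^sub>m (w u\<^sub>m)\<close> for Brownian motion started at \<open>x\<close> at
  time \<open>s\<close>. The terminal function also receives the last time, so that a further operator can serve as
  terminal function.\<close>
fun bm_op :: "real \<Rightarrow> (real \<times> (R3 \<Rightarrow> ennreal)) list \<Rightarrow> (real \<Rightarrow> R3 \<Rightarrow> ennreal) \<Rightarrow> R3 \<Rightarrow> ennreal"
where
  "bm_op s [] g x = g s x"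
| "bm_op s ((u, f) # L) g x =
     (\<integral>\<^sup>+y. ennreal (heat (u - s) (y - x)) * (f y * bm_op u L g y) \<partial>lborel)"

text \<open>The Markov property in operator form: everything after the first block is a terminal
  function of the time and place reached there.\<close>

lemma bm_op_append: "bm_op s (L @ L') g x = bm_op s L (\<lambda>r z. bm_op r L' g z) x"
  by (induction s L g x rule: bm_op.induct) auto

text \<open>In the series, the set of tests still to be applied depends on integration variables.
  The induction runs over the fixed list \<open>L\<close>, and the dependence on \<open>p\<close>
  enters each step only through a measurable case distinction on \<open>P p u\<close>.\<close>

lemma measurable_bm_op_filter:
  assumes "\<And>u f. (u, f) \<in> set L \<Longrightarrow> f \<in> borel_measurable borel \<and> Measurable.pred K (\<lambda>p. P p u)"
    and "(\<lambda>(p, r, z). g p r z) \<in> borel_measurable (K \<Otimes>\<^sub>M borel \<Otimes>\<^sub>M borel)"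
  shows "(\<lambda>(p, s, x). bm_op s (filter (\<lambda>q. P p (fst q)) L) (g p) x) \<in> borel_measurable (K \<Otimes>\<^sub>M borel \<Otimes>\<^sub>M borel)"
  using assms(1)
proof (induction L)
  case Nil
  then show ?case using assms(2) by simp
next
  case (Cons a L)
  obtain u f where a: "a = (u, f)" by (cases a)
  have [measurable]: "f \<in> borel_measurable borel" "Measurable.pred K (\<lambda>p. P p u)"
    using Cons.prems[of u f] a by auto
  have IH: "(\<lambda>(p, s, x). bm_op s (filter (\<lambda>q. P p (fst q)) L) (g p) x) \<in> borel_measurable (K \<Otimes>\<^sub>M borel \<Otimes>\<^sub>M borel)"
    using Cons by auto
  have [measurable]: "(\<lambda>w. bm_op u (filter (\<lambda>q. P (fst (fst w)) (fst q)) L) (g (fst (fst w))) (snd w))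
     \<in> borel_measurable ((K \<Otimes>\<^sub>M borel \<Otimes>\<^sub>M borel) \<Otimes>\<^sub>M borel)"
  proof -
    have "(\<lambda>w. (fst (fst w), u, snd w)) \<in> (K \<Otimes>\<^sub>M borel \<Otimes>\<^sub>M borel) \<Otimes>\<^sub>M borel \<rightarrow>\<^sub>M K \<Otimes>\<^sub>M borel \<Otimes>\<^sub>M borel"
      by measurable
    from measurable_compose[OF this IH] show ?thesis by simp
  qed
  have [measurable]: "(\<lambda>w. \<integral>\<^sup>+y. ennreal (heat (u - fst (snd w)) (y - snd (snd w))) *
      (f y * bm_op u (filter (\<lambda>q. P (fst w) (fst q)) L) (g (fst w)) y) \<partial>lborel) \<in> borel_measurable (K \<Otimes>\<^sub>M borel \<Otimes>\<^sub>M borel)"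
    by measurable
  have IH'[measurable]: "(\<lambda>w. bm_op (fst (snd w)) (filter (\<lambda>q. P (fst w) (fst q)) L) (g (fst w)) (snd (snd w)))
     \<in> borel_measurable (K \<Otimes>\<^sub>M borel \<Otimes>\<^sub>M borel)"
    using IH by (simp add: split_beta')
  have "(\<lambda>(p, s, x). bm_op s (filter (\<lambda>q. P p (fst q)) (a # L)) (g p) x) =
    (\<lambda>w. if P (fst w) u then (\<integral>\<^sup>+y. ennreal (heat (u - fst (snd w)) (y - snd (snd w))) *
      (f y * bm_op u (filter (\<lambda>q. P (fst w) (fst q)) L) (g (fst w)) y) \<partial>lborel)
      else bm_op (fst (snd w)) (filter (\<lambda>q. P (fst w) (fst q)) L) (g (fst w)) (snd (snd w)))"
    by (auto simp: a)
  also have "\<dots> \<in> borel_measurable (K \<Otimes>\<^sub>M borel \<Otimes>\<^sub>M borel)"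
    by measurable
  finally show ?case .
qed

lemma measurable_bm_op:
  assumes "\<And>u f. (u, f) \<in> set L \<Longrightarrow> f \<in> borel_measurable borel"
    and "(\<lambda>(p, r, z). g p r z) \<in> borel_measurable (K \<Otimes>\<^sub>M borel \<Otimes>\<^sub>M borel)"
  shows "(\<lambda>(p, s, x). bm_op s L (g p) x) \<in> borel_measurable (K \<Otimes>\<^sub>M borel \<Otimes>\<^sub>M borel)"
  using measurable_bm_op_filter[where L=L and K=K and P="\<lambda>_ _. True" and g=g] assms by simp

lemma bm_op_nn_integral:
  assumes "sigma_finite_measure K"
    and L: "\<And>u f. (u, f) \<in> set L \<Longrightarrow> f \<in> borel_measurable borel"
    and g: "(\<lambda>(p, r, z). g p r z) \<in> borel_measurable (K \<Otimes>\<^sub>M borel \<Otimes>\<^sub>M borel)"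
  shows "bm_op s L (\<lambda>r z. \<integral>\<^sup>+p. g p r z \<partial>K) x = (\<integral>\<^sup>+p. bm_op s L (g p) x \<partial>K)"
  using L
proof (induction L arbitrary: s x)
  case Nil
  then show ?case by simp
next
  case (Cons a L)
  interpret K: sigma_finite_measure K by fact
  interpret pair_sigma_finite K "lborel :: R3 measure" ..
  obtain u f where a: "a = (u, f)" by (cases a)
  have [measurable]: "f \<in> borel_measurable borel"
    using Cons.prems[of u f] a by auto
  have m: "(\<lambda>(p, s, x). bm_op s L (g p) x) \<in> borel_measurable (K \<Otimes>\<^sub>M borel \<Otimes>\<^sub>M borel)"
    using Cons.prems by (intro measurable_bm_op g) auto
  have m1[measurable]: "(\<lambda>w. bm_op u L (g (fst w)) (snd w)) \<in> borel_measurable (K \<Otimes>\<^sub>M borel)"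
    using measurable_compose[OF _ m, of "\<lambda>w. (fst w, u, snd w)" "K \<Otimes>\<^sub>M borel"] by simp
  have m2[measurable]: "(\<lambda>p. bm_op u L (g p) y) \<in> borel_measurable K" for y
    using measurable_compose[OF _ m, of "\<lambda>w. (w, u, y)" K] by simp
  have IH: "bm_op s L (\<lambda>r z. \<integral>\<^sup>+p. g p r z \<partial>K) x = (\<integral>\<^sup>+p. bm_op s L (g p) x \<partial>K)" for s x
    using Cons.prems by (intro Cons.IH) auto
  have "bm_op s (a # L) (\<lambda>r z. \<integral>\<^sup>+p. g p r z \<partial>K) x =
    (\<integral>\<^sup>+y. ennreal (heat (u - s) (y - x)) * (f y * (\<integral>\<^sup>+p. bm_op u L (g p) y \<partial>K)) \<partial>lborel)"
    using IH by (simp add: a)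
  also have "\<dots> = (\<integral>\<^sup>+y. (\<integral>\<^sup>+p. ennreal (heat (u - s) (y - x)) * (f y * bm_op u L (g p) y) \<partial>K) \<partial>lborel)"
    by (simp add: nn_integral_cmult)
  also have "\<dots> = (\<integral>\<^sup>+p. (\<integral>\<^sup>+y. ennreal (heat (u - s) (y - x)) * (f y * bm_op u L (g p) y) \<partial>lborel) \<partial>K)"
    by (rule Fubini') measurable
  also have "\<dots> = (\<integral>\<^sup>+p. bm_op s (a # L) (g p) x \<partial>K)"
    by (simp add: a)
  finally show ?case .
qed

lemma bm_op_cmult:
  assumes L: "\<And>u f. (u, f) \<in> set L \<Longrightarrow> f \<in> borel_measurable borel"
    and g: "(\<lambda>(r, z). g r z) \<in> borel_measurable (borel \<Otimes>\<^sub>M borel)"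
  shows "bm_op s L (\<lambda>r z. g r z * c) x = bm_op s L g x * c"
  using L
proof (induction L arbitrary: s x)
  case Nil
  then show ?case by simp
next
  case (Cons a L)
  obtain u f where a: "a = (u, f)" by (cases a)
  have [measurable]: "f \<in> borel_measurable borel"
    using Cons.prems[of u f] a by auto
  \<comment> \<open>The parameter \<open>p\<close> is a dummy of type \<open>real\<close>, as
    \<open>g\<close> does not depend on it; the value 0 is put in below.\<close>
  have m: "(\<lambda>(p, s, x). bm_op s L (\<lambda>r z. g r z) x) \<in> borel_measurable ((borel :: real measure) \<Otimes>\<^sub>M borel \<Otimes>\<^sub>M borel)"
    using Cons.prems measurable_compose[OF measurable_snd g] by (intro measurable_bm_op) (auto simp: split_beta')
  have m1[measurable]: "(\<lambda>y. bm_op u L g y) \<in> borel_measurable borel"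
    using measurable_compose[OF _ m, of "\<lambda>w. (0, u, w)" borel] by simp
  have "bm_op s L (\<lambda>r z. g r z * c) x = bm_op s L g x * c" for s x
    using Cons.prems by (intro Cons.IH) auto
  then show ?case by (simp add: a nn_integral_multc[symmetric] mult.assoc)
qed

section \<open>Gaussian increments\<close>

text \<open>\<open>X s \<omega>\<close> is the limit of \<open>X (\<lfloor>n * s\<rfloor> / n) \<omega>\<close>, which involves countably many times only.\<close>
lemma measurable_continuous_process:
  fixes X :: "real \<Rightarrow> 'a \<Rightarrow> R3"
  assumes X[measurable]: "\<And>s. X s \<in> borel_measurable M"
    and cont: "\<And>\<omega>. \<omega> \<in> space M \<Longrightarrow> continuous_on UNIV (\<lambda>s. X s \<omega>)"
  shows "(\<lambda>(s, \<omega>). X s \<omega>) \<in> borel_measurable (borel \<Otimes>\<^sub>M M)"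
proof -
  let ?r = "\<lambda>n s. real_of_int \<lfloor>real (Suc n) * s\<rfloor> / real (Suc n)"
  have "(\<lambda>p. X (fst p) (snd p)) \<in> borel_measurable (borel \<Otimes>\<^sub>M M)"
  proof (rule borel_measurable_LIMSEQ_metric)
    show "(\<lambda>p. X (?r n (fst p)) (snd p)) \<in> borel_measurable (borel \<Otimes>\<^sub>M M)" for n
    proof -
      have "(\<lambda>p. (\<lambda>i p. X (real_of_int i / real (Suc n)) (snd p)) \<lfloor>real (Suc n) * fst p\<rfloor> p)
          \<in> borel_measurable (borel \<Otimes>\<^sub>M M)"
        by (rule measurable_compose_countable) measurable
      then show ?thesis by simp
    qed
  next
    fix p :: "real \<times> 'a" assume "p \<in> space (borel \<Otimes>\<^sub>M M)"
    then have "snd p \<in> space M" by (auto simp: space_pair_measure)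
    have "(\<lambda>n. ?r n (fst p)) \<longlonglongrightarrow> fst p"
    proof (rule LIMSEQ_I)
      fix e :: real assume "e > 0"
      then obtain n0 where n0: "1 / real (Suc n0) < e" using nat_approx_posE by blast
      show "\<exists>no. \<forall>n\<ge>no. norm (?r n (fst p) - fst p) < e"
      proof (intro exI allI impI)
        fix n assume "n \<ge> n0"
        have "norm (?r n (fst p) - fst p) = \<bar>(real_of_int \<lfloor>real (Suc n) * fst p\<rfloor> - real (Suc n) * fst p) / real (Suc n)\<bar>"
          by (simp add: diff_divide_distrib)
        also have "\<dots> = \<bar>real_of_int \<lfloor>real (Suc n) * fst p\<rfloor> - real (Suc n) * fst p\<bar> / real (Suc n)"
          by simp
        also have "\<dots> \<le> 1 / real (Suc n)"
        proof (intro divide_right_mono)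
          show "\<bar>real_of_int \<lfloor>real (Suc n) * fst p\<rfloor> - real (Suc n) * fst p\<bar> \<le> 1" by linarith
        qed simp
        also have "\<dots> \<le> 1 / real (Suc n0)" using \<open>n \<ge> n0\<close> by (intro divide_left_mono) auto
        finally show "norm (?r n (fst p) - fst p) < e" using n0 by linarith
      qed
    qed
    then show "(\<lambda>n. X (?r n (fst p)) (snd p)) \<longlonglongrightarrow> X (fst p) (snd p)"
      using continuous_on_tendsto_compose[OF cont[OF \<open>snd p \<in> space M\<close>]] by auto
  qed
  then show ?thesis by (simp add: split_beta')
qed

text \<open>The joint law is the product of the marginals, so Tonelli allows \<open>Y\<close> to be
  evaluated at an independent copy \<open>\<omega>'\<close> of the outcome. This freezes
  \<open>X\<close> while \<open>Y\<close> is integrated out.\<close>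

lemma (in prob_space) indep_var_nn_integral:
  assumes ind: "indep_var N1 X N2 Y" and F: "(\<lambda>(x, y). F x y) \<in> borel_measurable (N1 \<Otimes>\<^sub>M N2)"
  shows "(\<integral>\<^sup>+\<omega>. F (X \<omega>) (Y \<omega>) \<partial>M) = (\<integral>\<^sup>+\<omega>. (\<integral>\<^sup>+\<omega>'. F (X \<omega>) (Y \<omega>') \<partial>M) \<partial>M)"
proof -
  have X[measurable]: "X \<in> measurable M N1" and Y[measurable]: "Y \<in> measurable M N2"
    using ind by (auto dest: indep_var_rv1 indep_var_rv2)
  interpret X: prob_space "distr M N1 X" by (rule prob_space_distr) fact
  interpret Y: prob_space "distr M N2 Y" by (rule prob_space_distr) fact
  note F[measurable]
  have "(\<integral>\<^sup>+\<omega>. F (X \<omega>) (Y \<omega>) \<partial>M) = (\<integral>\<^sup>+p. F (fst p) (snd p) \<partial>distr M (N1 \<Otimes>\<^sub>M N2) (\<lambda>\<omega>. (X \<omega>, Y \<omega>)))"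
    by (subst nn_integral_distr) auto
  also have "\<dots> = (\<integral>\<^sup>+p. F (fst p) (snd p) \<partial>(distr M N1 X \<Otimes>\<^sub>M distr M N2 Y))"
    using ind by (simp add: indep_var_distribution_eq)
  also have "\<dots> = (\<integral>\<^sup>+x. (\<integral>\<^sup>+y. F x y \<partial>distr M N2 Y) \<partial>distr M N1 X)"
    by (subst Y.nn_integral_fst[symmetric]) (auto simp: split_beta')
  also have "\<dots> = (\<integral>\<^sup>+x. (\<integral>\<^sup>+\<omega>'. F x (Y \<omega>') \<partial>M) \<partial>distr M N1 X)"
    by (intro nn_integral_cong) (simp add: nn_integral_distr)
  also have "\<dots> = (\<integral>\<^sup>+\<omega>. (\<integral>\<^sup>+\<omega>'. F (X \<omega>) (Y \<omega>') \<partial>M) \<partial>M)"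
    by (subst nn_integral_distr) auto
  finally show ?thesis .
qed

lemma nn_integral_lborel_shift:
  fixes f :: "R3 \<Rightarrow> ennreal"
  assumes "f \<in> borel_measurable borel"
  shows "(\<integral>\<^sup>+y. f (c + y) \<partial>lborel) = (\<integral>\<^sup>+y. f y \<partial>lborel)"
  using assms by (subst lborel_distr_plus[symmetric, of c]) (simp add: nn_integral_distr)

section \<open>Products of test functions along a path\<close>

definition path_prod :: "(real \<times> (R3 \<Rightarrow> ennreal)) list \<Rightarrow> (real \<Rightarrow> R3) \<Rightarrow> ennreal" where
  "path_prod L w = (\<Prod>(u, f)\<leftarrow>L. f (w u))"

lemma path_prod_simps[simp]:
  "path_prod [] w = 1" "path_prod ((u, f) # L) w = f (w u) * path_prod L w"
  "path_prod (L @ L') w = path_prod L w * path_prod L' w"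
  by (auto simp: path_prod_def)

lemma path_prod_nth: "path_prod L w = (\<Prod>k<length L. snd (L ! k) (w (fst (L ! k))))"
  by (simp add: path_prod_def prod.list_conv_set_nth split_beta' atLeast0LessThan)

lemma measurable_path_prod:
  assumes "\<And>u f. (u, f) \<in> set L \<Longrightarrow> f \<in> borel_measurable borel \<and> (\<lambda>\<omega>. X \<omega> u) \<in> borel_measurable M"
  shows "(\<lambda>\<omega>. path_prod L (X \<omega>)) \<in> borel_measurable M"
  using assms
proof (induction L)
  case (Cons a L)
  obtain u f where a: "a = (u, f)" by (cases a)
  have [measurable]: "f \<in> borel_measurable borel" "(\<lambda>\<omega>. X \<omega> u) \<in> borel_measurable M"
    "(\<lambda>\<omega>. path_prod L (X \<omega>)) \<in> borel_measurable M"
    using Cons a by auto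
  show ?case by (simp add: a)
qed simp

text \<open>The total mass is read off from the law of a Brownian increment, whose density this is,
  instead of evaluating the Gaussian integral in three dimensions.\<close>

lemma nn_integral_heat:
  assumes "prob_space M" "gaussian_increments M X" "t > 0"
  shows "(\<integral>\<^sup>+y. heat t y \<partial>lborel) = 1"
proof -
  interpret prob_space M by fact
  have "distributed M lborel (\<lambda>\<omega>. X t \<omega> - X 0 \<omega>) (\<lambda>y. ennreal (heat (t - 0) y))"
    using assms unfolding gaussian_increments_def by blast
  from distributed_nn_integral[OF this, of "\<lambda>_. 1"] show ?thesis
    by (simp add: emeasure_space_1)
qed

text \<open>The Markov property at the last test time \<open>s\<close>: the tests and
  \<open>X s\<close> are functions of the increments up to \<open>s\<close>, which are independent
  of the increment from \<open>s\<close> to \<open>u\<close>. Integrating the latter against its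
  density leaves the heat kernel centred at \<open>X s\<close>.\<close>

lemma nn_integral_increment:
  assumes "prob_space M" and inc: "gaussian_increments M X"
    and X: "\<And>s. s \<ge> 0 \<Longrightarrow> X s \<in> borel_measurable M" and start: "AE \<omega> in M. X 0 \<omega> = x"
    and L: "\<And>u f. (u, f) \<in> set L \<Longrightarrow> f \<in> borel_measurable borel"
    and sorted: "sorted_wrt (<) (0 # map fst L @ [u])"
    and F[measurable]: "F \<in> borel_measurable borel"
  defines "s \<equiv> last (0 # map fst L)"
  shows "(\<integral>\<^sup>+\<omega>. path_prod L (\<lambda>r. X r \<omega>) * F (X u \<omega>) \<partial>M) =
    (\<integral>\<^sup>+\<omega>. path_prod L (\<lambda>r. X r \<omega>) * (\<integral>\<^sup>+y. ennreal (heat (u - s) (y - X s \<omega>)) * F y \<partial>lborel) \<partial>M)"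
proof -
  interpret prob_space M by fact
  define m where "m = length L"
  define r where "r k = (if k \<le> Suc m then (0 # map fst L @ [u]) ! k else 0)" for k
  define D where "D k \<omega> = X (r (Suc k)) \<omega> - X (r k) \<omega>" for k \<omega>
  have r0: "r 0 = 0" by (simp add: r_def)
  have rm: "r m = s"
    by (cases L rule: rev_cases) (auto simp: r_def s_def m_def nth_append nth_Cons')
  have rSm: "r (Suc m) = u" by (simp add: r_def m_def nth_append)
  have rk: "r (Suc k) = fst (L ! k)" if "k < m" for k
    using that by (simp add: r_def m_def nth_append)
  have r_mono: "strict_mono_on {..Suc m} r"
    unfolding strict_mono_on_def using sorted
    by (auto simp: sorted_wrt_iff_nth_less r_def m_def simp del: sorted_wrt.simps)
  have r_nonneg: "r k \<ge> 0" for k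
    using strict_mono_onD[OF r_mono, of 0 k] r0 by (cases "k = 0"; cases "k \<le> Suc m") (auto simp: r_def)
  have "s < u" using strict_mono_onD[OF r_mono, of m "Suc m"] rm rSm by simp
  have "s \<ge> 0" using r_nonneg[of m] rm by simp
  have [measurable]: "D k \<in> borel_measurable M" for k
    unfolding D_def using X r_nonneg by (intro borel_measurable_diff) auto
  have [measurable]: "X s \<in> borel_measurable M" using X \<open>s \<ge> 0\<close> by auto
  \<comment> \<open>Grouping independent variables yields families indexed by subsets, so the last
    increment appears below as a function on the singleton \<open>{m}\<close>, evaluated at
    \<open>m\<close>.\<close>
  have "indep_vars (\<lambda>_. borel) D {..<Suc m}"
    using inc r_mono r0 unfolding gaussian_increments_def D_def by auto
  then have ind: "indep_var (PiM {..<m} (\<lambda>_. borel)) (\<lambda>\<omega>. \<lambda>k\<in>{..<m}. D k \<omega>) (PiM {m} (\<lambda>_. borel)) (\<lambda>\<omega>. \<lambda>k\<in>{m}. D k \<omega>)"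
    by (rule indep_var_restrict) auto
  have dist: "distributed M lborel (D m) (\<lambda>y. ennreal (heat (u - s) y))"
    using inc \<open>s < u\<close> \<open>s \<ge> 0\<close> unfolding gaussian_increments_def D_def[abs_def] rm rSm by auto
  have tele: "X (r k) \<omega> = X 0 \<omega> + (\<Sum>i<k. D i \<omega>)" for k \<omega>
    using sum_lessThan_telescope[of "\<lambda>k. X (r k) \<omega>" k] by (simp add: D_def r0)
  \<comment> \<open>The product of the tests as a function of the increments alone: the path at the
    \<open>k\<close>-th test time is \<open>x\<close> plus the first \<open>Suc k\<close>
    increments.\<close>
  define \<Phi> where "\<Phi> y = (\<Prod>k<m. snd (L ! k) (x + (\<Sum>i<Suc k. y i)))" for y :: "nat \<Rightarrow> R3"
  have [measurable]: "snd (L ! k) \<in> borel_measurable borel" if "k < m" for k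
    using L[of "fst (L ! k)" "snd (L ! k)"] that by (simp add: m_def)
  have \<Phi>[measurable]: "\<Phi> \<in> borel_measurable (PiM {..<m} (\<lambda>_. borel))"
  proof -
    have "(\<lambda>y. \<Sum>i<Suc k. y i) \<in> borel_measurable (PiM {..<m} (\<lambda>_. borel :: R3 measure))" if "k < m" for k
      using that by (intro borel_measurable_sum measurable_component_singleton) auto
    then have "(\<lambda>y. snd (L ! k) (x + (\<Sum>i<Suc k. y i))) \<in> borel_measurable (PiM {..<m} (\<lambda>_. borel))" if "k < m" for k
      using that by (intro measurable_compose[OF borel_measurable_add, where g="snd (L ! k)"]) auto
    then show ?thesis
      unfolding \<Phi>_def[abs_def] by (intro borel_measurable_prod_ennreal) auto
  qed
  have [measurable]: "(\<lambda>y. x + (\<Sum>i<m. y i)) \<in> borel_measurable (PiM {..<m} (\<lambda>_. borel :: R3 measure))"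
    by (intro borel_measurable_add borel_measurable_sum measurable_component_singleton) auto
  define Y where "Y \<omega> = (\<lambda>k\<in>{..<m}. D k \<omega>)" for \<omega>
  have sumY: "(\<Sum>i<k. Y \<omega> i) = (\<Sum>i<k. D i \<omega>)" if "k \<le> m" for k \<omega>
    using that by (intro sum.cong) (auto simp: Y_def)
  have AE: "AE \<omega> in M. path_prod L (\<lambda>r. X r \<omega>) = \<Phi> (Y \<omega>) \<and> X s \<omega> = x + (\<Sum>i<m. Y \<omega> i) \<and>
      X u \<omega> = x + (\<Sum>i<m. Y \<omega> i) + D m \<omega>"
    using start
  proof eventually_elim
    case (elim \<omega>)
    have "path_prod L (\<lambda>r. X r \<omega>) = (\<Prod>k<m. snd (L ! k) (X (r (Suc k)) \<omega>))"
      by (simp add: path_prod_nth m_def[symmetric] rk)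
    also have "\<dots> = \<Phi> (Y \<omega>)"
      unfolding \<Phi>_def tele elim by (intro prod.cong refl) (subst sumY, auto)
    finally have 1: "path_prod L (\<lambda>r. X r \<omega>) = \<Phi> (Y \<omega>)" .
    have 2: "X s \<omega> = x + (\<Sum>i<m. Y \<omega> i)"
      unfolding rm[symmetric] tele elim by (subst sumY) auto
    have "X u \<omega> = X s \<omega> + D m \<omega>"
      by (simp add: D_def rm rSm)
    with 1 2 show ?case by simp
  qed
  have "(\<integral>\<^sup>+\<omega>. path_prod L (\<lambda>r. X r \<omega>) * F (X u \<omega>) \<partial>M) =
     (\<integral>\<^sup>+\<omega>. \<Phi> (Y \<omega>) * F (x + (\<Sum>i<m. Y \<omega> i) + (\<lambda>k\<in>{m}. D k \<omega>) m) \<partial>M)"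
    by (rule nn_integral_cong_AE) (use AE in eventually_elim, simp)
  also have "\<dots> = (\<integral>\<^sup>+\<omega>. (\<integral>\<^sup>+\<omega>'. \<Phi> (Y \<omega>) * F (x + (\<Sum>i<m. Y \<omega> i) + (\<lambda>k\<in>{m}. D k \<omega>') m) \<partial>M) \<partial>M)"
    unfolding Y_def
  proof (rule indep_var_nn_integral[OF ind])
    have [measurable]: "(\<lambda>z. z m) \<in> borel_measurable (PiM {m} (\<lambda>_. borel :: R3 measure))"
      by (rule measurable_component_singleton) auto
    show "(\<lambda>(y, z). \<Phi> y * F (x + (\<Sum>i<m. y i) + z m)) \<in> borel_measurable (PiM {..<m} (\<lambda>_. borel) \<Otimes>\<^sub>M PiM {m} (\<lambda>_. borel))"
      by measurable
  qed
  also have "\<dots> = (\<integral>\<^sup>+\<omega>. \<Phi> (Y \<omega>) * (\<integral>\<^sup>+y. ennreal (heat (u - s) (y - (x + (\<Sum>i<m. Y \<omega> i)))) * F y \<partial>lborel) \<partial>M)"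
  proof (rule nn_integral_cong)
    fix \<omega>
    let ?c = "x + (\<Sum>i<m. Y \<omega> i)"
    have "(\<integral>\<^sup>+\<omega>'. \<Phi> (Y \<omega>) * F (?c + (\<lambda>k\<in>{m}. D k \<omega>') m) \<partial>M) = \<Phi> (Y \<omega>) * (\<integral>\<^sup>+\<omega>'. F (?c + D m \<omega>') \<partial>M)"
      by (simp add: nn_integral_cmult)
    also have "(\<integral>\<^sup>+\<omega>'. F (?c + D m \<omega>') \<partial>M) = (\<integral>\<^sup>+y. ennreal (heat (u - s) y) * F (?c + y) \<partial>lborel)"
      by (rule distributed_nn_integral[OF dist, symmetric]) simp
    also have "\<dots> = (\<integral>\<^sup>+y. ennreal (heat (u - s) ((?c + y) - ?c)) * F (?c + y) \<partial>lborel)"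
      by simp
    also have "\<dots> = (\<integral>\<^sup>+y. ennreal (heat (u - s) (y - ?c)) * F y \<partial>lborel)"
      by (rule nn_integral_lborel_shift) simp
    finally show "(\<integral>\<^sup>+\<omega>'. \<Phi> (Y \<omega>) * F (?c + (\<lambda>k\<in>{m}. D k \<omega>') m) \<partial>M) =
      \<Phi> (Y \<omega>) * (\<integral>\<^sup>+y. ennreal (heat (u - s) (y - ?c)) * F y \<partial>lborel)" .
  qed
  also have "\<dots> = (\<integral>\<^sup>+\<omega>. path_prod L (\<lambda>r. X r \<omega>) * (\<integral>\<^sup>+y. ennreal (heat (u - s) (y - X s \<omega>)) * F y \<partial>lborel) \<partial>M)"
    by (rule nn_integral_cong_AE) (use AE in eventually_elim, simp)
  finally show ?thesis .
qed

text \<open>The last test is integrated out and becomes part of the terminal function. Hence the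
  induction removes tests from the end and keeps \<open>g\<close> arbitrary.\<close>

lemma gaussian_increments_bm_op:
  assumes "prob_space M" and "gaussian_increments M X"
    and "\<And>s. s \<ge> 0 \<Longrightarrow> X s \<in> borel_measurable M" and "AE \<omega> in M. X 0 \<omega> = x"
    and "\<And>u f. (u, f) \<in> set L \<Longrightarrow> f \<in> borel_measurable borel"
    and "sorted_wrt (<) (0 # map fst L)"
    and "\<And>r. g r \<in> borel_measurable borel"
  shows "(\<integral>\<^sup>+\<omega>. path_prod L (\<lambda>r. X r \<omega>) * g (last (0 # map fst L)) (X (last (0 # map fst L)) \<omega>) \<partial>M) = bm_op 0 L g x"
  using assms(5-)
proof (induction L arbitrary: g rule: rev_induct)
  case Nil
  interpret prob_space M by fact
  have "(\<integral>\<^sup>+\<omega>. g 0 (X 0 \<omega>) \<partial>M) = (\<integral>\<^sup>+\<omega>. g 0 x \<partial>M)"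
    by (rule nn_integral_cong_AE) (use assms(4) in eventually_elim, simp)
  then show ?case by (simp add: emeasure_space_1)
next
  case (snoc a L)
  obtain u f where a: "a = (u, f)" by (cases a)
  note [measurable] = snoc.prems(3)
  have f[measurable]: "f \<in> borel_measurable borel" and L: "\<And>u f. (u, f) \<in> set L \<Longrightarrow> f \<in> borel_measurable borel"
    using snoc.prems(1) a by auto
  have sorted: "sorted_wrt (<) (0 # map fst L @ [u])" "sorted_wrt (<) (0 # map fst L)"
    using snoc.prems(2) a by (auto simp: sorted_wrt_append)
  let ?g = "\<lambda>r z. \<integral>\<^sup>+y. ennreal (heat (u - r) (y - z)) * (f y * g u y) \<partial>lborel"
  have "(\<integral>\<^sup>+\<omega>. path_prod (L @ [a]) (\<lambda>r. X r \<omega>) * g (last (0 # map fst (L @ [a]))) (X (last (0 # map fst (L @ [a]))) \<omega>) \<partial>M)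
     = (\<integral>\<^sup>+\<omega>. path_prod L (\<lambda>r. X r \<omega>) * (f (X u \<omega>) * g u (X u \<omega>)) \<partial>M)"
    by (simp add: a mult.assoc)
  also have "\<dots> = (\<integral>\<^sup>+\<omega>. path_prod L (\<lambda>r. X r \<omega>) * ?g (last (0 # map fst L)) (X (last (0 # map fst L)) \<omega>) \<partial>M)"
    by (rule nn_integral_increment[OF assms(1-4)]) (use L sorted in auto)
  also have "\<dots> = bm_op 0 L ?g x"
    by (rule snoc.IH) (use L sorted in auto)
  also have "\<dots> = bm_op 0 (L @ [a]) g x"
    by (simp add: bm_op_append a)
  finally show ?case .
qed

section \<open>Wiener measure on path space\<close>

lemma space_path_space: "space path_space = {w \<in> extensional {0..}. continuous_on {0..} w}"
  by (auto simp: path_space_def space_restrict_space space_PiM PiE_def)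

lemma measurable_path_space_eval: "s \<ge> 0 \<Longrightarrow> (\<lambda>w. w s) \<in> borel_measurable path_space"
  unfolding path_space_def by (intro measurable_restrict_space1 measurable_component_singleton) auto

lemma measurable_path_spaceI:
  assumes "\<And>s. s \<ge> 0 \<Longrightarrow> (\<lambda>\<omega>. Y \<omega> s) \<in> borel_measurable M"
    and "\<And>\<omega>. \<omega> \<in> space M \<Longrightarrow> Y \<omega> \<in> extensional {0..} \<and> continuous_on {0..} (Y \<omega>)"
  shows "Y \<in> M \<rightarrow>\<^sub>M path_space"
  unfolding path_space_def
proof (rule measurable_restrict_space2)
  show "Y \<in> space M \<rightarrow> {w. continuous_on {0..} w}" using assms(2) by auto
  show "Y \<in> M \<rightarrow>\<^sub>M PiM {0..} (\<lambda>_. borel)"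
    by (rule measurable_PiM_single') (use assms in \<open>auto simp: PiE_def\<close>)
qed

text \<open>Time is clamped at 0 because an extensional path equals \<open>undefined\<close> at
  negative times and may jump at 0, whereas \<open>measurable_continuous_process\<close> asks for
  continuity on the whole line.\<close>

lemma measurable_path_space_process:
  "(\<lambda>(s, w). w (max 0 s)) \<in> borel_measurable (borel \<Otimes>\<^sub>M path_space)"
proof (rule measurable_continuous_process)
  show "(\<lambda>w. w (max 0 s)) \<in> borel_measurable path_space" for s :: real
    by (rule measurable_path_space_eval) auto
  show "continuous_on UNIV (\<lambda>s. w (max 0 s))" if "w \<in> space path_space" for w
    by (rule continuous_on_compose2[of "{0..}" w UNIV "\<lambda>s. max 0 s"])
      (use that in \<open>auto simp: space_path_space intro!: continuous_on_max continuous_on_const continuous_on_id\<close>)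
qed

text \<open>Finite-dimensional distributions determine a measure on the cylinder sigma-algebra. Test
  times are strictly positive, as required by the heat kernels; the coordinate at time 0 is handled
  by the common deterministic starting point.\<close>

lemma path_measure_eqI:
  assumes p1: "prob_space \<mu>1" and p2: "prob_space \<mu>2"
    and s1: "sets \<mu>1 = sets path_space" and s2: "sets \<mu>2 = sets path_space"
    and start1: "AE w in \<mu>1. w 0 = x" and start2: "AE w in \<mu>2. w 0 = x"
    and eq: "\<And>L. sorted_wrt (<) (0 # map fst L) \<Longrightarrow> (\<And>u f. (u, f) \<in> set L \<Longrightarrow> f \<in> borel_measurable borel) \<Longrightarrow>
      (\<integral>\<^sup>+w. path_prod L w \<partial>\<mu>1) = (\<integral>\<^sup>+w. path_prod L w \<partial>\<mu>2)"
  shows "\<mu>1 = \<mu>2"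
proof (rule measure_eqI)
  let ?P = "PiM {0..} (\<lambda>_. borel) :: (real \<Rightarrow> R3) measure"
  let ?\<Omega> = "{w. continuous_on {0..} w} :: (real \<Rightarrow> R3) set"
  have m: "(\<lambda>w. w) \<in> \<mu> \<rightarrow>\<^sub>M ?P" if "sets \<mu> = sets path_space" for \<mu>
    unfolding measurable_cong_sets[OF that refl] path_space_def
    by (rule measurable_restrict_space1) auto
  have sp: "space \<mu> = space ?P \<inter> ?\<Omega>" if "sets \<mu> = sets path_space" for \<mu>
    using sets_eq_imp_space_eq[OF that] by (simp add: path_space_def space_restrict_space Int_commute)
  \<comment> \<open>A cylinder probability is the integral of a product of indicator tests; a
    constraint at time 0 becomes a constant factor depending on \<open>x\<close> only.\<close>
  have cyl: "emeasure \<mu> (prod_emb {0..} (\<lambda>_. borel) J (Pi\<^sub>E J A) \<inter> ?\<Omega>) =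
      indicator {y. 0 \<in> J \<longrightarrow> y \<in> A 0} x * (\<integral>\<^sup>+w. path_prod (map (\<lambda>j. (j, indicator (A j))) (sorted_list_of_set (J - {0}))) w \<partial>\<mu>)"
    if s: "sets \<mu> = sets path_space" and start: "AE w in \<mu>. w 0 = x" and J: "finite J" "J \<subseteq> {0..}" and A: "\<And>j. j \<in> J \<Longrightarrow> A j \<in> sets borel"
    for \<mu> J and A :: "real \<Rightarrow> R3 set"
  proof -
    let ?E = "prod_emb {0..} (\<lambda>_. borel) J (Pi\<^sub>E J A)"
    let ?L = "map (\<lambda>j. (j, indicator (A j) :: R3 \<Rightarrow> ennreal)) (sorted_list_of_set (J - {0}))"
    have E: "?E \<in> sets ?P" using J A by (intro sets_PiM_I) auto
    have [measurable]: "?E \<inter> ?\<Omega> \<in> sets \<mu>"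
      unfolding s path_space_def sets_restrict_space using E by (auto simp: image_iff)
    have [measurable]: "(\<lambda>w. path_prod ?L w) \<in> borel_measurable \<mu>"
      unfolding measurable_cong_sets[OF s refl]
      by (rule measurable_path_prod) (use J A in \<open>auto intro!: measurable_path_space_eval borel_measurable_indicator\<close>)
    have prod: "path_prod ?L w = indicator {w. \<forall>j\<in>J - {0}. w j \<in> A j} w" for w
    proof -
      have "path_prod ?L w = (\<Prod>j\<leftarrow>sorted_list_of_set (J - {0}). indicator (A j) (w j))"
        by (simp add: path_prod_def comp_def)
      also have "\<dots> = (\<Prod>j\<in>J - {0}. indicator (A j) (w j))"
        by (subst prod.distinct_set_conv_list[symmetric]) (use J in auto)
      also have "\<dots> = indicator {w. \<forall>j\<in>J - {0}. w j \<in> A j} w"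
        using J by (auto simp: indicator_def)
      finally show ?thesis .
    qed
    have "emeasure \<mu> (?E \<inter> ?\<Omega>) = (\<integral>\<^sup>+w. indicator (?E \<inter> ?\<Omega>) w \<partial>\<mu>)"
      by simp
    also have "\<dots> = (\<integral>\<^sup>+w. indicator {y. 0 \<in> J \<longrightarrow> y \<in> A 0} x * path_prod ?L w \<partial>\<mu>)"
    proof (rule nn_integral_cong_AE)
      show "AE w in \<mu>. indicator (?E \<inter> ?\<Omega>) w = indicator {y. 0 \<in> J \<longrightarrow> y \<in> A 0} x * path_prod ?L w"
        using start AE_space
      proof eventually_elim
        case (elim w)
        then have w: "w \<in> extensional {0..}" "w \<in> ?\<Omega>" by (auto simp: sp[OF s] space_PiM PiE_def)
        then have "w \<in> ?E \<longleftrightarrow> (\<forall>j\<in>J. w j \<in> A j)"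
          using J by (auto simp: prod_emb_def PiE_def Pi_iff)
        also have "\<dots> \<longleftrightarrow> (0 \<in> J \<longrightarrow> x \<in> A 0) \<and> (\<forall>j\<in>J - {0}. w j \<in> A j)"
          using elim by auto
        finally show ?case using w(2) unfolding prod by (auto simp: indicator_def)
      qed
    qed
    also have "\<dots> = indicator {y. 0 \<in> J \<longrightarrow> y \<in> A 0} x * (\<integral>\<^sup>+w. path_prod ?L w \<partial>\<mu>)"
      by (rule nn_integral_cmult) measurable
    finally show ?thesis .
  qed
  \<comment> \<open>The uniqueness theorem for infinite products concerns the full product space.
    Both measures are pushed there along the inclusion, and their values on path space are recovered
    as traces.\<close>
  have distr_eq: "distr \<mu>1 ?P (\<lambda>w. w) = distr \<mu>2 ?P (\<lambda>w. w)"
  proof (rule measure_eqI_PiM_infinite)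
    interpret distr: prob_space "distr \<mu>1 ?P (\<lambda>w. w)"
      by (rule prob_space.prob_space_distr[OF p1 m[OF s1]])
    show "finite_measure (distr \<mu>1 ?P (\<lambda>w. w))" by (rule distr.finite_measure_axioms)
    fix A :: "real \<Rightarrow> R3 set" and J assume J: "finite J" "J \<subseteq> {0::real..}" and A: "\<And>j. j \<in> J \<Longrightarrow> A j \<in> sets borel"
    let ?E = "prod_emb {0..} (\<lambda>_. borel) J (Pi\<^sub>E J A)"
    have E: "?E \<in> sets ?P" using J A by (intro sets_PiM_I) auto
    have *: "emeasure (distr \<mu> ?P (\<lambda>w. w)) ?E = emeasure \<mu> (?E \<inter> ?\<Omega>)" if "sets \<mu> = sets path_space" for \<mu>
      using sets.sets_into_space[OF E, THEN subsetD]
      by (subst emeasure_distr[OF m[OF that] E]) (auto simp: sp[OF that] intro!: arg_cong[where f="emeasure \<mu>"])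
    let ?L = "map (\<lambda>j. (j, indicator (A j) :: R3 \<Rightarrow> ennreal)) (sorted_list_of_set (J - {0}))"
    have "sorted_wrt (<) (sorted_list_of_set (J - {0}))"
      by (rule sorted_list_of_set.strict_sorted_key_list_of_set)
    then have "sorted_wrt (<) (0 # map fst ?L)"
      using J by (auto simp: comp_def order.strict_iff_order)
    then have "(\<integral>\<^sup>+w. path_prod ?L w \<partial>\<mu>1) = (\<integral>\<^sup>+w. path_prod ?L w \<partial>\<mu>2)"
      by (rule eq) (use J A in auto)
    then show "emeasure (distr \<mu>1 ?P (\<lambda>w. w)) ?E = emeasure (distr \<mu>2 ?P (\<lambda>w. w)) ?E"
      using cyl[OF s1 start1 J, of A] cyl[OF s2 start2 J, of A] A
      by (simp add: *[OF s1] *[OF s2])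
  qed auto
  show "sets \<mu>1 = sets \<mu>2" using s1 s2 by simp
  fix A assume "A \<in> sets \<mu>1"
  then obtain A' where A': "A' \<in> sets ?P" "A = A' \<inter> ?\<Omega>"
    unfolding s1 path_space_def sets_restrict_space by auto
  have "emeasure (distr \<mu> ?P (\<lambda>w. w)) A' = emeasure \<mu> A" if "sets \<mu> = sets path_space" for \<mu>
    using sets.sets_into_space[OF A'(1)]
    by (subst emeasure_distr[OF m[OF that] A'(1)]) (auto simp: sp[OF that] A'(2) intro!: arg_cong[where f="emeasure \<mu>"])
  from this[OF s1] this[OF s2] distr_eq show "emeasure \<mu>1 A = emeasure \<mu>2 A" by simp
qed

lemma is_wiener_unique:
  assumes "is_wiener x \<mu>1" "is_wiener x \<mu>2"
  shows "\<mu>1 = \<mu>2"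
proof -
  have op: "(\<integral>\<^sup>+w. path_prod L w \<partial>\<mu>) = bm_op 0 L (\<lambda>_ _. 1) x"
    if \<mu>: "is_wiener x \<mu>" and L: "sorted_wrt (<) (0 # map fst L)" "\<And>u f. (u, f) \<in> set L \<Longrightarrow> f \<in> borel_measurable borel" for \<mu> L
  proof -
    have s: "sets \<mu> = sets path_space" using \<mu> by (simp add: is_wiener_def)
    show ?thesis
      using gaussian_increments_bm_op[of \<mu> "\<lambda>s w. w s" x L "\<lambda>_ _. 1"] \<mu> L measurable_path_space_eval
      by (auto simp: is_wiener_def measurable_cong_sets[OF s refl])
  qed
  show ?thesis
    by (rule path_measure_eqI[where x=x]) (use assms op in \<open>auto simp: is_wiener_def\<close>)
qed

text \<open>Independence says that the joint law is a product, and the joint law of \<open>X\<close>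
  under the image measure is that of the composites under \<open>M\<close>. This characterisation
  needs a nonempty index set.\<close>

lemma indep_vars_distr:
  assumes M: "prob_space M" and Y: "Y \<in> M \<rightarrow>\<^sub>M N" and I: "I \<noteq> {}"
    and X: "\<And>i. i \<in> I \<Longrightarrow> X i \<in> N \<rightarrow>\<^sub>M K i"
    and ind: "prob_space.indep_vars M K (\<lambda>i \<omega>. X i (Y \<omega>)) I"
  shows "prob_space.indep_vars (distr M N Y) K X I"
proof -
  interpret M: prob_space M by fact
  interpret D: prob_space "distr M N Y" by (rule M.prob_space_distr) fact
  have m: "(\<lambda>x. \<lambda>i\<in>I. X i x) \<in> N \<rightarrow>\<^sub>M PiM I K"
    using X by (intro measurable_restrict) auto
  have "distr M (PiM I K) (\<lambda>\<omega>. \<lambda>i\<in>I. X i (Y \<omega>)) = PiM I (\<lambda>i. distr M (K i) (\<lambda>\<omega>. X i (Y \<omega>)))"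
    using ind X by (subst M.indep_vars_iff_distr_eq_PiM'[symmetric, OF I]) (auto intro: measurable_compose[OF Y])
  then have "distr (distr M N Y) (PiM I K) (\<lambda>x. \<lambda>i\<in>I. X i x) = PiM I (\<lambda>i. distr (distr M N Y) (K i) (X i))"
    using distr_distr[OF m Y] distr_distr[OF X Y] by (simp add: comp_def cong: PiM_cong)
  then show ?thesis
    using X by (subst D.indep_vars_iff_distr_eq_PiM'[OF I]) auto
qed

lemma gaussian_increments_distr:
  assumes M: "prob_space M" and Y: "Y \<in> M \<rightarrow>\<^sub>M path_space"
    and inc: "gaussian_increments M B"
    and eq: "\<And>s u \<omega>. 0 \<le> s \<Longrightarrow> 0 \<le> u \<Longrightarrow> Y \<omega> u - Y \<omega> s = B u \<omega> - B s \<omega>"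
  shows "gaussian_increments (distr M path_space Y) (\<lambda>s w. w s)"
  unfolding gaussian_increments_def
proof (intro conjI allI impI)
  interpret M: prob_space M by fact
  interpret D: prob_space "distr M path_space Y" by (rule M.prob_space_distr) fact
  note ev = measurable_path_space_eval
  have diff: "(\<lambda>w. w u - w s) \<in> borel_measurable path_space" if "0 \<le> s" "0 \<le> u" for s u
    using that by (intro borel_measurable_diff ev)
  {
    fix s u :: real assume su: "0 \<le> s \<and> s < u"
    have "distributed M lborel (\<lambda>\<omega>. B u \<omega> - B s \<omega>) (\<lambda>y. ennreal (heat (u - s) y))"
      using inc su unfolding gaussian_increments_def by blast
    then show "distributed (distr M path_space Y) lborel (\<lambda>w. w u - w s) (\<lambda>y. ennreal (heat (u - s) y))"
      unfolding distributed_def using su diff[of s u] eq[of s u]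
      by (subst distr_distr[OF _ Y]) (auto simp: comp_def)
  next
    fix n and r :: "nat \<Rightarrow> real" assume r: "0 \<le> r 0 \<and> strict_mono_on {..n} r"
    have nonneg: "r k \<ge> 0" if "k \<le> n" for k
      using r strict_mono_onD[of "{..n}" r 0 k] that by (cases "k = 0") auto
    show "D.indep_vars (\<lambda>_. borel) (\<lambda>k w. w (r (Suc k)) - w (r k)) {..<n}"
    proof (cases "n = 0")
      case False
      have "M.indep_vars (\<lambda>_. borel) (\<lambda>k \<omega>. B (r (Suc k)) \<omega> - B (r k) \<omega>) {..<n}"
        using inc r unfolding gaussian_increments_def by blast
      then have "M.indep_vars (\<lambda>_. borel) (\<lambda>k \<omega>. Y \<omega> (r (Suc k)) - Y \<omega> (r k)) {..<n}"
        by (rule M.indep_vars_cong[THEN iffD1, rotated -1]) (use nonneg eq in auto)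
      then show ?thesis
        by (intro indep_vars_distr[OF M Y]) (use False nonneg diff in auto)
    qed (auto simp: D.indep_vars_def2 D.indep_sets_def)
  }
qed

lemma is_wiener_brownian_motion:
  assumes B: "standard_brownian_motion M B"
  shows "(\<lambda>\<omega>. \<lambda>s\<in>{0..}. x + B s \<omega>) \<in> M \<rightarrow>\<^sub>M path_space"
    and "is_wiener x (distr M path_space (\<lambda>\<omega>. \<lambda>s\<in>{0..}. x + B s \<omega>))"
proof -
  let ?Y = "\<lambda>\<omega>. \<lambda>s\<in>{0..}. x + B s \<omega>"
  interpret M: prob_space M using B by (simp add: standard_brownian_motion_def)
  show Y: "?Y \<in> M \<rightarrow>\<^sub>M path_space"
  proof (rule measurable_path_spaceI)
    show "(\<lambda>\<omega>. ?Y \<omega> s) \<in> borel_measurable M" if "s \<ge> 0" for s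
      using B that by (auto simp: standard_brownian_motion_def)
    fix \<omega> assume "\<omega> \<in> space M"
    then have "continuous_on {0..} (\<lambda>s. x + B s \<omega>)"
      using B by (auto simp: standard_brownian_motion_def intro!: continuous_intros)
    then show "?Y \<omega> \<in> extensional {0..} \<and> continuous_on {0..} (?Y \<omega>)"
      by (auto elim!: continuous_on_eq)
  qed
  show "is_wiener x (distr M path_space ?Y)"
    unfolding is_wiener_def
  proof (intro conjI)
    show "prob_space (distr M path_space ?Y)" by (rule M.prob_space_distr) (rule Y)
    show "gaussian_increments (distr M path_space ?Y) (\<lambda>s w. w s)"
      using B by (intro gaussian_increments_distr[OF M.prob_space_axioms Y]) (auto simp: standard_brownian_motion_def)
    have [measurable]: "(\<lambda>w. w 0) \<in> borel_measurable path_space" by (rule measurable_path_space_eval) simp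
    show "AE w in distr M path_space ?Y. w 0 = x"
      using B by (subst AE_distr_iff[OF Y]) (auto simp: standard_brownian_motion_def)
  qed simp
qed

lemma wiener_eq_distr:
  assumes "standard_brownian_motion M B"
  shows "wiener x = distr M path_space (\<lambda>\<omega>. \<lambda>s\<in>{0..}. x + B s \<omega>)"
  unfolding wiener_def
  by (rule the_equality) (use is_wiener_brownian_motion[OF assms] is_wiener_unique in auto)

lemma is_wiener_wiener:
  assumes "standard_brownian_motion M B"
  shows "is_wiener x (wiener x)"
  unfolding wiener_eq_distr[OF assms] by (rule is_wiener_brownian_motion) fact

section \<open>The Feynman--Kac series\<close>

lemma measurable_path_space_eval_joint:
  "(\<lambda>(s, w). w s) \<in> borel_measurable (borel \<Otimes>\<^sub>M path_space)"
proof -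
  have [measurable]: "(\<lambda>p. snd p (max 0 (fst p))) \<in> borel_measurable (borel \<Otimes>\<^sub>M path_space)"
    using measurable_path_space_process by (simp add: split_beta')
  \<comment> \<open>At negative times an extensional path takes the value \<open>undefined\<close>,
    so evaluation is constant there and clamped evaluation covers the rest.\<close>
  have "(\<lambda>p. if fst p \<ge> 0 then snd p (max 0 (fst p)) else undefined) \<in> borel_measurable (borel \<Otimes>\<^sub>M path_space)"
    by measurable
  then show ?thesis
    by (rule measurable_cong[THEN iffD1, rotated])
      (auto simp: space_pair_measure space_path_space extensional_def max_def)
qed

lemma measurable_path_prod_path_space:
  assumes "\<And>u f. (u, f) \<in> set L \<Longrightarrow> 0 \<le> u \<and> f \<in> borel_measurable borel"
  shows "(\<lambda>w. path_prod L w) \<in> borel_measurable path_space"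
  by (rule measurable_path_prod) (use assms measurable_path_space_eval in auto)

lemma sorted_wrt_less_last:
  fixes xs :: "'a :: linorder list"
  assumes "sorted_wrt (<) xs" "x \<in> set xs"
  shows "x \<le> last xs"
  using assms by (cases xs rule: rev_cases) (auto simp: sorted_wrt_append)

lemma sorted_wrt_less_append_last:
  fixes xs :: "'a :: linorder list"
  assumes "sorted_wrt (<) xs" "sorted_wrt (<) ys" "\<And>y. y \<in> set ys \<Longrightarrow> last xs < y"
  shows "sorted_wrt (<) (xs @ ys)"
  unfolding sorted_wrt_append
  using assms sorted_wrt_less_last[OF assms(1)] by (auto intro: order.strict_trans1)

lemma sorted_map_filter: "sorted_wrt (<) (map f xs) \<Longrightarrow> sorted_wrt (<) (map f (filter P xs))"
  by (simp add: sorted_wrt_map sorted_wrt_filter)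

text \<open>Splits the pending tests at the next point \<open>u\<close>. A test exactly at
  \<open>u\<close> would be lost on the right-hand side, hence the last hypothesis.\<close>

lemma filter_sorted_split:
  fixes u :: "'a :: linorder"
  assumes "sorted_wrt (<) (map fst L)" "s < u" "u \<notin> fst ` set L"
  shows "filter (\<lambda>p. s < fst p) L = filter (\<lambda>p. s < fst p \<and> fst p < u) L @ filter (\<lambda>p. u < fst p) L"
  using assms
proof (induction L)
  case (Cons a L)
  then have *: "sorted_wrt (<) (map fst L)" "u \<notin> fst ` set L" by auto
  show ?case
  proof (cases "fst a < u")
    case True
    then show ?thesis using Cons.IH[OF * (1) Cons.prems(2) * (2)] by auto
  next
    case False
    then have u: "u < fst a" using Cons.prems(3) by auto
    then have "u < fst p" if "p \<in> set (a # L)" for p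
      using Cons.prems(1) that by (auto intro: order.strict_trans)
    moreover from this have "s < fst p" if "p \<in> set (a # L)" for p
      using that Cons.prems(2) by (meson order.strict_trans)
    ultimately have "filter (\<lambda>p. s < fst p) (a # L) = a # L" "filter (\<lambda>p. u < fst p) (a # L) = a # L"
      "filter (\<lambda>p. s < fst p \<and> fst p < u) (a # L) = []"
      unfolding filter_id_conv filter_empty_conv by (blast dest: order.asym)+
    then show ?thesis by simp
  qed
qed simp

abbreviation tests_after :: "real \<Rightarrow> (real \<times> 'b) list \<Rightarrow> (real \<times> 'b) list" where
  "tests_after s L \<equiv> filter (\<lambda>p. s < fst p) L"

abbreviation tests_between :: "real \<Rightarrow> real \<Rightarrow> (real \<times> 'b) list \<Rightarrow> (real \<times> 'b) list" where
  "tests_between s u L \<equiv> filter (\<lambda>p. s < fst p \<and> fst p < u) L"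

abbreviation heat_to :: "real \<Rightarrow> R3 \<Rightarrow> real \<Rightarrow> R3 \<Rightarrow> ennreal" where
  "heat_to u y \<equiv> \<lambda>r z. ennreal (heat (u - r) (y - z))"

text \<open>The \<open>n\<close>-th term of the series for the path started at \<open>x\<close> at time \<open>s\<close>, without the coupling and
  tested against the part of \<open>L\<close> after \<open>s\<close>. The integration variable \<open>u\<close> is the next point; the tests
  between \<open>s\<close> and \<open>u\<close> are inserted in the transition from \<open>s\<close> to \<open>u\<close>.\<close>
fun dyson :: "(R3 \<Rightarrow> ennreal) \<Rightarrow> real \<Rightarrow> (real \<times> (R3 \<Rightarrow> ennreal)) list \<Rightarrow> nat \<Rightarrow> real \<Rightarrow> R3 \<Rightarrow> ennreal"
where
  "dyson q t L 0 s x = bm_op s (tests_after s L) (\<lambda>_ _. 1) x"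
| "dyson q t L (Suc m) s x =
    (\<integral>\<^sup>+u. indicator {s<..<t} u * (\<integral>\<^sup>+y.
      bm_op s (tests_between s u L) (heat_to u y) x *
      (q y * dyson q t L m u y) \<partial>lborel) \<partial>lborel)"

text \<open>The integral of the product of the \<open>q (w u)\<close> over \<open>m\<close> ordered
  times in the open interval from \<open>s\<close> to \<open>t\<close>, in the recursive form that
  mirrors \<open>dyson\<close>.\<close>

fun occupation :: "(R3 \<Rightarrow> ennreal) \<Rightarrow> real \<Rightarrow> (real \<Rightarrow> R3) \<Rightarrow> nat \<Rightarrow> real \<Rightarrow> ennreal" where
  "occupation q t w 0 s = 1"
| "occupation q t w (Suc m) s = (\<integral>\<^sup>+u. indicator {s<..<t} u * (q (w u) * occupation q t w m u) \<partial>lborel)"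

lemma measurable_occupation:
  assumes [measurable]: "q \<in> borel_measurable borel"
  shows "(\<lambda>(s, w). occupation q t w m s) \<in> borel_measurable (borel \<Otimes>\<^sub>M path_space)"
proof (induction m)
  case (Suc m)
  note [measurable] = Suc measurable_path_space_eval_joint
  have [measurable]: "(\<lambda>p. occupation q t (snd (fst p)) m (snd p)) \<in> borel_measurable ((borel \<Otimes>\<^sub>M path_space) \<Otimes>\<^sub>M borel)"
    using measurable_compose[OF _ Suc, of "\<lambda>p. (snd p, snd (fst p))" "(borel \<Otimes>\<^sub>M path_space) \<Otimes>\<^sub>M borel"] by simp
  have [measurable]: "(\<lambda>p. snd (fst p) (snd p)) \<in> borel_measurable (((borel :: real measure) \<Otimes>\<^sub>M path_space) \<Otimes>\<^sub>M borel)"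
    using measurable_compose[OF _ measurable_path_space_eval_joint, of "\<lambda>p. (snd p, snd (fst p))" "((borel :: real measure) \<Otimes>\<^sub>M path_space) \<Otimes>\<^sub>M borel"] by simp
  have [measurable]: "(\<lambda>p. indicator {fst (fst p)<..<t} (snd p) :: ennreal) \<in> borel_measurable (((borel :: real measure) \<Otimes>\<^sub>M path_space) \<Otimes>\<^sub>M borel)"
    unfolding indicator_def by (simp add: greaterThanLessThan_iff)
  show ?case
    unfolding occupation.simps split_beta' by measurable
qed simp

text \<open>Both \<open>s\<close> and the integration variable \<open>u\<close> select the tests, so
  they enter as parameters of the filter; the endpoint \<open>y\<close> enters through the terminal
  function.\<close>

lemma measurable_dyson_step:
  assumes L: "\<And>u f. (u, f) \<in> set L \<Longrightarrow> f \<in> borel_measurable borel"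
    and D: "(\<lambda>(u, y). D u y) \<in> borel_measurable (borel \<Otimes>\<^sub>M borel)"
  shows "(\<lambda>((s, x), u). \<integral>\<^sup>+y. bm_op s (tests_between s u L)
      (heat_to u y) x * D u y \<partial>lborel)
    \<in> borel_measurable ((borel \<Otimes>\<^sub>M borel) \<Otimes>\<^sub>M borel)"
proof -
  let ?K = "(borel :: real measure) \<Otimes>\<^sub>M (borel :: real measure) \<Otimes>\<^sub>M (borel :: R3 measure)"
  have *: "(\<lambda>(p, s, x). bm_op s (tests_between (fst p) (fst (snd p)) L) (heat_to (fst (snd p)) (snd (snd p))) x)
      \<in> borel_measurable (?K \<Otimes>\<^sub>M borel \<Otimes>\<^sub>M borel)"
    by (rule measurable_bm_op_filter) (use L in auto)
  have [measurable]: "(\<lambda>p. bm_op (fst (fst (fst p))) (filter (\<lambda>q. fst (fst (fst p)) < fst q \<and> fst q < snd (fst p)) L)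
        (heat_to (snd (fst p)) (snd p)) (snd (fst (fst p))))
      \<in> borel_measurable (((borel \<Otimes>\<^sub>M borel) \<Otimes>\<^sub>M borel) \<Otimes>\<^sub>M borel)"
    using measurable_compose[OF _ *, of "\<lambda>p. ((fst (fst (fst p)), snd (fst p), snd p), fst (fst (fst p)), snd (fst (fst p)))"
        "((borel \<Otimes>\<^sub>M borel) \<Otimes>\<^sub>M borel) \<Otimes>\<^sub>M borel"] by (simp add: split_beta')
  have [measurable]: "(\<lambda>p. D (snd (fst p)) (snd p)) \<in> borel_measurable ((((borel :: real measure) \<Otimes>\<^sub>M (borel :: R3 measure)) \<Otimes>\<^sub>M borel) \<Otimes>\<^sub>M borel)"
    using measurable_compose[OF _ D, of "\<lambda>p. (snd (fst p), snd p)" "(((borel :: real measure) \<Otimes>\<^sub>M (borel :: R3 measure)) \<Otimes>\<^sub>M borel) \<Otimes>\<^sub>M borel"] by simp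
  show ?thesis
    unfolding split_beta' by measurable
qed

lemma measurable_dyson:
  assumes [measurable]: "q \<in> borel_measurable borel"
    and L: "\<And>u f. (u, f) \<in> set L \<Longrightarrow> f \<in> borel_measurable borel"
  shows "(\<lambda>(s, x). dyson q t L m s x) \<in> borel_measurable (borel \<Otimes>\<^sub>M borel)"
proof (induction m)
  case 0
  have *: "(\<lambda>(p, s, x). bm_op s (tests_after p L) (\<lambda>_ _. 1) x) \<in> borel_measurable ((borel :: real measure) \<Otimes>\<^sub>M borel \<Otimes>\<^sub>M borel)"
    by (rule measurable_bm_op_filter) (use L in auto)
  show ?case
    using measurable_compose[OF _ *, of "\<lambda>(s, x). (s, s, x)" "borel \<Otimes>\<^sub>M borel"] by (simp add: split_beta')
next
  case (Suc m)
  have "(\<lambda>(u, y). q y * dyson q t L m u y) \<in> borel_measurable (borel \<Otimes>\<^sub>M borel)"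
    using Suc by (simp add: split_beta')
  from measurable_dyson_step[OF L this]
  have [measurable]: "(\<lambda>p. \<integral>\<^sup>+y. bm_op (fst (fst p)) (tests_between (fst (fst p)) (snd p) L)
      (heat_to (snd p) y) (snd (fst p)) * (q y * dyson q t L m (snd p) y) \<partial>lborel)
      \<in> borel_measurable ((borel \<Otimes>\<^sub>M borel) \<Otimes>\<^sub>M borel)"
    by (simp add: split_beta')
  have [measurable]: "(\<lambda>p. indicator {fst (fst p)<..<t} (snd p) :: ennreal) \<in> borel_measurable (((borel :: real measure) \<Otimes>\<^sub>M (borel :: R3 measure)) \<Otimes>\<^sub>M borel)"
    unfolding indicator_def by (simp add: greaterThanLessThan_iff)
  show ?case
    unfolding dyson.simps split_beta' by measurable
qed

text \<open>A point of the skeleton acts like an extra test with test function \<open>q\<close> at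
  its time. The weight at the endpoint is moved inside the operator, where Tonelli turns the
  integral over the endpoint into one more step.\<close>

lemma bm_op_insert_point:
  assumes q[measurable]: "q \<in> borel_measurable borel" and D[measurable]: "D \<in> borel_measurable borel"
    and L: "\<And>u f. (u, f) \<in> set L \<Longrightarrow> f \<in> borel_measurable borel"
  shows "(\<integral>\<^sup>+y. bm_op s L (heat_to u y) x * (q y * D y) \<partial>lborel) =
    bm_op s (L @ [(u, q)]) (\<lambda>_. D) x"
proof -
  have "(\<integral>\<^sup>+y. bm_op s L (heat_to u y) x * (q y * D y) \<partial>lborel) =
     (\<integral>\<^sup>+y. bm_op s L (\<lambda>r z. ennreal (heat (u - r) (y - z)) * (q y * D y)) x \<partial>lborel)"
    by (intro nn_integral_cong bm_op_cmult[symmetric] L) auto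
  also have "\<dots> = bm_op s L (\<lambda>r z. \<integral>\<^sup>+y. ennreal (heat (u - r) (y - z)) * (q y * D y) \<partial>lborel) x"
    by (rule bm_op_nn_integral[symmetric]) (use L lborel.sigma_finite_measure_axioms in auto)
  finally show ?thesis by (simp add: bm_op_append)
qed

lemma wiener_bm_op:
  assumes \<mu>: "is_wiener x \<mu>"
    and L: "\<And>u f. (u, f) \<in> set L \<Longrightarrow> f \<in> borel_measurable borel"
    and sorted: "sorted_wrt (<) (0 # map fst L)"
    and g: "\<And>r. g r \<in> borel_measurable borel"
  shows "(\<integral>\<^sup>+w. path_prod L w * g (last (0 # map fst L)) (w (last (0 # map fst L))) \<partial>\<mu>) = bm_op 0 L g x"
proof -
  have s: "sets \<mu> = sets path_space" using \<mu> by (simp add: is_wiener_def)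
  show ?thesis
    using \<mu> measurable_path_space_eval
    by (intro gaussian_increments_bm_op) (use assms in \<open>auto simp: is_wiener_def measurable_cong_sets[OF s refl]\<close>)
qed

text \<open>The prefix \<open>P\<close> makes the induction possible: it records the tests already
  passed and the points already placed, the latter as tests with function \<open>q\<close>. Placing
  the next point extends \<open>P\<close>, and the operator identity for the Brownian path is used
  in both directions.\<close>

lemma dyson_wiener_aux:
  assumes \<mu>: "is_wiener x \<mu>" and q[measurable]: "q \<in> borel_measurable borel"
    and L: "\<And>u f. (u, f) \<in> set L \<Longrightarrow> f \<in> borel_measurable borel" "sorted_wrt (<) (map fst L)"
    and P: "\<And>u f. (u, f) \<in> set P \<Longrightarrow> f \<in> borel_measurable borel" "sorted_wrt (<) (0 # map fst P)"
    and s: "s = last (0 # map fst P)"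
  shows "(\<integral>\<^sup>+w. path_prod P w * dyson q t L m s (w s) \<partial>\<mu>) =
    (\<integral>\<^sup>+w. path_prod P w * (path_prod (tests_after s L) w * occupation q t w m s) \<partial>\<mu>)"
  using P s
proof (induction m arbitrary: P s)
  case 0
  let ?L = "tests_after s L"
  have *: "(\<lambda>(p, s, x). bm_op s ?L (\<lambda>_ _. 1) x) \<in> borel_measurable ((borel :: real measure) \<Otimes>\<^sub>M borel \<Otimes>\<^sub>M borel)"
    by (rule measurable_bm_op) (use L in auto)
  have m: "(\<lambda>z. bm_op r ?L (\<lambda>_ _. 1) z) \<in> borel_measurable borel" for r
    using measurable_compose[OF _ *, of "\<lambda>z. (0, r, z)" borel] by simp
  have "sorted_wrt (<) ((0 # map fst P) @ map fst ?L)"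
    using 0(2,3) L(2) by (intro sorted_wrt_less_append_last sorted_map_filter) auto
  then have sorted: "sorted_wrt (<) (0 # map fst (P @ ?L))"
    by (simp del: sorted_wrt.simps)
  have "(\<integral>\<^sup>+w. path_prod P w * dyson q t L 0 s (w s) \<partial>\<mu>) =
      bm_op 0 P (\<lambda>r z. bm_op r ?L (\<lambda>_ _. 1) z) x"
    using wiener_bm_op[where g="\<lambda>r z. bm_op r ?L (\<lambda>_ _. 1) z", OF \<mu> _ 0(2) m, OF 0(1)]
    by (simp only: 0(3)[symmetric] dyson.simps)
  also have "\<dots> = bm_op 0 (P @ ?L) (\<lambda>_ _. 1) x"
    by (simp add: bm_op_append)
  also have "\<dots> = (\<integral>\<^sup>+w. path_prod (P @ ?L) w * 1 \<partial>\<mu>)"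
    by (rule wiener_bm_op[OF \<mu> _ sorted, symmetric]) (use 0(1) L(1) in auto)
  finally show ?case by simp
next
  case (Suc m)
  note P = Suc.prems
  interpret prob_space \<mu> using \<mu> by (simp add: is_wiener_def)
  interpret pair_sigma_finite \<mu> "lborel :: real measure" ..
  have sets: "sets \<mu> = sets path_space" using \<mu> by (simp add: is_wiener_def)
  note sets_pair[measurable_cong] = sets
  have "s \<ge> 0"
    using sorted_wrt_less_last[OF P(2), of 0] P(3) by simp
  let ?L = "\<lambda>u. tests_between s u L"
  let ?R = "tests_after s L"
  have mP[measurable]: "(\<lambda>w. path_prod P w) \<in> borel_measurable path_space"
    using P(1,2) by (intro measurable_path_prod_path_space) force+
  have mR[measurable]: "(\<lambda>w. path_prod ?R w) \<in> borel_measurable path_space"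
    using L(1) \<open>s \<ge> 0\<close> by (intro measurable_path_prod_path_space) auto
  have ms[measurable]: "(\<lambda>w. w s) \<in> borel_measurable path_space"
    using \<open>s \<ge> 0\<close> by (rule measurable_path_space_eval)
  let ?\<Phi> = "\<lambda>u x. \<integral>\<^sup>+y. bm_op s (?L u) (heat_to u y) x * (q y * dyson q t L m u y) \<partial>lborel"
  have mD: "(\<lambda>(s, x). dyson q t L m s x) \<in> borel_measurable (borel \<Otimes>\<^sub>M borel)"
    by (rule measurable_dyson) (use L in auto)
  have mDu[measurable]: "dyson q t L m u \<in> borel_measurable borel" for u
    using measurable_compose[OF _ mD, of "\<lambda>x. (u, x)" borel] by simp
  have "(\<lambda>(u, y). q y * dyson q t L m u y) \<in> borel_measurable (borel \<Otimes>\<^sub>M borel)"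
    using mD by (simp add: split_beta')
  from measurable_compose[OF _ measurable_dyson_step[OF L(1) this], of "\<lambda>p. ((s, fst p), snd p)" "borel \<Otimes>\<^sub>M borel"]
  have m\<Phi>: "(\<lambda>p. ?\<Phi> (snd p) (fst p)) \<in> borel_measurable (borel \<Otimes>\<^sub>M borel)"
    by simp
  have [measurable]: "(\<lambda>p. ?\<Phi> (snd p) (fst p s)) \<in> borel_measurable (path_space \<Otimes>\<^sub>M borel)"
    using measurable_compose[OF _ m\<Phi>, of "\<lambda>p. (fst p s, snd p)" "path_space \<Otimes>\<^sub>M borel"] by simp
  have [measurable]: "(\<lambda>u. ?\<Phi> u (w s)) \<in> borel_measurable borel" for w
    using measurable_compose[OF _ m\<Phi>, of "\<lambda>u. (w s, u)" borel] by simp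
  have m1[measurable]: "(\<lambda>p. occupation q t (fst p) m (snd p)) \<in> borel_measurable (path_space \<Otimes>\<^sub>M borel)"
    using measurable_compose[OF _ measurable_occupation[OF q], of "\<lambda>p. (snd p, fst p)" "path_space \<Otimes>\<^sub>M borel"] by simp
  have m2[measurable]: "(\<lambda>p. fst p (snd p)) \<in> borel_measurable (path_space \<Otimes>\<^sub>M borel)"
    using measurable_compose[OF _ measurable_path_space_eval_joint, of "\<lambda>p. (snd p, fst p)" "path_space \<Otimes>\<^sub>M borel"] by simp
  have [measurable]: "(\<lambda>u. occupation q t w m u) \<in> borel_measurable borel" "w \<in> borel_measurable borel"
    if "w \<in> space path_space" for w
    using measurable_compose[OF _ m1, of "\<lambda>u. (w, u)" borel] measurable_compose[OF _ m2, of "\<lambda>u. (w, u)" borel] that by simp_all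
  have [measurable]: "(\<lambda>w. occupation q t w m u) \<in> borel_measurable path_space" for u
    using measurable_compose[OF _ m1, of "\<lambda>w. (w, u)" path_space] by simp
  have "(\<integral>\<^sup>+w. path_prod P w * dyson q t L (Suc m) s (w s) \<partial>\<mu>) =
     (\<integral>\<^sup>+w. (\<integral>\<^sup>+u. path_prod P w * (indicator {s<..<t} u * ?\<Phi> u (w s)) \<partial>lborel) \<partial>\<mu>)"
    by (simp add: nn_integral_cmult)
  also have "\<dots> = (\<integral>\<^sup>+u. (\<integral>\<^sup>+w. path_prod P w * (indicator {s<..<t} u * ?\<Phi> u (w s)) \<partial>\<mu>) \<partial>lborel)"
    by (rule Fubini'[symmetric]) measurable
  also have "\<dots> = (\<integral>\<^sup>+u. (\<integral>\<^sup>+w. path_prod P w * (path_prod ?R w * (indicator {s<..<t} u * (q (w u) * occupation q t w m u))) \<partial>\<mu>) \<partial>lborel)"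
  proof (rule nn_integral_cong_AE)
    \<comment> \<open>The pending tests split at \<open>u\<close> only if \<open>u\<close> is not a
      test time; the finitely many exceptions form a null set.\<close>
    have "AE u in lborel. u \<notin> fst ` set L"
      by (intro AE_not_in finite_imp_null_set_lborel) auto
    then show "AE u in lborel. (\<integral>\<^sup>+w. path_prod P w * (indicator {s<..<t} u * ?\<Phi> u (w s)) \<partial>\<mu>) =
      (\<integral>\<^sup>+w. path_prod P w * (path_prod ?R w * (indicator {s<..<t} u * (q (w u) * occupation q t w m u))) \<partial>\<mu>)"
    proof eventually_elim
      case (elim u)
      show ?case
      proof (cases "u \<in> {s<..<t}")
        case True
        then have "s < u" by simp
        \<comment> \<open>The new prefix ends with the point at \<open>u\<close>, so the induction
          hypothesis applies with \<open>u\<close> in the role of \<open>s\<close>, and the tests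
          after \<open>u\<close> remain pending.\<close>
        let ?P = "P @ ?L u @ [(u, q)]"
        have su: "sorted_wrt (<) (map fst (?L u) @ [u])"
          using L(2) by (auto simp: sorted_wrt_append sorted_map_filter)
        have "sorted_wrt (<) ((0 # map fst P) @ (map fst (?L u) @ [u]))"
          by (rule sorted_wrt_less_append_last[OF P(2) su]) (use P(3) \<open>s < u\<close> in auto)
        then have sorted: "sorted_wrt (<) (0 # map fst ?P)"
          by (simp del: sorted_wrt.simps)
        have meas: "(v, f) \<in> set ?P \<Longrightarrow> f \<in> borel_measurable borel" for v f
          using P(1) L(1) by auto
        have m_op: "(\<lambda>z. bm_op r (?L u @ [(u, q)]) (\<lambda>_. dyson q t L m u) z) \<in> borel_measurable borel" for r
        proof -
          have "(\<lambda>(p, s, x). bm_op s (?L u @ [(u, q)]) (\<lambda>_. dyson q t L m u) x) \<in> borel_measurable ((borel :: real measure) \<Otimes>\<^sub>M borel \<Otimes>\<^sub>M borel)"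
            by (rule measurable_bm_op) (use L in auto)
          from measurable_compose[OF _ this, of "\<lambda>z. (0, r, z)" borel] show ?thesis by simp
        qed
        have split: "path_prod ?P w * path_prod (tests_after u L) w = path_prod P w * (path_prod ?R w * q (w u))" for w
          using filter_sorted_split[OF L(2) \<open>s < u\<close> elim] by (simp add: mult_ac)
        have "(\<integral>\<^sup>+w. path_prod P w * ?\<Phi> u (w s) \<partial>\<mu>) =
            (\<integral>\<^sup>+w. path_prod P w * bm_op s (?L u @ [(u, q)]) (\<lambda>_. dyson q t L m u) (w s) \<partial>\<mu>)"
          by (subst bm_op_insert_point) (use L in auto)
        also have "\<dots> = bm_op 0 P (\<lambda>r z. bm_op r (?L u @ [(u, q)]) (\<lambda>_. dyson q t L m u) z) x"
          using wiener_bm_op[where g="\<lambda>r z. bm_op r (?L u @ [(u, q)]) (\<lambda>_. dyson q t L m u) z", OF \<mu> _ P(2) m_op, OF P(1)]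
          by (simp only: P(3)[symmetric])
        also have "\<dots> = bm_op 0 ?P (\<lambda>_. dyson q t L m u) x"
          by (simp add: bm_op_append)
        also have "\<dots> = (\<integral>\<^sup>+w. path_prod ?P w * dyson q t L m u (w (last (0 # map fst ?P))) \<partial>\<mu>)"
          by (rule wiener_bm_op[OF \<mu> meas sorted, symmetric]) auto
        also have "\<dots> = (\<integral>\<^sup>+w. path_prod ?P w * dyson q t L m u (w u) \<partial>\<mu>)"
          by simp
        also have "\<dots> = (\<integral>\<^sup>+w. path_prod ?P w * (path_prod (tests_after u L) w * occupation q t w m u) \<partial>\<mu>)"
          by (rule Suc.IH[OF meas sorted]) auto
        also have "\<dots> = (\<integral>\<^sup>+w. path_prod P w * (path_prod ?R w * (q (w u) * occupation q t w m u)) \<partial>\<mu>)"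
          by (simp only: mult.assoc[symmetric] split)
        finally show ?thesis using True by simp
      qed simp
    qed
  qed
  also have "\<dots> = (\<integral>\<^sup>+w. (\<integral>\<^sup>+u. path_prod P w * (path_prod ?R w * (indicator {s<..<t} u * (q (w u) * occupation q t w m u))) \<partial>lborel) \<partial>\<mu>)"
    by (rule Fubini') measurable
  also have "\<dots> = (\<integral>\<^sup>+w. path_prod P w * (path_prod ?R w * occupation q t w (Suc m) s) \<partial>\<mu>)"
    by (rule nn_integral_cong) (simp add: nn_integral_cmult sets_eq_imp_space_eq[OF sets])
  finally show ?case .
qed

lemma dyson_eq_wiener:
  assumes \<mu>: "is_wiener x \<mu>" and q: "q \<in> borel_measurable borel"
    and L: "\<And>u f. (u, f) \<in> set L \<Longrightarrow> f \<in> borel_measurable borel" "sorted_wrt (<) (0 # map fst L)"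
  shows "dyson q t L m 0 x = (\<integral>\<^sup>+w. path_prod L w * occupation q t w m 0 \<partial>\<mu>)"
proof -
  interpret prob_space \<mu> using \<mu> by (simp add: is_wiener_def)
  have "(\<integral>\<^sup>+w. path_prod [] w * dyson q t L m 0 (w 0) \<partial>\<mu>) =
    (\<integral>\<^sup>+w. path_prod [] w * (path_prod (filter (\<lambda>p. 0 < fst p) L) w * occupation q t w m 0) \<partial>\<mu>)"
    by (rule dyson_wiener_aux[OF \<mu> q]) (use L in auto)
  also have "filter (\<lambda>p. 0 < fst p) L = L"
    using L(2) by (auto simp: filter_id_conv)
  also have "(\<integral>\<^sup>+w. path_prod [] w * dyson q t L m 0 (w 0) \<partial>\<mu>) = (\<integral>\<^sup>+w. dyson q t L m 0 x \<partial>\<mu>)"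
    using \<mu> by (intro nn_integral_cong_AE) (auto simp: is_wiener_def)
  finally show ?thesis by (simp add: emeasure_space_1)
qed

text \<open>With \<open>Q\<close> the integral of \<open>v\<close> along the path from
  \<open>u\<close> to \<open>t\<close>, the derivative of \<open>Q\<close> is minus the integrand,
  so \<open>- Q ^ Suc m / fact (Suc m)\<close> is an antiderivative of the integrand of the next
  recursion step. It vanishes at the upper end.\<close>

lemma occupation_eq:
  fixes v :: "R3 \<Rightarrow> real"
  assumes v: "continuous_on UNIV v" "\<And>y. v y \<ge> 0" and w: "continuous_on {0..} w"
    and s: "0 \<le> s" "s \<le> t"
  shows "occupation (\<lambda>y. ennreal (v y)) t w m s = ennreal ((integral {s..t} (\<lambda>u. v (w u))) ^ m / fact m)"
  using s
proof (induction m arbitrary: s)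
  case (Suc m)
  define f where "f u = v (w u)" for u
  define Q where "Q u = integral {u..t} f" for u
  have cont: "continuous_on {s..t} f"
    unfolding f_def using Suc.prems
    by (intro continuous_on_compose2[OF v(1)] continuous_on_subset[OF w]) auto
  have Q_nonneg: "Q u \<ge> 0" if "u \<in> {s..t}" for u
    unfolding Q_def
  proof (rule integral_nonneg)
    show "f integrable_on {u..t}"
      by (intro integrable_continuous_real continuous_on_subset[OF cont]) (use that in auto)
  qed (simp add: f_def v(2))
  have "((\<lambda>u. f u * Q u ^ m / fact m) has_integral (- (Q t ^ Suc m / fact (Suc m)) - (- (Q s ^ Suc m / fact (Suc m))))) {s..t}"
  proof (rule fundamental_theorem_of_calculus)
    fix u assume u: "u \<in> {s..t}"
    have "(Q has_real_derivative - f u) (at u within {s..t})"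
      unfolding Q_def by (rule integral_has_real_derivative'[OF cont u])
    then have "((\<lambda>u. - (Q u ^ Suc m / fact (Suc m))) has_real_derivative
        - (real (Suc m) * Q u ^ m * (- f u) / fact (Suc m))) (at u within {s..t})"
      by (auto intro!: derivative_eq_intros simp del: power_Suc fact_Suc)
    also have "- (real (Suc m) * Q u ^ m * (- f u) / fact (Suc m)) = f u * Q u ^ m / fact m"
      by (simp add: field_simps del: of_nat_Suc)
    finally show "((\<lambda>u. - (Q u ^ Suc m / fact (Suc m))) has_vector_derivative f u * Q u ^ m / fact m) (at u within {s..t})"
      by (simp add: has_real_derivative_iff_has_vector_derivative)
  qed fact
  then have hi: "((\<lambda>u. f u * Q u ^ m / fact m) has_integral Q s ^ Suc m / fact (Suc m)) {s..t}"
    by (simp add: Q_def)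
  have "occupation (\<lambda>y. ennreal (v y)) t w (Suc m) s =
    (\<integral>\<^sup>+u. indicator {s<..<t} u * (ennreal (v (w u)) * occupation (\<lambda>y. ennreal (v y)) t w m u) \<partial>lborel)"
    by simp
  also have "\<dots> = (\<integral>\<^sup>+u. ennreal (indicator {s..t} u * (f u * Q u ^ m / fact m)) \<partial>lborel)"
  proof (rule nn_integral_cong_AE)
    have "AE u in lborel. u \<noteq> s \<and> u \<noteq> t"
      using AE_lborel_singleton[of s] AE_lborel_singleton[of t] by eventually_elim simp
    then show "AE u in lborel. indicator {s<..<t} u * (ennreal (v (w u)) * occupation (\<lambda>y. ennreal (v y)) t w m u)
      = ennreal (indicator {s..t} u * (f u * Q u ^ m / fact m))"
    proof eventually_elim
      case (elim u)
      show ?case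
      proof (cases "u \<in> {s<..<t}")
        case True
        then have "occupation (\<lambda>y. ennreal (v y)) t w m u = ennreal (Q u ^ m / fact m)"
          unfolding Q_def f_def using Suc.prems by (intro Suc.IH) auto
        then show ?thesis
          using True v(2) Q_nonneg[of u] by (simp add: f_def ennreal_mult[symmetric])
      qed (use elim in \<open>auto simp: indicator_def\<close>)
    qed
  qed
  also have "\<dots> = ennreal (Q s ^ Suc m / fact (Suc m))"
    by (rule nn_integral_has_integral_lebesgue[OF _ hi]) (use v(2) Q_nonneg in \<open>auto simp: f_def\<close>)
  finally show ?case by (simp add: Q_def f_def[abs_def])
qed simp

section \<open>The Gibbs weight: bounds and exponential series\<close>

lemma continuous_V_path:
  assumes "\<epsilon> > 0" "w \<in> space path_space"
  shows "continuous_on {0..t} (\<lambda>u. V \<epsilon> (w u))"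
  by (rule continuous_on_compose2[OF continuous_V[OF assms(1)]])
    (use assms(2) in \<open>auto simp: space_path_space intro: continuous_on_subset\<close>)

lemma set_integral_V_path:
  assumes "\<epsilon> > 0" "w \<in> space path_space"
  shows "(LBINT s:{0..t}. V \<epsilon> (w s)) = - integral {0..t} (\<lambda>u. - V \<epsilon> (w u))"
proof -
  have "(LBINT s:{0..t}. V \<epsilon> (w s)) = integral {0..t} (\<lambda>u. V \<epsilon> (w u))"
    by (intro set_borel_integral_eq_integral borel_integrable_atLeastAtMost' continuous_V_path assms)
  then show ?thesis by simp
qed

lemma measurable_gibbs_weight[measurable]:
  assumes "\<epsilon> > 0"
  shows "gibbs_weight \<epsilon> l t \<in> borel_measurable path_space"
proof -
  note [measurable] = measurable_V[OF assms]
  have [measurable]: "(\<lambda>p. fst p (snd p)) \<in> borel_measurable (path_space \<Otimes>\<^sub>M borel)"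
    using measurable_compose[OF _ measurable_path_space_eval_joint, of "\<lambda>p. (snd p, fst p)" "path_space \<Otimes>\<^sub>M borel"] by simp
  show ?thesis
    unfolding gibbs_weight_def[abs_def] set_lebesgue_integral_def by measurable
qed

text \<open>The potential lies between 0 and a constant in absolute value, so the exponent is
  bounded uniformly over paths for either sign of \<open>l\<close>. The upper bound gives
  integrability, the lower one positivity of \<open>G\<close>.\<close>

lemma gibbs_weight_bounds:
  assumes "\<epsilon> > 0" "t \<ge> 0"
  obtains K where "\<And>w. w \<in> space path_space \<Longrightarrow> exp (- K) \<le> gibbs_weight \<epsilon> l t w"
    "\<And>w. w \<in> space path_space \<Longrightarrow> gibbs_weight \<epsilon> l t w \<le> exp K"
proof -
  obtain C where C: "C > 0" "\<And>x. - V \<epsilon> x \<le> C" using V_bounded[OF assms(1)] by blast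
  have "\<bar>- l * (LBINT s:{0..t}. V \<epsilon> (w s))\<bar> \<le> \<bar>l\<bar> * (C * t)" if w: "w \<in> space path_space" for w
  proof -
    let ?I = "integral {0..t} (\<lambda>u. - V \<epsilon> (w u))"
    have int: "(\<lambda>u. - V \<epsilon> (w u)) integrable_on {0..t}"
      by (intro integrable_continuous_real continuous_on_minus continuous_V_path assms w)
    have "?I \<ge> 0"
      using V_neg[OF assms(1)] by (intro integral_nonneg[OF int]) (auto intro: less_imp_le)
    moreover have "?I \<le> integral {0..t} (\<lambda>u. C)"
      using C by (intro integral_le int) auto
    ultimately have "\<bar>?I\<bar> \<le> C * t" using assms(2) by (simp add: mult.commute)
    then show ?thesis
      unfolding set_integral_V_path[OF assms(1) w] by (simp add: abs_mult mult_left_mono)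
  qed
  then have "exp (- (\<bar>l\<bar> * (C * t))) \<le> gibbs_weight \<epsilon> l t w \<and> gibbs_weight \<epsilon> l t w \<le> exp (\<bar>l\<bar> * (C * t))"
    if "w \<in> space path_space" for w
    using that unfolding gibbs_weight_def by (fastforce simp: abs_le_iff)
  then show thesis using that by blast
qed

lemma gibbs_weight_integrable:
  assumes "\<epsilon> > 0" "t \<ge> 0" and \<mu>: "is_wiener x (wiener x)"
  shows "integrable (wiener x) (gibbs_weight \<epsilon> l t)" and "G \<epsilon> l t x > 0"
proof -
  interpret prob_space "wiener x" using \<mu> by (simp add: is_wiener_def)
  have s[measurable_cong]: "sets (wiener x) = sets path_space" using \<mu> by (simp add: is_wiener_def)
  note sp = sets_eq_imp_space_eq[OF s]
  obtain K where K: "\<And>w. w \<in> space path_space \<Longrightarrow> exp (- K) \<le> gibbs_weight \<epsilon> l t w"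
    "\<And>w. w \<in> space path_space \<Longrightarrow> gibbs_weight \<epsilon> l t w \<le> exp K"
    using gibbs_weight_bounds[OF assms(1,2)] by blast
  have [measurable]: "gibbs_weight \<epsilon> l t \<in> borel_measurable path_space"
    by (rule measurable_gibbs_weight) fact
  show int: "integrable (wiener x) (gibbs_weight \<epsilon> l t)"
    by (rule integrable_const_bound[where B="exp K"]) (use K(2) in \<open>auto simp: sp gibbs_weight_def\<close>)
  have "0 < (\<integral>w. exp (- K) \<partial>wiener x)" by (simp add: prob_space)
  also have "\<dots> \<le> G \<epsilon> l t x"
    unfolding G_def by (rule integral_mono[OF _ int]) (use K(1) in \<open>auto simp: sp\<close>)
  finally show "G \<epsilon> l t x > 0" .
qed

lemma ennreal_G:
  assumes "\<epsilon> > 0" "t \<ge> 0" and \<mu>: "is_wiener x (wiener x)"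
  shows "(\<integral>\<^sup>+w. gibbs_weight \<epsilon> l t w \<partial>wiener x) = ennreal (G \<epsilon> l t x)"
  unfolding G_def
  by (rule nn_integral_eq_integral[OF gibbs_weight_integrable(1)[OF assms]]) (simp add: gibbs_weight_def)

text \<open>By \<open>occupation_eq\<close> this is the exponential series of \<open>l\<close> times
  the integral of \<open>- V\<close> along the path. The sign of \<open>l\<close> keeps all terms
  nonnegative, as \<open>ennreal\<close> demands.\<close>

lemma gibbs_weight_series:
  assumes \<epsilon>: "\<epsilon> > 0" and "t \<ge> 0" "l \<ge> 0" and w: "w \<in> space path_space"
  shows "ennreal (gibbs_weight \<epsilon> l t w) = (\<Sum>m. ennreal (l ^ m) * occupation (\<lambda>y. ennreal (- V \<epsilon> y)) t w m 0)"
proof -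
  define I where "I = integral {0..t} (\<lambda>u. - V \<epsilon> (w u))"
  have V: "0 \<le> - V \<epsilon> y" for y using V_neg[OF \<epsilon>, of y] by simp
  have "I \<ge> 0"
    unfolding I_def using V by (intro integral_nonneg integrable_continuous_real continuous_on_minus continuous_V_path \<epsilon> w) auto
  have occ: "occupation (\<lambda>y. ennreal (- V \<epsilon> y)) t w m 0 = ennreal (I ^ m / fact m)" for m
    unfolding I_def by (rule occupation_eq) (use V w \<open>t \<ge> 0\<close> \<epsilon> in \<open>auto simp: space_path_space intro!: continuous_on_minus continuous_V\<close>)
  have "(\<Sum>m. ennreal (l ^ m) * occupation (\<lambda>y. ennreal (- V \<epsilon> y)) t w m 0) = (\<Sum>m. ennreal ((l * I) ^ m / fact m))"
    unfolding occ using \<open>l \<ge> 0\<close> \<open>I \<ge> 0\<close> by (simp add: ennreal_mult[symmetric] power_mult_distrib)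
  also have "\<dots> = ennreal (\<Sum>m. (l * I) ^ m / fact m)"
    by (rule suminf_ennreal2) (use \<open>l \<ge> 0\<close> \<open>I \<ge> 0\<close> summable_exp[of "l * I"] in \<open>auto simp: field_simps\<close>)
  also have "(\<Sum>m. (l * I) ^ m / fact m) = exp (l * I)"
    by (simp add: exp_def divide_inverse mult.commute)
  also have "\<dots> = gibbs_weight \<epsilon> l t w"
    unfolding gibbs_weight_def set_integral_V_path[OF \<epsilon> w] I_def by simp
  finally show ?thesis by simp
qed

lemma nn_integral_gibbs_weight:
  assumes \<epsilon>: "\<epsilon> > 0" and "t \<ge> 0" "l \<ge> 0" and \<mu>: "is_wiener x \<mu>"
    and L: "\<And>u f. (u, f) \<in> set L \<Longrightarrow> f \<in> borel_measurable borel" "sorted_wrt (<) (0 # map fst L)"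
  shows "(\<integral>\<^sup>+w. path_prod L w * ennreal (gibbs_weight \<epsilon> l t w) \<partial>\<mu>) =
    (\<Sum>m. ennreal (l ^ m) * dyson (\<lambda>y. ennreal (- V \<epsilon> y)) t L m 0 x)"
proof -
  let ?q = "\<lambda>y. ennreal (- V \<epsilon> y)"
  have s[measurable_cong]: "sets \<mu> = sets path_space" using \<mu> by (simp add: is_wiener_def)
  note [measurable] = measurable_V[OF \<epsilon>]
  have q: "?q \<in> borel_measurable borel" by measurable
  have [measurable]: "(\<lambda>w. occupation ?q t w m 0) \<in> borel_measurable path_space" for m
    using measurable_compose[OF _ measurable_occupation[OF q], of "\<lambda>w. (0, w)" path_space] by simp
  have [measurable]: "(\<lambda>w. path_prod L w) \<in> borel_measurable path_space"
    using L by (intro measurable_path_prod_path_space) force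
  have "(\<integral>\<^sup>+w. path_prod L w * ennreal (gibbs_weight \<epsilon> l t w) \<partial>\<mu>) =
     (\<integral>\<^sup>+w. (\<Sum>m. ennreal (l ^ m) * (path_prod L w * occupation ?q t w m 0)) \<partial>\<mu>)"
  proof (rule nn_integral_cong)
    fix w assume "w \<in> space \<mu>"
    then have w: "w \<in> space path_space" by (simp add: sets_eq_imp_space_eq[OF s])
    have "path_prod L w * (\<Sum>m. ennreal (l ^ m) * occupation ?q t w m 0) =
       (\<Sum>m. path_prod L w * (ennreal (l ^ m) * occupation ?q t w m 0))"
      by (rule ennreal_suminf_cmult[symmetric])
    then show "path_prod L w * ennreal (gibbs_weight \<epsilon> l t w) =
       (\<Sum>m. ennreal (l ^ m) * (path_prod L w * occupation ?q t w m 0))"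
      by (simp add: gibbs_weight_series[OF assms(1-3) w] mult.left_commute)
  qed
  also have "\<dots> = (\<Sum>m. \<integral>\<^sup>+w. ennreal (l ^ m) * (path_prod L w * occupation ?q t w m 0) \<partial>\<mu>)"
    by (rule nn_integral_suminf) measurable
  also have "\<dots> = (\<Sum>m. ennreal (l ^ m) * dyson ?q t L m 0 x)"
    by (simp add: nn_integral_cmult dyson_eq_wiener[OF \<mu> q L])
  finally show ?thesis .
qed

section \<open>Brownian bridges\<close>

text \<open>The time passed to \<open>g\<close> is the last one of the list, so a time-dependent
  terminal function may be frozen there. This matches \<open>kernel_iter\<close>, whose terminal
  function sees no time.\<close>

lemma bm_op_last: "bm_op s L g x = bm_op s L (\<lambda>_. g (last (s # map fst L))) x"
proof (induction L arbitrary: s x)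
  case (Cons a L)
  obtain u f where a: "a = (u, f)" by (cases a)
  show ?case
    unfolding a bm_op.simps by (subst Cons.IH) simp
qed simp

text \<open>The kernel with the largest index is absorbed into \<open>g\<close>, so that the
  recursion follows the removal of the last coordinate from a product measure.\<close>

fun kernel_iter :: "'a measure \<Rightarrow> (nat \<Rightarrow> 'a \<Rightarrow> 'a \<Rightarrow> ennreal) \<Rightarrow> nat \<Rightarrow> ('a \<Rightarrow> ennreal) \<Rightarrow> 'a \<Rightarrow> ennreal"
where
  "kernel_iter N K 0 g a = g a"
| "kernel_iter N K (Suc n) g a = kernel_iter N K n (\<lambda>w. \<integral>\<^sup>+y. K n w y * g y \<partial>N) a"

lemma measurable_PiM_coord:
  fixes k m :: nat
  assumes "a \<in> space N" "k \<le> m"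
  shows "(\<lambda>z. (z(0 := a)) k) \<in> Pi\<^sub>M {1..m} (\<lambda>_. N) \<rightarrow>\<^sub>M N"
proof (cases "k = 0")
  case False
  then have "k \<in> {1..m}" using assms by auto
  from measurable_component_singleton[OF this, of "\<lambda>_. N"] False
  show ?thesis by simp
qed (simp add: assms)

lemma measurable_PiM_chain:
  assumes a: "a \<in> space N"
    and K: "\<And>k. k < n \<Longrightarrow> (\<lambda>(w, y). K k w y) \<in> borel_measurable (N \<Otimes>\<^sub>M N)"
    and g: "g \<in> borel_measurable N"
  shows "(\<lambda>z. (\<Prod>k<n. K k ((z(0 := a)) k) ((z(0 := a)) (Suc k))) * g ((z(0 := a)) n) :: ennreal)
    \<in> borel_measurable (Pi\<^sub>M {1..n} (\<lambda>_. N))"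
proof (intro borel_measurable_times_ennreal borel_measurable_prod_ennreal)
  show "(\<lambda>z. g ((z(0 := a)) n)) \<in> borel_measurable (Pi\<^sub>M {1..n} (\<lambda>_. N))"
    by (rule measurable_compose[OF measurable_PiM_coord[OF a] g]) simp
  fix k assume k: "k \<in> {..<n}"
  then have "(\<lambda>z. ((z(0 := a)) k, (z(0 := a)) (Suc k))) \<in> Pi\<^sub>M {1..n} (\<lambda>_. N) \<rightarrow>\<^sub>M N \<Otimes>\<^sub>M N"
    by (intro measurable_Pair measurable_PiM_coord a) auto
  from measurable_compose[OF this K[of k]] k
  show "(\<lambda>z. K k ((z(0 := a)) k) ((z(0 := a)) (Suc k))) \<in> borel_measurable (Pi\<^sub>M {1..n} (\<lambda>_. N))"
    by simp
qed

text \<open>Index 0 of \<open>z\<close> is not integrated over: it is overwritten by the starting point.\<close>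
lemma nn_integral_PiM_chain:
  assumes N: "sigma_finite_measure N" and a: "a \<in> space N"
    and K: "\<And>k. k < n \<Longrightarrow> (\<lambda>(w, y). K k w y) \<in> borel_measurable (N \<Otimes>\<^sub>M N)"
    and g: "g \<in> borel_measurable N"
  shows "(\<integral>\<^sup>+z. (\<Prod>k<n. K k ((z(0 := a)) k) ((z(0 := a)) (Suc k))) * g ((z(0 := a)) n) \<partial>Pi\<^sub>M {1..n} (\<lambda>_. N)) =
    kernel_iter N K n g a"
  using K g
proof (induction n arbitrary: g)
  case 0
  interpret product_sigma_finite "\<lambda>_ :: nat. N" using N by (simp add: product_sigma_finite_def)
  show ?case by (simp add: PiM_empty)
next
  case (Suc n)
  interpret N: sigma_finite_measure N by fact
  interpret product_sigma_finite "\<lambda>_ :: nat. N" using N by (simp add: product_sigma_finite_def)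
  note g[measurable] = Suc.prems(2)
  have K: "(\<lambda>(w, y). K k w y) \<in> borel_measurable (N \<Otimes>\<^sub>M N)" if "k \<le> n" for k
    using Suc.prems(1)[of k] that by simp
  note [measurable] = K[OF order.refl]
  define g' where "g' w = (\<integral>\<^sup>+y. K n w y * g y \<partial>N)" for w
  have g': "g' \<in> borel_measurable N"
    unfolding g'_def by measurable
  let ?f = "\<lambda>n z. \<Prod>k<n. K k ((z(0 := a)) k) ((z(0 := a)) (Suc k))"
  have ins: "{1..Suc n} = insert (Suc n) {1..n}" by auto
  have "(\<integral>\<^sup>+z. ?f (Suc n) z * g ((z(0 := a)) (Suc n)) \<partial>Pi\<^sub>M {1..Suc n} (\<lambda>_. N)) =
     (\<integral>\<^sup>+z. (\<integral>\<^sup>+y. ?f (Suc n) (z(Suc n := y)) * g (((z(Suc n := y))(0 := a)) (Suc n)) \<partial>N) \<partial>Pi\<^sub>M {1..n} (\<lambda>_. N))"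
    unfolding ins
  proof (rule product_nn_integral_insert)
    have "(\<lambda>z. ?f (Suc n) z * g ((z(0 := a)) (Suc n))) \<in> borel_measurable (Pi\<^sub>M {1..Suc n} (\<lambda>_. N))"
      by (rule measurable_PiM_chain[OF a Suc.prems])
    then show "(\<lambda>z. ?f (Suc n) z * g ((z(0 := a)) (Suc n))) \<in> borel_measurable (Pi\<^sub>M (insert (Suc n) {1..n}) (\<lambda>_. N))"
      by (simp only: ins)
  qed auto
  also have "\<dots> = (\<integral>\<^sup>+z. ?f n z * g' ((z(0 := a)) n) \<partial>Pi\<^sub>M {1..n} (\<lambda>_. N))"
  proof (rule nn_integral_cong)
    fix z assume z: "z \<in> space (Pi\<^sub>M {1..n} (\<lambda>_. N))"
    have zn: "(z(0 := a)) n \<in> space N"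
      using measurable_space[OF measurable_PiM_coord[OF a order.refl] z] by simp
    have [measurable]: "(\<lambda>y. K n ((z(0 := a)) n) y) \<in> borel_measurable N"
      using measurable_compose[OF measurable_Pair1'[OF zn] K[of n]] by simp
    have "?f (Suc n) (z(Suc n := y)) = ?f n z * K n ((z(0 := a)) n) y" for y
    proof -
      have "?f n (z(Suc n := y)) = ?f n z" by (intro prod.cong) auto
      then show ?thesis by simp
    qed
    then have "(\<integral>\<^sup>+y. ?f (Suc n) (z(Suc n := y)) * g (((z(Suc n := y))(0 := a)) (Suc n)) \<partial>N) =
        (\<integral>\<^sup>+y. ?f n z * (K n ((z(0 := a)) n) y * g y) \<partial>N)"
      by (simp add: mult.assoc)
    also have "\<dots> = ?f n z * g' ((z(0 := a)) n)"
      unfolding g'_def by (rule nn_integral_cmult) measurable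
    finally show "(\<integral>\<^sup>+y. ?f (Suc n) (z(Suc n := y)) * g (((z(Suc n := y))(0 := a)) (Suc n)) \<partial>N) = ?f n z * g' ((z(0 := a)) n)" .
  qed
  also have "\<dots> = kernel_iter N K n g' a"
    by (rule Suc.IH) (use K g' in auto)
  finally show ?case by (simp add: g'_def[abs_def])
qed

lemma kernel_iter_bm_op:
  "kernel_iter lborel (\<lambda>k w y. ennreal (heat (r (Suc k) - r k) (y - w)) * F k y) n g x =
    bm_op (r 0) (map (\<lambda>k. (r (Suc k), F k)) [0..<n]) (\<lambda>_. g) x"
proof (induction n arbitrary: g)
  case (Suc n)
  have "last (r 0 # map fst (map (\<lambda>k. (r (Suc k), F k)) [0..<n])) = r n"
    by (cases n) auto
  then show ?case
    by (simp add: bm_op_append Suc mult.assoc) (subst (2) bm_op_last, simp)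
qed simp

lemma nn_integral_PiM_bm_op:
  assumes F: "\<And>k. k < n \<Longrightarrow> F k \<in> borel_measurable borel" and g: "g \<in> borel_measurable borel"
  shows "(\<integral>\<^sup>+z. (\<Prod>k<n. ennreal (heat (r (Suc k) - r k) ((z(0 := x)) (Suc k) - (z(0 := x)) k)) * F k ((z(0 := x)) (Suc k))) *
      g ((z(0 := x)) n) \<partial>Pi\<^sub>M {1..n} (\<lambda>_. lborel)) =
    bm_op (r 0) (map (\<lambda>k. (r (Suc k), F k)) [0..<n]) (\<lambda>_. g) x"
  unfolding kernel_iter_bm_op[symmetric]
proof (rule nn_integral_PiM_chain[where K="\<lambda>k w y. ennreal (heat (r (Suc k) - r k) (y - w)) * F k y"])
  show "(\<lambda>(w, y). ennreal (heat (r (Suc k) - r k) (y - w)) * F k y) \<in> borel_measurable (lborel \<Otimes>\<^sub>M lborel)"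
    if "k < n" for k
    using F[OF that] by measurable
qed (use g lborel.sigma_finite_measure_axioms in auto)

lemma nn_integral_lborel_affine:
  fixes f :: "R3 \<Rightarrow> ennreal"
  assumes [measurable]: "f \<in> borel_measurable borel" and "c > 0"
  shows "(\<integral>\<^sup>+y. f y \<partial>lborel) = ennreal (c ^ 3) * (\<integral>\<^sup>+z. f (t + c *\<^sub>R z) \<partial>lborel)"
  using assms(2) by (subst lborel_affine[of c t]) (simp_all add: nn_integral_density nn_integral_distr nn_integral_cmult)

section \<open>Affine images of the standard bridge\<close>

context
  fixes x y :: R3 and s e :: real
begin

text \<open>The position at time \<open>u\<close> of the path from \<open>(s, x)\<close> to
  \<open>(e, y)\<close> when the standard bridge is at \<open>z\<close> at the rescaled time; the
  same expression occurs in \<open>W\<close>.\<close>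

definition bridge_interp :: "real \<Rightarrow> R3 \<Rightarrow> R3" where
  "bridge_interp u z = (1 - (u - s) / (e - s)) *\<^sub>R x + ((u - s) / (e - s)) *\<^sub>R y + sqrt (e - s) *\<^sub>R z"

text \<open>The Girsanov density that removes the drift \<open>(y - x) / (e - s)\<close>: weighted with it, the affine
  image of the increments of the bridge on \<open>[0, 1]\<close> has heat kernels on \<open>[s, e]\<close> as densities.\<close>
definition bridge_tilt :: "real \<Rightarrow> R3 \<Rightarrow> real" where
  "bridge_tilt u w = exp (inner (w - x) (y - x) / (e - s) - (u - s) * (norm (y - x))\<^sup>2 / (2 * (e - s)\<^sup>2))"

text \<open>An increment \<open>\<zeta>\<close> is mapped to
  \<open>(D / d) *\<^sub>R v + sqrt d *\<^sub>R \<zeta>\<close> with \<open>v = y - x\<close>.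
  Expanding its squared norm produces a mixed term and a term in \<open>v\<close>, and these are
  exactly what the tilt gains between \<open>a\<close> and \<open>u\<close>. The change of variance
  in dimension three produces the factor \<open>sqrt d ^ 3\<close>.\<close>

lemma heat_interp:
  assumes se: "s < e" and au: "a < u"
  shows "heat ((u - s) / (e - s) - (a - s) / (e - s)) (z' - z) * bridge_tilt a (bridge_interp a z) =
    sqrt (e - s) ^ 3 * heat (u - a) (bridge_interp u z' - bridge_interp a z) * bridge_tilt u (bridge_interp u z')"
proof -
  define d where "d = e - s"
  define D where "D = u - a"
  define v where "v = y - x"
  define \<zeta> where "\<zeta> = z' - z"
  have d: "d > 0" and D: "D > 0" using se au by (auto simp: d_def D_def)
  have diff: "bridge_interp u z' - bridge_interp a z = (D / d) *\<^sub>R v + sqrt d *\<^sub>R \<zeta>"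
    unfolding bridge_interp_def d_def[symmetric] v_def \<zeta>_def D_def
    by (simp add: algebra_simps diff_divide_distrib)
  have t: "(u - s) / (e - s) - (a - s) / (e - s) = D / d"
    by (simp add: D_def d_def diff_divide_distrib)
  have pre: "(2 * pi * (D / d)) powr (- 3 / 2) = sqrt d ^ 3 * (2 * pi * D) powr (- 3 / 2)"
  proof -
    have "sqrt d ^ 3 = d powr (3 / 2)"
      using d by (simp add: powr_half_sqrt[symmetric] powr_realpow[symmetric] powr_powr)
    then show ?thesis
      using d D by (simp add: powr_divide powr_mult powr_minus divide_simps)
  qed
  have n2: "(norm (bridge_interp u z' - bridge_interp a z))\<^sup>2 = (D / d)\<^sup>2 * (norm v)\<^sup>2 + 2 * (D / d) * sqrt d * inner v \<zeta> + d * (norm \<zeta>)\<^sup>2"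
    unfolding diff power2_norm_eq_inner using d
    by (simp add: inner_simps inner_commute power2_eq_square algebra_simps)
  have in1: "inner (bridge_interp u z' - x) v = inner (bridge_interp a z - x) v + (D / d) * (norm v)\<^sup>2 + sqrt d * inner v \<zeta>"
  proof -
    have "bridge_interp u z' - x = (bridge_interp a z - x) + ((D / d) *\<^sub>R v + sqrt d *\<^sub>R \<zeta>)"
      using diff by (simp add: algebra_simps)
    then show ?thesis by (simp add: inner_simps power2_norm_eq_inner inner_commute)
  qed
  have ex: "- (norm \<zeta>)\<^sup>2 / (2 * (D / d)) + (inner (bridge_interp a z - x) v / d - (a - s) * (norm v)\<^sup>2 / (2 * d\<^sup>2)) =
     - (norm (bridge_interp u z' - bridge_interp a z))\<^sup>2 / (2 * D) + (inner (bridge_interp u z' - x) v / d - (u - s) * (norm v)\<^sup>2 / (2 * d\<^sup>2))"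
  proof -
    have us: "u - s = (a - s) + D" by (simp add: D_def)
    show ?thesis
      unfolding n2 in1 us using d D
      by (simp add: field_simps power2_eq_square)
  qed
  have "heat (D / d) \<zeta> * bridge_tilt a (bridge_interp a z) = (2 * pi * (D / d)) powr (- 3 / 2) *
      exp (- (norm \<zeta>)\<^sup>2 / (2 * (D / d)) + (inner (bridge_interp a z - x) v / d - (a - s) * (norm v)\<^sup>2 / (2 * d\<^sup>2)))"
    unfolding heat_def bridge_tilt_def d_def[symmetric] v_def[symmetric] by (simp only: exp_add mult.assoc)
  also have "\<dots> = sqrt d ^ 3 * heat D (bridge_interp u z' - bridge_interp a z) * bridge_tilt u (bridge_interp u z')"
    unfolding ex pre unfolding heat_def bridge_tilt_def d_def[symmetric] v_def[symmetric] by (simp only: exp_add mult.assoc)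
  finally show ?thesis by (simp only: t \<zeta>_def d_def D_def)
qed

text \<open>The tilts telescope along the chain, and each factor \<open>sqrt (e - s) ^ 3\<close> is
  used up as the Jacobian of one integration. There is one more heat kernel than there are
  integrations, since the endpoint is fixed; hence one such factor survives, together with the tilt
  at the end.\<close>

lemma bm_op_interp:
  assumes se: "s < e"
    and L: "\<And>u f. (u, f) \<in> set L \<Longrightarrow> f \<in> borel_measurable borel"
    and sorted: "sorted_wrt (<) (a # map fst L @ [e])"
  shows "bm_op ((a - s) / (e - s)) (map (\<lambda>(u, f). ((u - s) / (e - s), \<lambda>z. f (bridge_interp u z))) L)
      (\<lambda>r z. ennreal (heat (1 - r) (0 - z))) z * ennreal (bridge_tilt a (bridge_interp a z)) =
    ennreal (sqrt (e - s) ^ 3 * bridge_tilt e y) * bm_op a L (heat_to e y) (bridge_interp a z)"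
  using L sorted
proof (induction L arbitrary: a z)
  case Nil
  have "bridge_interp e 0 = y" using se by (simp add: bridge_interp_def)
  with heat_interp[OF se, of a e 0 z] Nil se show ?case
    by (simp add: ennreal_mult[symmetric] heat_nonneg bridge_tilt_def mult_ac)
next
  case (Cons p L)
  obtain u f where p: "p = (u, f)" by (cases p)
  let ?d = "e - s"
  let ?L = "map (\<lambda>(u, f). ((u - s) / (e - s), \<lambda>z. f (bridge_interp u z))) L"
  let ?g = "\<lambda>r z. ennreal (heat (1 - r) (0 - z))"
  let ?G = "\<lambda>r w. ennreal (heat (e - r) (y - w))"
  let ?K = "ennreal (sqrt (e - s) ^ 3 * bridge_tilt e y)"
  have f[measurable]: "f \<in> borel_measurable borel" using Cons.prems(1)[of u f] p by simp
  have "a < u" using Cons.prems(2) p by simp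
  have [measurable]: "bridge_interp u \<in> borel_measurable borel" unfolding bridge_interp_def by measurable
  have mG: "(\<lambda>(q, s, x). bm_op s L ?G x) \<in> borel_measurable ((borel :: real measure) \<Otimes>\<^sub>M borel \<Otimes>\<^sub>M borel)"
    by (rule measurable_bm_op) (use Cons.prems(1) in auto)
  have [measurable]: "(\<lambda>w. bm_op u L ?G w) \<in> borel_measurable borel"
    using measurable_compose[OF _ mG, of "\<lambda>z. (0, u, z)" borel] by simp
  have mg: "(\<lambda>(q, s, x). bm_op s ?L ?g x) \<in> borel_measurable ((borel :: real measure) \<Otimes>\<^sub>M borel \<Otimes>\<^sub>M borel)"
  proof (rule measurable_bm_op)
    fix v k assume "(v, k) \<in> set ?L"
    then obtain u' f' where *: "(u', f') \<in> set L" "k = (\<lambda>z. f' (bridge_interp u' z))" by auto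
    have [measurable]: "f' \<in> borel_measurable borel" using Cons.prems(1)[of u' f'] * by auto
    show "k \<in> borel_measurable borel" unfolding *(2) bridge_interp_def by measurable
  qed auto
  have [measurable]: "(\<lambda>w. bm_op ((u - s) / ?d) ?L ?g w) \<in> borel_measurable borel"
    using measurable_compose[OF _ mg, of "\<lambda>z. (0, (u - s) / ?d, z)" borel] by simp
  have IH: "bm_op ((u - s) / ?d) ?L ?g z' * ennreal (bridge_tilt u (bridge_interp u z')) = ?K * bm_op u L ?G (bridge_interp u z')" for z'
    by (rule Cons.IH) (use Cons.prems p in auto)
  have "bm_op ((a - s) / ?d) (map (\<lambda>(u, f). ((u - s) / ?d, \<lambda>z. f (bridge_interp u z))) (p # L)) ?g z * ennreal (bridge_tilt a (bridge_interp a z)) =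
     (\<integral>\<^sup>+z'. ennreal (heat ((u - s) / ?d - (a - s) / ?d) (z' - z) * bridge_tilt a (bridge_interp a z)) * (f (bridge_interp u z') * bm_op ((u - s) / ?d) ?L ?g z') \<partial>lborel)"
    unfolding p list.map prod.case bm_op.simps
    by (subst nn_integral_multc[symmetric])
      (measurable, simp add: ennreal_mult heat_nonneg bridge_tilt_def mult_ac)
  also have "\<dots> = (\<integral>\<^sup>+z'. ennreal (sqrt ?d ^ 3) * (ennreal (heat (u - a) (bridge_interp u z' - bridge_interp a z)) * (f (bridge_interp u z') * (?K * bm_op u L ?G (bridge_interp u z')))) \<partial>lborel)"
    unfolding heat_interp[OF se \<open>a < u\<close>] IH[symmetric]
    using se by (intro nn_integral_cong) (simp add: ennreal_mult heat_nonneg bridge_tilt_def mult_ac)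
  also have "\<dots> = ennreal (sqrt ?d ^ 3) * (\<integral>\<^sup>+z'. ennreal (heat (u - a) (bridge_interp u z' - bridge_interp a z)) * (f (bridge_interp u z') * (?K * bm_op u L ?G (bridge_interp u z'))) \<partial>lborel)"
    by (rule nn_integral_cmult) measurable
  also have "\<dots> = (\<integral>\<^sup>+w. ennreal (heat (u - a) (w - bridge_interp a z)) * (f w * (?K * bm_op u L ?G w)) \<partial>lborel)"
    unfolding bridge_interp_def[of u]
    by (rule nn_integral_lborel_affine[symmetric]) (use se in auto)
  also have "\<dots> = (\<integral>\<^sup>+w. ?K * (ennreal (heat (u - a) (w - bridge_interp a z)) * (f w * bm_op u L ?G w)) \<partial>lborel)"
    by (simp add: mult_ac)
  also have "\<dots> = ?K * bm_op a (p # L) ?G (bridge_interp a z)"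
    by (simp add: p nn_integral_cmult)
  finally show ?case .
qed

text \<open>The interpolated bridge is Brownian motion from \<open>x\<close> conditioned to be at
  \<open>y\<close> at time \<open>e\<close>. Multiplying by the transition density undoes the
  conditioning.\<close>

lemma bridge_bm_op:
  assumes se: "s < e"
    and b: "standard_brownian_bridge M b"
    and L: "\<And>u f. (u, f) \<in> set L \<Longrightarrow> f \<in> borel_measurable borel"
    and sorted: "sorted_wrt (<) (s # map fst L @ [e])"
  shows "ennreal (heat (e - s) (y - x)) * (\<integral>\<^sup>+\<omega>. path_prod L (\<lambda>u. bridge_interp u (b ((u - s) / (e - s)) \<omega>)) \<partial>M) =
    bm_op s L (heat_to e y) x"
proof -
  define n where "n = length L"
  define r where "r k = ((s # map fst L @ [e]) ! k - s) / (e - s)" for k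
  define F where "F k z = snd (L ! k) (bridge_interp (fst (L ! k)) z)" for k z
  have r0: "r 0 = 0" by (simp add: r_def)
  have rS: "r (Suc k) = (fst (L ! k) - s) / (e - s)" if "k < n" for k
    using that by (simp add: r_def n_def nth_append)
  have mono: "strict_mono_on {..Suc n} r"
  proof (rule strict_mono_onI)
    fix i j assume "i \<in> {..Suc n}" "j \<in> {..Suc n}" "i < j"
    then have "(s # map fst L @ [e]) ! i < (s # map fst L @ [e]) ! j"
      using sorted by (simp add: sorted_wrt_iff_nth_less n_def del: sorted_wrt.simps)
    then show "r i < r j" unfolding r_def using se by (intro divide_strict_right_mono) auto
  qed
  have rn1: "r (Suc n) = 1" using se by (simp add: r_def n_def nth_append)
  have rn: "r n < 1" using strict_mono_onD[OF mono, of n "Suc n"] rn1 by simp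
  have mono_n: "strict_mono_on {..n} r" using mono by (auto simp: strict_mono_on_def)
  have F[measurable]: "F k \<in> borel_measurable borel" if "k < n" for k
  proof -
    have [measurable]: "snd (L ! k) \<in> borel_measurable borel"
      using L[of "fst (L ! k)" "snd (L ! k)"] that by (simp add: n_def)
    show ?thesis unfolding F_def bridge_interp_def by measurable
  qed
  have dist: "distributed M (Pi\<^sub>M {1..n} (\<lambda>_. lborel)) (\<lambda>\<omega>. \<lambda>k\<in>{1..n}. b (r k) \<omega>) (\<lambda>z. ennreal (bridge_density n r z))"
    using b r0 mono_n rn unfolding standard_brownian_bridge_def by blast
  have prodF[measurable]: "(\<lambda>z. \<Prod>k<n. F k (z (Suc k))) \<in> borel_measurable (Pi\<^sub>M {1..n} (\<lambda>_. lborel))"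
  proof (rule borel_measurable_prod_ennreal)
    fix k assume "k \<in> {..<n}"
    then have "(\<lambda>z. z (Suc k)) \<in> borel_measurable (Pi\<^sub>M {1..n} (\<lambda>_. lborel :: R3 measure))"
      using measurable_component_singleton[of "Suc k" "{1..n}" "\<lambda>_. lborel :: R3 measure"] by simp
    from measurable_compose[OF this F[of k]] \<open>k \<in> {..<n}\<close>
    show "(\<lambda>z. F k (z (Suc k))) \<in> borel_measurable (Pi\<^sub>M {1..n} (\<lambda>_. lborel))" by simp
  qed
  have "(\<integral>\<^sup>+\<omega>. path_prod L (\<lambda>u. bridge_interp u (b ((u - s) / (e - s)) \<omega>)) \<partial>M) =
     (\<integral>\<^sup>+\<omega>. (\<Prod>k<n. F k ((\<lambda>k\<in>{1..n}. b (r k) \<omega>) (Suc k))) \<partial>M)"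
    unfolding path_prod_nth n_def[symmetric]
    by (intro nn_integral_cong prod.cong) (auto simp: F_def rS)
  also have "\<dots> = (\<integral>\<^sup>+z. ennreal (bridge_density n r z) * (\<Prod>k<n. F k (z (Suc k))) \<partial>Pi\<^sub>M {1..n} (\<lambda>_. lborel))"
    by (rule distributed_nn_integral[OF dist prodF, symmetric])
  \<comment> \<open>This factor clears the denominator of \<open>bridge_density\<close>; being
    positive and finite, it is cancelled at the end.\<close>
  also have "ennreal (heat 1 0) * \<dots> = (\<integral>\<^sup>+z. ennreal (heat 1 0) * (ennreal (bridge_density n r z) * (\<Prod>k<n. F k (z (Suc k)))) \<partial>Pi\<^sub>M {1..n} (\<lambda>_. lborel))"
    by (intro nn_integral_cmult[symmetric] borel_measurable_times_ennreal distributed_borel_measurable[OF dist] prodF)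
  also have "\<dots> = (\<integral>\<^sup>+z. (\<Prod>k<n. ennreal (heat (r (Suc k) - r k) ((z(0 := 0)) (Suc k) - (z(0 := 0)) k)) * F k (z (Suc k))) *
      ennreal (heat (1 - r n) (0 - (z(0 := 0)) n)) \<partial>Pi\<^sub>M {1..n} (\<lambda>_. lborel))"
  proof (rule nn_integral_cong)
    fix z :: "nat \<Rightarrow> R3"
    have "heat 1 0 * bridge_density n r z = (\<Prod>k<n. heat (r (Suc k) - r k) ((z(0 := 0)) (Suc k) - (z(0 := 0)) k)) * heat (1 - r n) (0 - (z(0 := 0)) n)"
      using heat_pos[of 1 0] by (simp add: bridge_density_def Let_def)
    then have "ennreal (heat 1 0) * ennreal (bridge_density n r z) = (\<Prod>k<n. ennreal (heat (r (Suc k) - r k) ((z(0 := 0)) (Suc k) - (z(0 := 0)) k))) * ennreal (heat (1 - r n) (0 - (z(0 := 0)) n))"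
      by (simp add: ennreal_mult[symmetric] prod_ennreal heat_nonneg prod_nonneg ennreal_mult'[symmetric] del: fun_upd_apply)
    then show "ennreal (heat 1 0) * (ennreal (bridge_density n r z) * (\<Prod>k<n. F k (z (Suc k)))) =
      (\<Prod>k<n. ennreal (heat (r (Suc k) - r k) ((z(0 := 0)) (Suc k) - (z(0 := 0)) k)) * F k (z (Suc k))) * ennreal (heat (1 - r n) (0 - (z(0 := 0)) n))"
      by (simp add: prod.distrib mult.assoc[symmetric] del: fun_upd_apply) (simp add: mult_ac del: fun_upd_apply)
  qed
  also have "\<dots> = bm_op (r 0) (map (\<lambda>k. (r (Suc k), F k)) [0..<n]) (\<lambda>_ z. ennreal (heat (1 - r n) (0 - z))) 0"
    using nn_integral_PiM_bm_op[of n F "\<lambda>z. ennreal (heat (1 - r n) (0 - z))" r 0] by simp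
  also have "\<dots> = bm_op ((s - s) / (e - s)) (map (\<lambda>(u, f). ((u - s) / (e - s), \<lambda>z. f (bridge_interp u z))) L) (\<lambda>r z. ennreal (heat (1 - r) (0 - z))) 0"
    (is "?A = ?B")
  proof -
    have map: "map (\<lambda>(u, f). ((u - s) / (e - s), \<lambda>z. f (bridge_interp u z))) L = map (\<lambda>k. (r (Suc k), F k)) [0..<n]"
      by (rule nth_equalityI) (auto simp: n_def[symmetric] rS F_def[abs_def] split_beta')
    have last: "last (r 0 # map fst (map (\<lambda>k. (r (Suc k), F k)) [0..<n])) = r n"
      by (cases n) auto
    have "?B = bm_op (r 0) (map (\<lambda>k. (r (Suc k), F k)) [0..<n]) (\<lambda>r z. ennreal (heat (1 - r) (0 - z))) 0"
      unfolding map by (simp add: r0)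
    also have "\<dots> = ?A" by (subst bm_op_last) (simp only: last)
    finally show ?thesis by simp
  qed
  also have "\<dots> = ennreal (sqrt (e - s) ^ 3 * bridge_tilt e y) * bm_op s L (heat_to e y) x"
    using bm_op_interp[OF se L sorted, where z=0] by (simp add: bridge_interp_def bridge_tilt_def)
  finally have *: "ennreal (heat 1 0) * (\<integral>\<^sup>+\<omega>. path_prod L (\<lambda>u. bridge_interp u (b ((u - s) / (e - s)) \<omega>)) \<partial>M) =
    ennreal (sqrt (e - s) ^ 3 * bridge_tilt e y) * bm_op s L (heat_to e y) x" .
  \<comment> \<open>The surviving constants are identified by \<open>heat_interp\<close> for the
    single step from \<open>s\<close> to \<open>e\<close>, that is, by the case without
    tests.\<close>
  have K: "heat (e - s) (y - x) * (sqrt (e - s) ^ 3 * bridge_tilt e y) = heat 1 0"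
    using heat_interp[OF se, of s e 0 0] se by (simp add: bridge_interp_def bridge_tilt_def)
  let ?E = "\<integral>\<^sup>+\<omega>. path_prod L (\<lambda>u. bridge_interp u (b ((u - s) / (e - s)) \<omega>)) \<partial>M"
  have "ennreal (heat 1 0) * (ennreal (heat (e - s) (y - x)) * ?E) = ennreal (heat (e - s) (y - x)) * (ennreal (heat 1 0) * ?E)"
    by (simp add: mult_ac)
  also have "\<dots> = ennreal (heat (e - s) (y - x) * (sqrt (e - s) ^ 3 * bridge_tilt e y)) *
      bm_op s L (heat_to e y) x"
    unfolding * using se by (simp add: ennreal_mult heat_nonneg bridge_tilt_def mult_ac)
  also have "\<dots> = ennreal (heat 1 0) * bm_op s L (heat_to e y) x"
    by (simp only: K)
  finally show ?thesis
    using heat_pos[of 1 0] by (simp add: ennreal_mult_cancel_left)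
qed

end

section \<open>The interpolated path\<close>

lemma strict_chain_less:
  fixes \<tau> :: "nat \<Rightarrow> real"
  assumes "\<And>k. k < n \<Longrightarrow> \<tau> k < \<tau> (Suc k)" "i < j" "j \<le> n"
  shows "\<tau> i < \<tau> j"
  using assms(2,3)
proof (induction j)
  case (Suc j)
  then show ?case using assms(1)[of j] by (cases "i = j") auto
qed simp

lemma strict_chain_le:
  fixes \<tau> :: "nat \<Rightarrow> real"
  assumes "\<And>k. k < n \<Longrightarrow> \<tau> k < \<tau> (Suc k)" "i \<le> j" "j \<le> n"
  shows "\<tau> i \<le> \<tau> j"
  using strict_chain_less[of n \<tau> i j] assms by (cases "i = j") auto

text \<open>The clamped processes are continuous in time on the whole line, as
  \<open>measurable_continuous_process\<close> requires.\<close>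
lemma W_clamp:
  "W U \<tau> \<xi> B b \<omega> = W U \<tau> \<xi> (\<lambda>s. B (max 0 s)) (\<lambda>k v. b k (max 0 (min 1 v))) \<omega>"
proof -
  have "max 0 (min 1 ((s - \<tau> k \<omega>) / (\<tau> (Suc k) \<omega> - \<tau> k \<omega>))) = (s - \<tau> k \<omega>) / (\<tau> (Suc k) \<omega> - \<tau> k \<omega>)"
    if "\<tau> k \<omega> \<le> s \<and> s < \<tau> (Suc k) \<omega>" for s k
    using that by (auto simp: max_def min_def divide_simps)
  then show ?thesis
    unfolding W_def by (auto simp: Let_def intro!: restrict_ext sum.cong)
qed

lemma measurable_W:
  assumes U: "U \<in> K \<rightarrow>\<^sub>M count_space UNIV"
    and \<tau>[measurable]: "\<And>k. \<tau> k \<in> borel_measurable K" and \<xi>[measurable]: "\<And>k. \<xi> k \<in> borel_measurable K"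
    and B: "\<And>s. s \<ge> 0 \<Longrightarrow> B s \<in> borel_measurable K" "\<And>\<omega>. \<omega> \<in> space K \<Longrightarrow> continuous_on {0..} (\<lambda>s. B s \<omega>)"
    and b: "\<And>k v. v \<in> {0..1} \<Longrightarrow> b k v \<in> borel_measurable K"
      "\<And>k \<omega>. \<omega> \<in> space K \<Longrightarrow> continuous_on {0..1} (\<lambda>v. b k v \<omega>)"
    and s: "s \<ge> 0"
  shows "(\<lambda>\<omega>. W U \<tau> \<xi> B b \<omega> s) \<in> borel_measurable K"
proof -
  define B' where "B' s = B (max 0 s)" for s
  define b' where "b' k v = b k (max 0 (min 1 v))" for k v
  have "(\<lambda>(s, \<omega>). B' s \<omega>) \<in> borel_measurable (borel \<Otimes>\<^sub>M K)"
  proof (rule measurable_continuous_process)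
    show "B' s \<in> borel_measurable K" for s unfolding B'_def by (rule B) auto
    show "continuous_on UNIV (\<lambda>s. B' s \<omega>)" if "\<omega> \<in> space K" for \<omega>
      unfolding B'_def by (rule continuous_on_compose2[OF B(2)[OF that]])
        (auto intro!: continuous_on_max continuous_on_const continuous_on_id)
  qed
  then have B'[measurable (raw)]: "(\<lambda>\<omega>. B' (f \<omega>) \<omega>) \<in> borel_measurable K" if [measurable]: "f \<in> borel_measurable K" for f
    using measurable_compose[of "\<lambda>\<omega>. (f \<omega>, \<omega>)" K "borel \<Otimes>\<^sub>M K"] by simp
  have "(\<lambda>(v, \<omega>). b' k v \<omega>) \<in> borel_measurable (borel \<Otimes>\<^sub>M K)" for k
  proof (rule measurable_continuous_process)
    show "b' k s \<in> borel_measurable K" for s unfolding b'_def by (rule b) auto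
    show "continuous_on UNIV (\<lambda>s. b' k s \<omega>)" if "\<omega> \<in> space K" for \<omega>
      unfolding b'_def by (rule continuous_on_compose2[OF b(2)[OF that]])
        (auto intro!: continuous_on_max continuous_on_min continuous_on_const continuous_on_id)
  qed
  then have b'[measurable (raw)]: "(\<lambda>\<omega>. b' k (f \<omega>) \<omega>) \<in> borel_measurable K" if [measurable]: "f \<in> borel_measurable K" for f k
    using measurable_compose[of "\<lambda>\<omega>. (f \<omega>, \<omega>)" K "borel \<Otimes>\<^sub>M K"] by simp
  \<comment> \<open>For a fixed number of points the path is a finite expression in measurable
    terms; the countably many values of \<open>U\<close> are then put together.\<close>
  have "(\<lambda>\<omega>. W (\<lambda>_. n) \<tau> \<xi> B' b' \<omega> s) \<in> borel_measurable K" for n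
    using s unfolding W_def Let_def by simp
  from measurable_compose_countable[OF this U]
  have "(\<lambda>\<omega>. W (\<lambda>_. U \<omega>) \<tau> \<xi> B' b' \<omega> s) \<in> borel_measurable K" .
  then show ?thesis
    by (subst W_clamp) (simp add: W_def B'_def[abs_def] b'_def[abs_def])
qed

text \<open>Only the points with index at most \<open>U \<omega>\<close> enter. The outcomes on the
  two sides may come from different spaces, so random points can be replaced by fixed ones or by
  points read from a product space.\<close>

lemma W_cong:
  assumes "U \<omega> = U' \<omega>'" "\<And>k. k \<le> U \<omega> \<Longrightarrow> \<tau> k \<omega> = \<tau>' k \<omega>' \<and> \<xi> k \<omega> = \<xi>' k \<omega>'"
    "\<And>s. B s \<omega> = B' s \<omega>'" "\<And>k v. b k v \<omega> = b' k v \<omega>'"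
  shows "W U \<tau> \<xi> B b \<omega> = W U' \<tau>' \<xi>' B' b' \<omega>'"
proof -
  have "(\<Sum>k<U \<omega>. if \<tau> k \<omega> \<le> s \<and> s < \<tau> (k + 1) \<omega> then
             (let d = \<tau> (k + 1) \<omega> - \<tau> k \<omega>; v = (s - \<tau> k \<omega>) / d in
               (1 - v) *\<^sub>R \<xi> k \<omega> + v *\<^sub>R \<xi> (k + 1) \<omega> + sqrt d *\<^sub>R b k v \<omega>) else 0) =
     (\<Sum>k<U' \<omega>'. if \<tau>' k \<omega>' \<le> s \<and> s < \<tau>' (k + 1) \<omega>' then
             (let d = \<tau>' (k + 1) \<omega>' - \<tau>' k \<omega>'; v = (s - \<tau>' k \<omega>') / d in
               (1 - v) *\<^sub>R \<xi>' k \<omega>' + v *\<^sub>R \<xi>' (k + 1) \<omega>' + sqrt d *\<^sub>R b' k v \<omega>') else 0)" for s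
    using assms by (intro sum.cong) auto
  moreover have "(\<forall>k<U \<omega>. \<tau> k \<omega> < \<tau> (k + 1) \<omega>) \<longleftrightarrow> (\<forall>k<U' \<omega>'. \<tau>' k \<omega>' < \<tau>' (k + 1) \<omega>')"
  proof -
    have "\<tau> k \<omega> < \<tau> (k + 1) \<omega> \<longleftrightarrow> \<tau>' k \<omega>' < \<tau>' (k + 1) \<omega>'" if "k < U \<omega>" for k
      using assms(2)[of k] assms(2)[of "k + 1"] that by simp
    then show ?thesis using assms(1) by auto
  qed
  moreover have "(if \<tau> (U \<omega>) \<omega> \<le> s then \<xi> (U \<omega>) \<omega> + B (s - \<tau> (U \<omega>) \<omega>) \<omega> else 0) =
      (if \<tau>' (U' \<omega>') \<omega>' \<le> s then \<xi>' (U' \<omega>') \<omega>' + B' (s - \<tau>' (U' \<omega>') \<omega>') \<omega>' else 0)" for s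
    using assms(1,3) assms(2)[of "U \<omega>"] by simp
  ultimately show ?thesis
    unfolding W_def by (simp only:)
qed

lemma W_bridge:
  assumes inc: "\<And>k. k < U \<omega> \<Longrightarrow> \<tau> k \<omega> < \<tau> (Suc k) \<omega>" and \<tau>0: "\<tau> 0 \<omega> \<ge> 0"
    and k: "k < U \<omega>" and s: "\<tau> k \<omega> \<le> s" "s < \<tau> (Suc k) \<omega>"
  shows "W U \<tau> \<xi> B b \<omega> s = bridge_interp (\<xi> k \<omega>) (\<xi> (Suc k) \<omega>) (\<tau> k \<omega>) (\<tau> (Suc k) \<omega>) s
    (b k ((s - \<tau> k \<omega>) / (\<tau> (Suc k) \<omega> - \<tau> k \<omega>)) \<omega>)"
proof -
  note le = strict_chain_le[of "U \<omega>" "\<lambda>k. \<tau> k \<omega>", OF inc]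
  have "s \<ge> 0" using le[of 0 k] k s \<tau>0 by simp
  have uniq: "\<tau> j \<omega> \<le> s \<and> s < \<tau> (Suc j) \<omega> \<longleftrightarrow> j = k" if "j < U \<omega>" for j
    using le[of "Suc j" k] le[of "Suc k" j] s k that by (cases j k rule: linorder_cases) auto
  have "\<not> \<tau> (U \<omega>) \<omega> \<le> s" using le[of "Suc k" "U \<omega>"] k s by simp
  moreover have "(\<Sum>j<U \<omega>. if \<tau> j \<omega> \<le> s \<and> s < \<tau> (j + 1) \<omega> then
             (let d = \<tau> (j + 1) \<omega> - \<tau> j \<omega>; v = (s - \<tau> j \<omega>) / d in
               (1 - v) *\<^sub>R \<xi> j \<omega> + v *\<^sub>R \<xi> (j + 1) \<omega> + sqrt d *\<^sub>R b j v \<omega>) else 0) =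
    (\<Sum>j<U \<omega>. if j = k then
             (let d = \<tau> (j + 1) \<omega> - \<tau> j \<omega>; v = (s - \<tau> j \<omega>) / d in
               (1 - v) *\<^sub>R \<xi> j \<omega> + v *\<^sub>R \<xi> (j + 1) \<omega> + sqrt d *\<^sub>R b j v \<omega>) else 0)"
    using uniq by (intro sum.cong) auto
  ultimately show ?thesis
    using inc k \<open>s \<ge> 0\<close> by (simp add: W_def Let_def bridge_interp_def)
qed

lemma W_tail:
  assumes inc: "\<And>k. k < U \<omega> \<Longrightarrow> \<tau> k \<omega> < \<tau> (Suc k) \<omega>" and \<tau>0: "\<tau> 0 \<omega> \<ge> 0"
    and s: "\<tau> (U \<omega>) \<omega> \<le> s"
  shows "W U \<tau> \<xi> B b \<omega> s = \<xi> (U \<omega>) \<omega> + B (s - \<tau> (U \<omega>) \<omega>) \<omega>"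
proof -
  note le = strict_chain_le[of "U \<omega>" "\<lambda>k. \<tau> k \<omega>", OF inc]
  have "s \<ge> 0" using le[of 0 "U \<omega>"] s \<tau>0 by simp
  have "\<not> s < \<tau> (Suc j) \<omega>" if "j < U \<omega>" for j
    using le[of "Suc j" "U \<omega>"] s that by simp
  then have "(\<Sum>j<U \<omega>. if \<tau> j \<omega> \<le> s \<and> s < \<tau> (j + 1) \<omega> then
             (let d = \<tau> (j + 1) \<omega> - \<tau> j \<omega>; v = (s - \<tau> j \<omega>) / d in
               (1 - v) *\<^sub>R \<xi> j \<omega> + v *\<^sub>R \<xi> (j + 1) \<omega> + sqrt d *\<^sub>R b j v \<omega>) else 0) = 0"
    by (intro sum.neutral) auto
  then show ?thesis
    using inc s \<open>s \<ge> 0\<close> by (simp add: W_def)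
qed

text \<open>On each closed interval between consecutive times the path agrees with a continuous
  bridge expression. The defining formula is half-open, so the value at the right end comes from the
  next piece; \<open>W_at\<close> shows that it fits, because the bridges vanish at 0 and 1 and
  \<open>B\<close> at 0.\<close>

lemma continuous_W:
  assumes B: "B 0 \<omega> = 0" "continuous_on {0..} (\<lambda>s. B s \<omega>)"
    and b: "\<And>k. b k 0 \<omega> = 0 \<and> b k 1 \<omega> = 0 \<and> continuous_on {0..1} (\<lambda>v. b k v \<omega>)"
    and \<tau>0: "\<tau> 0 \<omega> = 0"
  shows "continuous_on {0..} (W U \<tau> \<xi> B b \<omega>)"
proof (cases "\<forall>k<U \<omega>. \<tau> k \<omega> < \<tau> (Suc k) \<omega>")
  case False
  then have F: "(\<forall>k<U \<omega>. \<tau> k \<omega> < \<tau> (k + 1) \<omega>) = False" by simp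
  have "W U \<tau> \<xi> B b \<omega> = (\<lambda>s\<in>{0..}. 0)" by (simp only: W_def F if_False)
  then show ?thesis
    by (auto intro: continuous_on_eq[OF continuous_on_const])
next
  case True
  let ?W = "W U \<tau> \<xi> B b \<omega>"
  define t where "t k = \<tau> k \<omega>" for k
  note le = strict_chain_le[of "U \<omega>" t]
  have inc: "k < U \<omega> \<Longrightarrow> t k < t (Suc k)" for k using True by (simp add: t_def)
  have t0: "t 0 = 0" using \<tau>0 by (simp add: t_def)
  have W_at: "?W (t k) = \<xi> k \<omega>" if "k \<le> U \<omega>" for k
  proof (cases "k = U \<omega>")
    case True
    then show ?thesis using W_tail[of U \<omega> \<tau> "t k"] inc t0 B(1) by (auto simp: t_def)
  next
    case False
    then have "k < U \<omega>" using that by simp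
    then show ?thesis
      using W_bridge[of U \<omega> \<tau> k "t k"] inc[of k] inc t0 b by (auto simp: t_def bridge_interp_def)
  qed
  have piece: "continuous_on {t k..t (Suc k)} ?W" if k: "k < U \<omega>" for k
  proof (rule continuous_on_eq)
    let ?d = "t (Suc k) - t k"
    let ?p = "\<lambda>s. bridge_interp (\<xi> k \<omega>) (\<xi> (Suc k) \<omega>) (t k) (t (Suc k)) s (b k ((s - t k) / ?d) \<omega>)"
    have "?d > 0" using inc[OF k] by simp
    have "continuous_on {t k..t (Suc k)} (\<lambda>s. b k ((s - t k) / ?d) \<omega>)"
    proof (rule continuous_on_compose2[of "{0..1}" "\<lambda>v. b k v \<omega>"])
      show "continuous_on {0..1} (\<lambda>v. b k v \<omega>)" using b by blast
      show "continuous_on {t k..t (Suc k)} (\<lambda>s. (s - t k) / ?d)"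
        using \<open>?d > 0\<close> by (intro continuous_intros) auto
    qed (use \<open>?d > 0\<close> in \<open>auto simp: divide_simps\<close>)
    then show "continuous_on {t k..t (Suc k)} ?p"
      unfolding bridge_interp_def using \<open>?d > 0\<close> by (intro continuous_intros) auto
    show "?p s = ?W s" if s: "s \<in> {t k..t (Suc k)}" for s
    proof (cases "s = t (Suc k)")
      case True
      then show ?thesis using W_at[of "Suc k"] k \<open>?d > 0\<close> b by (simp add: bridge_interp_def)
    next
      case False
      then show ?thesis
        using W_bridge[of U \<omega> \<tau> k s] inc k s t0 by (auto simp: t_def)
    qed
  qed
  have tail: "continuous_on {t (U \<omega>)..} ?W"
  proof (rule continuous_on_eq)
    show "continuous_on {t (U \<omega>)..} (\<lambda>s. \<xi> (U \<omega>) \<omega> + B (s - t (U \<omega>)) \<omega>)"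
      by (intro continuous_on_add continuous_on_const continuous_on_compose2[OF B(2)] continuous_on_diff continuous_on_id) auto
    show "\<xi> (U \<omega>) \<omega> + B (s - t (U \<omega>)) \<omega> = ?W s" if "s \<in> {t (U \<omega>)..}" for s
      using W_tail[of U \<omega> \<tau> s] inc t0 that by (auto simp: t_def)
  qed
  have "continuous_on {0..t k} ?W" if "k \<le> U \<omega>" for k
    using that
  proof (induction k)
    case 0
    then show ?case by (simp add: t0)
  next
    case (Suc k)
    have "{0..t (Suc k)} = {0..t k} \<union> {t k..t (Suc k)}"
    proof -
      have "t k < t (Suc k)" "0 \<le> t k"
        using inc[of k] le[of 0 k] inc Suc.prems t0 by auto
      then show ?thesis by auto
    qed
    then show ?case
      using Suc piece[of k] by (auto intro: continuous_on_closed_Un)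
  qed
  from this[of "U \<omega>"] tail have "continuous_on ({0..t (U \<omega>)} \<union> {t (U \<omega>)..}) ?W"
    by (intro continuous_on_closed_Un) auto
  moreover have "{0..t (U \<omega>)} \<union> {t (U \<omega>)..} = {0..}"
    using le[of 0 "U \<omega>"] inc t0 by auto
  ultimately show ?thesis by simp
qed

section \<open>Tests along the pieces of the path\<close>

lemma bm_op_shift:
  "bm_op s L g x = bm_op (s - a) (map (\<lambda>(u, f). (u - a, f)) L) (\<lambda>r. g (r + a)) x"
proof (induction L arbitrary: s x)
  case (Cons p L)
  obtain u f where "p = (u, f)" by (cases p)
  then show ?case using Cons by simp
qed simp

lemma path_prod_map_shift: "path_prod (map (\<lambda>(u, f). (u - a, f)) L) w = path_prod L (\<lambda>u. w (u - a))"
  by (induction L) auto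

lemma path_prod_cong:
  assumes "\<And>u f. (u, f) \<in> set L \<Longrightarrow> w u = w' u"
  shows "path_prod L w = path_prod L w'"
  using assms
proof (induction L)
  case (Cons p L)
  obtain u f where p: "p = (u, f)" by (cases p)
  have "path_prod L w = path_prod L w'"
    using Cons.prems by (intro Cons.IH) auto
  then show ?case using Cons.prems[of u f] by (simp add: p)
qed simp

lemma brownian_motion_bm_op:
  assumes B: "standard_brownian_motion M B"
    and L: "\<And>u f. (u, f) \<in> set L \<Longrightarrow> f \<in> borel_measurable borel" "sorted_wrt (<) (s # map fst L)"
  shows "(\<integral>\<^sup>+\<omega>. path_prod L (\<lambda>u. y + B (u - s) \<omega>) \<partial>M) = bm_op s L (\<lambda>_ _. 1) y"
proof -
  let ?L = "map (\<lambda>(u, f). (u - s, f)) L"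
  have M: "prob_space M" and inc: "gaussian_increments M (\<lambda>u \<omega>. y + B u \<omega>)"
    using B by (auto simp: standard_brownian_motion_def gaussian_increments_def)
  have "sorted_wrt (<) (0 # map fst ?L)"
    using L(2) by (auto simp: sorted_wrt_map split_beta')
  note sorted = this
  have start: "AE \<omega> in M. y + B 0 \<omega> = y"
    using B by (simp add: standard_brownian_motion_def)
  have meas: "(\<lambda>\<omega>. y + B u \<omega>) \<in> borel_measurable M" if "u \<ge> 0" for u
    using B that by (intro borel_measurable_add) (auto simp: standard_brownian_motion_def)
  have measL: "f \<in> borel_measurable borel" if "(u, f) \<in> set ?L" for u f
    using that L(1) by auto
  have "(\<integral>\<^sup>+\<omega>. path_prod ?L (\<lambda>u. y + B u \<omega>) * 1 \<partial>M) = bm_op 0 ?L (\<lambda>_ _. 1) y"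
    by (rule gaussian_increments_bm_op[OF M inc meas start measL sorted]) simp_all
  also have "\<dots> = bm_op s L (\<lambda>_ _. 1) y"
    by (subst bm_op_shift[of s L _ y s]) simp
  finally show ?thesis
    by (simp only: path_prod_map_shift mult_1_right)
qed

text \<open>The open intervals between the points, together with the final half-line, cover all
  tests once no test time equals a point time. The induction splits off the last interval.\<close>

lemma path_prod_filter_split:
  assumes L: "sorted_wrt (<) (0 # map fst L)" and \<tau>: "\<tau> 0 = 0" "\<And>k. k < n \<Longrightarrow> \<tau> k < \<tau> (Suc k)"
    and notin: "\<And>k. 1 \<le> k \<Longrightarrow> k \<le> n \<Longrightarrow> \<tau> k \<notin> fst ` set L"
  shows "path_prod L w = (\<Prod>k<n. path_prod (tests_between (\<tau> k) (\<tau> (Suc k)) L) w) *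
    path_prod (tests_after (\<tau> n) L) w"
  using \<tau>(2) notin
proof (induction n)
  case 0
  have "filter (\<lambda>p. 0 < fst p) L = L" using L by (auto simp: filter_id_conv)
  then show ?case by (simp add: \<tau>(1))
next
  case (Suc n)
  have "path_prod L w = (\<Prod>k<n. path_prod (tests_between (\<tau> k) (\<tau> (Suc k)) L) w) *
    path_prod (tests_after (\<tau> n) L) w"
    using Suc.prems by (intro Suc.IH) auto
  also have "tests_after (\<tau> n) L = tests_between (\<tau> n) (\<tau> (Suc n)) L @ tests_after (\<tau> (Suc n)) L"
    using L Suc.prems by (intro filter_sorted_split) auto
  finally show ?case by (simp add: mult.assoc)
qed

section \<open>Independence of the skeleton\<close>

lemma sets_vimage_algebra_subset_Pow: "sets (vimage_algebra X f N) \<subseteq> Pow X"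
  using sets.space_closed[of "vimage_algebra X f N"] by simp

lemma sets_sigma_vimage_algebra:
  "sets (sigma X (sets (vimage_algebra X f N))) = sets (vimage_algebra X f N)"
  using sets.sigma_sets_eq[of "vimage_algebra X f N"] sets.space_closed[of "vimage_algebra X f N"]
  by (simp add: sets_measure_of)

lemma measurable_sigma_vimage_algebra:
  assumes "g \<in> vimage_algebra X f N \<rightarrow>\<^sub>M K" "S = sets (vimage_algebra X f N)"
  shows "g \<in> sigma X S \<rightarrow>\<^sub>M K"
  using assms measurable_cong_sets[OF sets_sigma_vimage_algebra refl, of X f N K] by simp

lemma part_sigma_measurable:
  "s \<ge> 0 \<Longrightarrow> B s \<in> borel_measurable (sigma (space M) (part_sigma M U \<tau> \<xi> B b Tail))"
  "v \<in> {0..1} \<Longrightarrow> b k v \<in> borel_measurable (sigma (space M) (part_sigma M U \<tau> \<xi> B b (Bridge k)))"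
  "skeleton U \<tau> \<xi> \<in> sigma (space M) (part_sigma M U \<tau> \<xi> B b Skeleton) \<rightarrow>\<^sub>M count_space UNIV \<Otimes>\<^sub>M Pi\<^sub>M UNIV (\<lambda>_. borel)"
proof -
  show "B s \<in> borel_measurable (sigma (space M) (part_sigma M U \<tau> \<xi> B b Tail))" if "s \<ge> 0"
  proof (rule measurable_sigma_vimage_algebra)
    show "B s \<in> borel_measurable (vimage_algebra (space M) (\<lambda>\<omega>. \<lambda>s\<in>{0..}. B s \<omega>) (Pi\<^sub>M {0..} (\<lambda>_. borel)))"
      using measurable_compose[OF measurable_vimage_algebra1 measurable_component_singleton,
          of "\<lambda>\<omega>. \<lambda>s\<in>{0..}. B s \<omega>" "space M" "{0..}" "\<lambda>_. borel" s] that
      by (simp add: space_PiM)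
  qed (simp add: part_sigma_def)
  show "b k v \<in> borel_measurable (sigma (space M) (part_sigma M U \<tau> \<xi> B b (Bridge k)))" if "v \<in> {0..1}"
  proof (rule measurable_sigma_vimage_algebra)
    show "b k v \<in> borel_measurable (vimage_algebra (space M) (\<lambda>\<omega>. \<lambda>s\<in>{0..1}. b k s \<omega>) (Pi\<^sub>M {0..1} (\<lambda>_. borel)))"
      using measurable_compose[OF measurable_vimage_algebra1 measurable_component_singleton,
          of "\<lambda>\<omega>. \<lambda>s\<in>{0..1}. b k s \<omega>" "space M" "{0..1}" "\<lambda>_. borel" v] that
      by (simp add: space_PiM)
  qed (simp add: part_sigma_def)
  show "skeleton U \<tau> \<xi> \<in> sigma (space M) (part_sigma M U \<tau> \<xi> B b Skeleton) \<rightarrow>\<^sub>M count_space UNIV \<Otimes>\<^sub>M Pi\<^sub>M UNIV (\<lambda>_. borel)"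
  proof (rule measurable_sigma_vimage_algebra)
    show "skeleton U \<tau> \<xi> \<in> vimage_algebra (space M) (skeleton U \<tau> \<xi>) (count_space UNIV \<Otimes>\<^sub>M Pi\<^sub>M UNIV (\<lambda>_. borel))
        \<rightarrow>\<^sub>M count_space UNIV \<Otimes>\<^sub>M Pi\<^sub>M UNIV (\<lambda>_. borel)"
      by (rule measurable_vimage_algebra1) (auto simp: space_pair_measure space_PiM)
  qed (simp add: part_sigma_def)
qed

lemma sets_sigma_part_sigma:
  "sets (sigma (space M) (part_sigma M U \<tau> \<xi> B b i)) = part_sigma M U \<tau> \<xi> B b i"
  by (cases i) (simp_all add: part_sigma_def sets_sigma_vimage_algebra)

lemma part_sigma_subset_Pow: "part_sigma M U \<tau> \<xi> B b i \<subseteq> Pow (space M)"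
  by (cases i) (simp_all add: part_sigma_def sets_vimage_algebra_subset_Pow)

lemma space_sigma_part_sigma[simp]: "space (sigma (space M) (part_sigma M U \<tau> \<xi> B b i)) = space M"
  using part_sigma_subset_Pow by (rule space_measure_of)

lemma Union_part_sigma_subset_Pow: "(\<Union>i\<in>I. part_sigma M U \<tau> \<xi> B b i) \<subseteq> Pow (space M)"
  using part_sigma_subset_Pow by (rule UN_least)

lemma nn_integral_prod_parts:
  assumes M: "prob_space M" and ind: "prob_space.indep_sets M (part_sigma M U \<tau> \<xi> B b) UNIV"
    and I: "finite I" and Y: "\<And>i. i \<in> I \<Longrightarrow> Y i \<in> borel_measurable (sigma (space M) (part_sigma M U \<tau> \<xi> B b i))"
  shows "(\<integral>\<^sup>+\<omega>. (\<Prod>i\<in>I. Y i \<omega>) \<partial>M) = (\<Prod>i\<in>I. \<integral>\<^sup>+\<omega>. Y i \<omega> \<partial>M)"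
proof -
  interpret prob_space M by fact
  have part: "Y i -` A \<inter> space M \<in> part_sigma M U \<tau> \<xi> B b i" if "i \<in> I" "A \<in> sets borel" for i A
    using measurable_sets[OF Y[OF that(1)] that(2)] by (simp add: sets_sigma_part_sigma)
  have ev: "part_sigma M U \<tau> \<xi> B b i \<subseteq> events" for i
    using ind by (simp add: indep_sets_def)
  have "indep_vars (\<lambda>_. borel) Y I"
    unfolding indep_vars_def2
  proof (intro conjI ballI)
    show "random_variable borel (Y i)" if "i \<in> I" for i
      using part[OF that] ev by (intro measurableI) auto
    show "indep_sets (\<lambda>i. {Y i -` A \<inter> space M |A. A \<in> sets borel}) I"
      by (rule indep_sets_mono[OF ind]) (use part in auto)
  qed
  then show ?thesis by (intro indep_vars_nn_integral I) auto
qed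

definition rest_sigma ::
  "'w measure \<Rightarrow> ('w \<Rightarrow> nat) \<Rightarrow> (nat \<Rightarrow> 'w \<Rightarrow> real) \<Rightarrow> (nat \<Rightarrow> 'w \<Rightarrow> R3) \<Rightarrow>
   (real \<Rightarrow> 'w \<Rightarrow> R3) \<Rightarrow> (nat \<Rightarrow> real \<Rightarrow> 'w \<Rightarrow> R3) \<Rightarrow> 'w measure" where
  "rest_sigma M U \<tau> \<xi> B b = sigma (space M) (\<Union>i\<in>- {Skeleton}. part_sigma M U \<tau> \<xi> B b i)"

lemma space_rest_sigma[simp]: "space (rest_sigma M U \<tau> \<xi> B b) = space M"
  unfolding rest_sigma_def by (rule space_measure_of[OF Union_part_sigma_subset_Pow])

lemma sets_rest_sigma:
  "sets (rest_sigma M U \<tau> \<xi> B b) = sigma_sets (space M) (\<Union>i\<in>- {Skeleton}. part_sigma M U \<tau> \<xi> B b i)"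
  unfolding rest_sigma_def by (rule sets_measure_of[OF Union_part_sigma_subset_Pow])

lemma measurable_rest_sigma:
  assumes "f \<in> sigma (space M) (part_sigma M U \<tau> \<xi> B b i) \<rightarrow>\<^sub>M K" "i \<noteq> Skeleton"
  shows "f \<in> rest_sigma M U \<tau> \<xi> B b \<rightarrow>\<^sub>M K"
proof (rule measurableI)
  note sp = space_sigma_part_sigma[of M U \<tau> \<xi> B b i]
  show "f \<omega> \<in> space K" if "\<omega> \<in> space (rest_sigma M U \<tau> \<xi> B b)" for \<omega>
    using measurable_space[OF assms(1)] that sp by auto
  show "f -` A \<inter> space (rest_sigma M U \<tau> \<xi> B b) \<in> sets (rest_sigma M U \<tau> \<xi> B b)" if "A \<in> sets K" for A
    using measurable_sets[OF assms(1) that] sp assms(2)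
    by (auto simp: sets_rest_sigma sets_sigma_part_sigma intro!: sigma_sets.Basic)
qed

text \<open>Independence of sigma-algebras is stated for the identity because \<open>indep_var\<close> requires two random
  variables with the same range type.\<close>
lemma indep_var_skeleton_rest:
  assumes M: "prob_space M" and ind: "prob_space.indep_sets M (part_sigma M U \<tau> \<xi> B b) UNIV"
  shows "prob_space.indep_var M (sigma (space M) (part_sigma M U \<tau> \<xi> B b Skeleton)) (\<lambda>\<omega>. \<omega>)
    (rest_sigma M U \<tau> \<xi> B b) (\<lambda>\<omega>. \<omega>)"
proof -
  interpret prob_space M by fact
  let ?p = "part_sigma M U \<tau> \<xi> B b"
  let ?V = "sigma (space M) (?p Skeleton)"
  let ?I = "\<lambda>j. if j then {Skeleton} else - {Skeleton}"
  have ev: "?p i \<subseteq> events" for i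
    using ind by (simp add: indep_sets_def)
  have "indep_sets (\<lambda>j. sigma_sets (space M) (\<Union>i\<in>?I j. ?p i)) UNIV"
  proof (rule indep_sets_collect_sigma)
    show "indep_sets ?p (\<Union>j\<in>UNIV. ?I j)"
      by (rule indep_sets_mono_index[OF _ ind]) auto
    show "Int_stable (?p i)" for i
      using sets.Int_stable[of "sigma (space M) (?p i)"] by (simp only: sets_sigma_part_sigma)
    show "disjoint_family_on ?I UNIV"
      by (auto simp: disjoint_family_on_def)
  qed
  then have *: "indep_set (sigma_sets (space M) (?p Skeleton)) (sets (rest_sigma M U \<tau> \<xi> B b))"
    unfolding indep_set_def
    by (rule indep_sets_mono_sets) (auto simp: sets_rest_sigma split: bool.splits)
  have Int: "(\<lambda>\<omega>. \<omega>) -` A \<inter> space M = A" if "A \<in> ?p i \<or> A \<in> sets (rest_sigma M U \<tau> \<xi> B b)" for A i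
    using that part_sigma_subset_Pow[of M U \<tau> \<xi> B b i] sets.sets_into_space[of A "rest_sigma M U \<tau> \<xi> B b"] by auto
  show ?thesis
    unfolding indep_var_eq
  proof (intro conjI)
    show "random_variable ?V (\<lambda>\<omega>. \<omega>)"
      using ev Int by (intro measurableI) (auto simp: sets_sigma_part_sigma)
    show "random_variable (rest_sigma M U \<tau> \<xi> B b) (\<lambda>\<omega>. \<omega>)"
    proof (rule measurableI)
      show "(\<lambda>\<omega>. \<omega>) -` A \<inter> space M \<in> events" if "A \<in> sets (rest_sigma M U \<tau> \<xi> B b)" for A
      proof -
        have "sigma_sets (space M) (\<Union>i\<in>- {Skeleton}. ?p i) \<subseteq> events"
          using ev by (intro sets.sigma_sets_subset) auto
        then show ?thesis using that by (auto simp: sets_rest_sigma)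
      qed
    qed auto
    have "{(\<lambda>\<omega>. \<omega>) -` A \<inter> space M |A. A \<in> sets ?V} = ?p Skeleton"
      using Int by (auto simp: sets_sigma_part_sigma) metis
    moreover have "{(\<lambda>\<omega>. \<omega>) -` A \<inter> space M |A. A \<in> sets (rest_sigma M U \<tau> \<xi> B b)} = sets (rest_sigma M U \<tau> \<xi> B b)"
      using Int by auto
    moreover have "sigma_sets (space M) (sets (rest_sigma M U \<tau> \<xi> B b)) = sets (rest_sigma M U \<tau> \<xi> B b)"
      using sets.sigma_sets_eq[of "rest_sigma M U \<tau> \<xi> B b"] by simp
    ultimately show "indep_set (sigma_sets (space M) {(\<lambda>\<omega>. \<omega>) -` A \<inter> space M |A. A \<in> sets ?V})
       (sigma_sets (space M) {(\<lambda>\<omega>. \<omega>) -` A \<inter> space M |A. A \<in> sets (rest_sigma M U \<tau> \<xi> B b)})"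
      using * by simp
  qed
qed

text \<open>The path with a frozen skeleton: only the bridges and the tail depend on the outcome.
  Entry 0 of \<open>z\<close> is overwritten, so \<open>z\<close> may come from the product space
  over \<open>{1..n}\<close>.\<close>

definition skeleton_path ::
  "R3 \<Rightarrow> (real \<Rightarrow> 'w \<Rightarrow> R3) \<Rightarrow> (nat \<Rightarrow> real \<Rightarrow> 'w \<Rightarrow> R3) \<Rightarrow> nat \<Rightarrow> (nat \<Rightarrow> real \<times> R3) \<Rightarrow> 'w \<Rightarrow> real \<Rightarrow> R3" where
  "skeleton_path x B b n z =
     W (\<lambda>_. n) (\<lambda>k _. fst ((z(0 := (0, x))) k)) (\<lambda>k _. snd ((z(0 := (0, x))) k)) B b"

lemma W_eq_skeleton_path:
  assumes "\<tau> 0 \<omega> = 0" "\<xi> 0 \<omega> = x" "\<And>k. 1 \<le> k \<Longrightarrow> k \<le> U \<omega> \<Longrightarrow> z k = (\<tau> k \<omega>, \<xi> k \<omega>)"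
  shows "W U \<tau> \<xi> B b \<omega> = skeleton_path x B b (U \<omega>) z \<omega>"
  unfolding skeleton_path_def by (rule W_cong) (use assms in auto)

lemma measurable_skeleton_path:
  fixes B :: "real \<Rightarrow> 'w \<Rightarrow> R3" and b :: "nat \<Rightarrow> real \<Rightarrow> 'w \<Rightarrow> R3"
  assumes B: "standard_brownian_motion M B" and b: "\<And>k. standard_brownian_bridge M (b k)"
    and K: "\<And>k. 1 \<le> k \<Longrightarrow> k \<le> n \<Longrightarrow> (\<lambda>p. z p k) \<in> borel_measurable K"
    and R: "R = rest_sigma M U \<tau> \<xi> B b" and s: "s \<ge> 0"
  shows "(\<lambda>(p, \<omega>). skeleton_path x B b n (z p) \<omega> s) \<in> borel_measurable (K \<Otimes>\<^sub>M R)"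
proof -
  \<comment> \<open>Measurability of \<open>z\<close> is known for the indices up to
    \<open>n\<close> only, while \<open>measurable_W\<close> asks for all of them; the others are
    set to a constant, which \<open>W_cong\<close> permits.\<close>
  let ?Z = "\<lambda>k p. if k \<le> n then ((z (fst p))(0 := (0, x))) k else (0, 0)"
  have Z: "?Z k \<in> borel_measurable (K \<Otimes>\<^sub>M R)" for k
    using measurable_compose[OF measurable_fst[of K R] K[of k]]
    by (cases "k = 0"; cases "k \<le> n") auto
  have "skeleton_path x B b n (z (fst p)) (snd p) =
      W (\<lambda>_. n) (\<lambda>k p. fst (?Z k p)) (\<lambda>k p. snd (?Z k p)) (\<lambda>s p. B s (snd p)) (\<lambda>k v p. b k v (snd p)) p" for p
    unfolding skeleton_path_def by (rule W_cong) auto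
  then have eq: "(\<lambda>(p, \<omega>). skeleton_path x B b n (z p) \<omega> s) =
      (\<lambda>p. W (\<lambda>_. n) (\<lambda>k p. fst (?Z k p)) (\<lambda>k p. snd (?Z k p)) (\<lambda>s p. B s (snd p)) (\<lambda>k v p. b k v (snd p)) p s)"
    by (simp only: split_beta')
  show ?thesis
    unfolding eq
  proof (rule measurable_W)
    have cb: "continuous_on UNIV (fst :: real \<times> R3 \<Rightarrow> real)" "continuous_on UNIV (snd :: real \<times> R3 \<Rightarrow> R3)"
      by (auto intro!: continuous_intros)
    show "(\<lambda>p. fst (?Z k p)) \<in> borel_measurable (K \<Otimes>\<^sub>M R)" "(\<lambda>p. snd (?Z k p)) \<in> borel_measurable (K \<Otimes>\<^sub>M R)" for k
      using measurable_compose[OF Z[of k] borel_measurable_continuous_onI[OF cb(1)]]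
        measurable_compose[OF Z[of k] borel_measurable_continuous_onI[OF cb(2)]] by auto
    show "(\<lambda>p. B s (snd p)) \<in> borel_measurable (K \<Otimes>\<^sub>M R)" if "s \<ge> 0" for s
      unfolding R
      by (rule measurable_compose[OF measurable_snd measurable_rest_sigma[OF part_sigma_measurable(1)[OF that]]]) simp
    show "(\<lambda>p. b k v (snd p)) \<in> borel_measurable (K \<Otimes>\<^sub>M R)" if "v \<in> {0..1}" for k v
      unfolding R
      by (rule measurable_compose[OF measurable_snd measurable_rest_sigma[OF part_sigma_measurable(2)[OF that]]]) simp
    fix p assume "p \<in> space (K \<Otimes>\<^sub>M R)"
    then have "snd p \<in> space M" by (auto simp: space_pair_measure R)
    then show "continuous_on {0..} (\<lambda>s. B s (snd p))" "continuous_on {0..1} (\<lambda>v. b k v (snd p))" for k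
      using B b by (auto simp: standard_brownian_motion_def standard_brownian_bridge_def)
  qed (use s in auto)
qed

section \<open>Integrating out the bridges\<close>

text \<open>Between the fixed points the path uses one bridge per interval, and afterwards the tail.
  These parts are independent, so the expectation factorises. The heat kernels on the left are the
  conditioning densities that \<open>bridge_bm_op\<close> needs, one per bridge.\<close>

lemma nn_integral_skeleton_path:
  fixes z :: "nat \<Rightarrow> real \<times> R3" and x :: R3
  assumes M: "prob_space M" and ind: "prob_space.indep_sets M (part_sigma M U \<tau> \<xi> B b) UNIV"
    and B: "standard_brownian_motion M B" and b: "\<And>k. standard_brownian_bridge M (b k)"
    and L: "\<And>u f. (u, f) \<in> set L \<Longrightarrow> f \<in> borel_measurable borel" "sorted_wrt (<) (0 # map fst L)"
  defines "t \<equiv> \<lambda>k. fst ((z(0 := (0, x))) k)" and "X \<equiv> \<lambda>k. snd ((z(0 := (0, x))) k)"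
  assumes inc: "\<And>k. k < n \<Longrightarrow> t k < t (Suc k)"
    and notin: "\<And>k. 1 \<le> k \<Longrightarrow> k \<le> n \<Longrightarrow> t k \<notin> fst ` set L"
  shows "(\<Prod>k<n. ennreal (heat (t (Suc k) - t k) (X (Suc k) - X k))) * (\<integral>\<^sup>+\<omega>. path_prod L (skeleton_path x B b n z \<omega>) \<partial>M) =
    (\<Prod>k<n. bm_op (t k) (tests_between (t k) (t (Suc k)) L)
      (heat_to (t (Suc k)) (X (Suc k))) (X k)) *
    bm_op (t n) (tests_after (t n) L) (\<lambda>_ _. 1) (X n)"
proof -
  let ?L = "\<lambda>k. tests_between (t k) (t (Suc k)) L"
  let ?R = "tests_after (t n) L"
  let ?I = "insert Tail (Bridge ` {..<n})"
  define F where "F i \<omega> = (case i of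
      Skeleton \<Rightarrow> 1
    | Tail \<Rightarrow> path_prod ?R (\<lambda>u. X n + B (u - t n) \<omega>)
    | Bridge k \<Rightarrow> path_prod (?L k) (\<lambda>u. bridge_interp (X k) (X (Suc k)) (t k) (t (Suc k)) u (b k ((u - t k) / (t (Suc k) - t k)) \<omega>)))" for i \<omega>
  have t0: "t 0 = 0" and X0: "X 0 = x" by (simp_all add: t_def X_def)
  have mL: "f \<in> borel_measurable borel" if "(u, f) \<in> set (?L k)" for u f k
    using L(1)[of u f] that by simp
  have mR: "f \<in> borel_measurable borel" if "(u, f) \<in> set ?R" for u f
    using L(1)[of u f] that by simp
  have Lpos: "sorted_wrt (<) (map fst L)" using L(2) by simp
  have prod: "(\<Prod>i\<in>?I. G i) = (\<Prod>k<n. G (Bridge k)) * G Tail" for G :: "part \<Rightarrow> ennreal"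
    by (subst prod.insert) (auto simp: prod.reindex inj_on_def mult.commute)
  have path: "path_prod L (skeleton_path x B b n z \<omega>) = (\<Prod>i\<in>?I. F i \<omega>)" for \<omega>
  proof -
    let ?w = "skeleton_path x B b n z \<omega>"
    have 1: "path_prod (?L k) ?w = F (Bridge k) \<omega>" if k: "k < n" for k
      unfolding F_def part.case
    proof (rule path_prod_cong)
      fix u f assume "(u, f) \<in> set (?L k)"
      then have "t k \<le> u" "u < t (Suc k)" by auto
      then show "?w u = bridge_interp (X k) (X (Suc k)) (t k) (t (Suc k)) u (b k ((u - t k) / (t (Suc k) - t k)) \<omega>)"
        unfolding skeleton_path_def t_def X_def
        by (intro W_bridge) (use inc k t0 in \<open>auto simp: t_def\<close>)
    qed
    have 2: "path_prod ?R ?w = F Tail \<omega>"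
      unfolding F_def part.case
    proof (rule path_prod_cong)
      fix u f assume "(u, f) \<in> set ?R"
      then have "t n \<le> u" by auto
      then show "?w u = X n + B (u - t n) \<omega>"
        unfolding skeleton_path_def t_def X_def
        by (intro W_tail) (use inc t0 in \<open>auto simp: t_def\<close>)
    qed
    have "path_prod L ?w = (\<Prod>k<n. path_prod (?L k) ?w) * path_prod ?R ?w"
      by (rule path_prod_filter_split[OF L(2) t0 inc notin]) auto
    also have "\<dots> = (\<Prod>k<n. F (Bridge k) \<omega>) * F Tail \<omega>"
      using 1 2 by (intro arg_cong2[where f="(*)"] prod.cong) auto
    also have "\<dots> = (\<Prod>i\<in>?I. F i \<omega>)" by (rule prod[symmetric])
    finally show ?thesis .
  qed
  have Fm: "F i \<in> borel_measurable (sigma (space M) (part_sigma M U \<tau> \<xi> B b i))" if i: "i \<in> ?I" for i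
  proof (cases i)
    case Tail
    show ?thesis
      unfolding Tail F_def[abs_def] part.case
    proof (rule measurable_path_prod, intro conjI)
      fix u f assume uf: "(u, f) \<in> set ?R"
      then have "u - t n \<ge> 0" by simp
      from part_sigma_measurable(1)[OF this, of B M U \<tau> \<xi> b]
      show "(\<lambda>\<omega>. X n + B (u - t n) \<omega>) \<in> borel_measurable (sigma (space M) (part_sigma M U \<tau> \<xi> B b Tail))"
        by (rule borel_measurable_add[OF borel_measurable_const])
    qed (rule mR)
  next
    case (Bridge k)
    have d: "t (Suc k) - t k > 0" using inc[of k] i Bridge by auto
    show ?thesis
      unfolding Bridge F_def[abs_def] part.case
    proof (rule measurable_path_prod, intro conjI)
      fix u f assume uf: "(u, f) \<in> set (?L k)"
      then have "(u - t k) / (t (Suc k) - t k) \<in> {0..1}" using d by auto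
      note [measurable] = part_sigma_measurable(2)[OF this, of b k M U \<tau> \<xi> B]
      show "(\<lambda>\<omega>. bridge_interp (X k) (X (Suc k)) (t k) (t (Suc k)) u (b k ((u - t k) / (t (Suc k) - t k)) \<omega>))
          \<in> borel_measurable (sigma (space M) (part_sigma M U \<tau> \<xi> B b (Bridge k)))"
        unfolding bridge_interp_def by measurable
    qed (rule mL)
  qed (use i in auto)
  have bridge: "ennreal (heat (t (Suc k) - t k) (X (Suc k) - X k)) * (\<integral>\<^sup>+\<omega>. F (Bridge k) \<omega> \<partial>M) =
      bm_op (t k) (?L k) (heat_to (t (Suc k)) (X (Suc k))) (X k)" if k: "k < n" for k
    unfolding F_def part.case
  proof (rule bridge_bm_op[OF inc[OF k] b mL])
    show "sorted_wrt (<) (t k # map fst (?L k) @ [t (Suc k)])"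
      using inc[OF k] sorted_map_filter[OF Lpos] by (auto simp: sorted_wrt_append)
  qed
  have tail: "(\<integral>\<^sup>+\<omega>. F Tail \<omega> \<partial>M) = bm_op (t n) ?R (\<lambda>_ _. 1) (X n)"
    unfolding F_def part.case
  proof (rule brownian_motion_bm_op[OF B mR])
    show "sorted_wrt (<) (t n # map fst ?R)"
      using sorted_map_filter[OF Lpos] by auto
  qed
  have "(\<integral>\<^sup>+\<omega>. path_prod L (skeleton_path x B b n z \<omega>) \<partial>M) = (\<Prod>i\<in>?I. \<integral>\<^sup>+\<omega>. F i \<omega> \<partial>M)"
    unfolding path by (rule nn_integral_prod_parts[OF M ind _ Fm]) auto
  also have "\<dots> = (\<Prod>k<n. \<integral>\<^sup>+\<omega>. F (Bridge k) \<omega> \<partial>M) * (\<integral>\<^sup>+\<omega>. F Tail \<omega> \<partial>M)"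
    by (rule prod)
  finally have "(\<Prod>k<n. ennreal (heat (t (Suc k) - t k) (X (Suc k) - X k))) * (\<integral>\<^sup>+\<omega>. path_prod L (skeleton_path x B b n z \<omega>) \<partial>M) =
     (\<Prod>k<n. ennreal (heat (t (Suc k) - t k) (X (Suc k) - X k)) * (\<integral>\<^sup>+\<omega>. F (Bridge k) \<omega> \<partial>M)) * (\<integral>\<^sup>+\<omega>. F Tail \<omega> \<partial>M)"
    by (simp add: prod.distrib mult.assoc)
  also have "\<dots> = (\<Prod>k<n. bm_op (t k) (?L k) (heat_to (t (Suc k)) (X (Suc k))) (X k)) * bm_op (t n) ?R (\<lambda>_ _. 1) (X n)"
    unfolding tail using bridge by (intro arg_cong2[where f="(*)"] prod.cong) auto
  finally show ?thesis .
qed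

lemma skeleton_path_cong:
  assumes "\<And>k. 1 \<le> k \<Longrightarrow> k \<le> n \<Longrightarrow> z k = z' k"
  shows "skeleton_path x B b n z \<omega> = skeleton_path x B b n z' \<omega>"
  unfolding skeleton_path_def by (rule W_cong) (use assms in auto)

lemma measurable_path_prod_skeleton_path:
  fixes B :: "real \<Rightarrow> 'w \<Rightarrow> R3" and b :: "nat \<Rightarrow> real \<Rightarrow> 'w \<Rightarrow> R3"
  assumes B: "standard_brownian_motion M B" and b: "\<And>k. standard_brownian_bridge M (b k)"
    and K: "\<And>k. 1 \<le> k \<Longrightarrow> k \<le> n \<Longrightarrow> (\<lambda>p. z p k) \<in> borel_measurable K"
    and L: "\<And>u f. (u, f) \<in> set L \<Longrightarrow> f \<in> borel_measurable borel" "sorted_wrt (<) (0 # map fst L)"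
  shows "(\<lambda>(p, \<omega>). path_prod L (skeleton_path x B b n (z p) \<omega>)) \<in> borel_measurable (K \<Otimes>\<^sub>M rest_sigma M U \<tau> \<xi> B b)"
  unfolding split_beta'
proof (rule measurable_path_prod, intro conjI)
  fix u f assume uf: "(u, f) \<in> set L"
  then have "u \<ge> 0" using L(2) by force
  from measurable_skeleton_path[OF B b K refl this]
  show "(\<lambda>p. skeleton_path x B b n (z (fst p)) (snd p) u) \<in> borel_measurable (K \<Otimes>\<^sub>M rest_sigma M U \<tau> \<xi> B b)"
    by (simp add: split_beta')
  show "f \<in> borel_measurable borel" using L(1) uf .
qed

text \<open>On \<open>U = n\<close> the path is a function of the skeleton and of the remaining
  parts, which are independent of it, so the latter can be integrated over a copy
  \<open>\<omega>'\<close>. The points are written as a restriction to \<open>{1..n}\<close> because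
  their law is given on that product space.\<close>

lemma nn_integral_W_event:
  fixes B :: "real \<Rightarrow> 'w \<Rightarrow> R3" and b :: "nat \<Rightarrow> real \<Rightarrow> 'w \<Rightarrow> R3"
  assumes M: "prob_space M" and ind: "prob_space.indep_sets M (part_sigma M U \<tau> \<xi> B b) UNIV"
    and start: "\<forall>\<omega>\<in>space M. \<tau> 0 \<omega> = 0 \<and> \<xi> 0 \<omega> = x"
    and B: "standard_brownian_motion M B" and b: "\<And>k. standard_brownian_bridge M (b k)"
    and L: "\<And>u f. (u, f) \<in> set L \<Longrightarrow> f \<in> borel_measurable borel" "sorted_wrt (<) (0 # map fst L)"
  shows "(\<integral>\<^sup>+\<omega>. indicator {n} (U \<omega>) * path_prod L (W U \<tau> \<xi> B b \<omega>) \<partial>M) =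
    (\<integral>\<^sup>+\<omega>. indicator {n} (U \<omega>) * (\<integral>\<^sup>+\<omega>'. path_prod L (skeleton_path x B b n (\<lambda>k\<in>{1..n}. (\<tau> k \<omega>, \<xi> k \<omega>)) \<omega>') \<partial>M) \<partial>M)"
proof -
  interpret prob_space M by fact
  let ?V = "sigma (space M) (part_sigma M U \<tau> \<xi> B b Skeleton)"
  let ?R = "rest_sigma M U \<tau> \<xi> B b"
  let ?F = "\<lambda>(p :: nat \<times> (nat \<Rightarrow> real \<times> R3)) \<omega>. indicator {n} (fst p) * path_prod L (skeleton_path x B b n (snd p) \<omega>)"
  note sk_meas = part_sigma_measurable(3)[of U \<tau> \<xi> M B b]
  have comp: "(\<lambda>\<omega>. snd (skeleton U \<tau> \<xi> \<omega>) k) \<in> borel_measurable ?V" for k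
    by (rule measurable_compose[OF measurable_compose[OF sk_meas measurable_snd] measurable_component_singleton]) simp
  have [measurable]: "(\<lambda>p. path_prod L (skeleton_path x B b n (snd (skeleton U \<tau> \<xi> (fst p))) (snd p))) \<in> borel_measurable (?V \<Otimes>\<^sub>M ?R)"
    using measurable_path_prod_skeleton_path[OF B b comp L, where x=x and n=n] by (simp add: split_beta')
  have [measurable]: "(\<lambda>p. indicator {n} (fst (skeleton U \<tau> \<xi> (fst p))) :: ennreal) \<in> borel_measurable (?V \<Otimes>\<^sub>M ?R)"
    by (rule measurable_compose[OF measurable_compose[OF measurable_compose[OF measurable_fst sk_meas] measurable_fst]]) simp
  have sk: "skeleton_path x B b n (snd (skeleton U \<tau> \<xi> \<omega>)) = skeleton_path x B b n (\<lambda>k\<in>{1..n}. (\<tau> k \<omega>, \<xi> k \<omega>))" if "U \<omega> = n" for \<omega>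
    by (intro ext skeleton_path_cong[THEN fun_cong]) (use that in \<open>auto simp: skeleton_def\<close>)
  have "(\<integral>\<^sup>+\<omega>. indicator {n} (U \<omega>) * path_prod L (W U \<tau> \<xi> B b \<omega>) \<partial>M) = (\<integral>\<^sup>+\<omega>. ?F (skeleton U \<tau> \<xi> \<omega>) \<omega> \<partial>M)"
  proof (rule nn_integral_cong)
    fix \<omega> assume \<omega>: "\<omega> \<in> space M"
    show "indicator {n} (U \<omega>) * path_prod L (W U \<tau> \<xi> B b \<omega>) = ?F (skeleton U \<tau> \<xi> \<omega>) \<omega>"
    proof (cases "U \<omega> = n")
      case True
      have "W U \<tau> \<xi> B b \<omega> = skeleton_path x B b (U \<omega>) (snd (skeleton U \<tau> \<xi> \<omega>)) \<omega>"
        by (rule W_eq_skeleton_path) (use start \<omega> in \<open>auto simp: skeleton_def\<close>)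
      then show ?thesis using True by (simp add: skeleton_def)
    qed (simp add: skeleton_def)
  qed
  also have "\<dots> = (\<integral>\<^sup>+\<omega>. (\<integral>\<^sup>+\<omega>'. ?F (skeleton U \<tau> \<xi> \<omega>) \<omega>' \<partial>M) \<partial>M)"
    by (rule indep_var_nn_integral[OF indep_var_skeleton_rest[OF M ind]]) (simp add: split_beta')
  also have "\<dots> = (\<integral>\<^sup>+\<omega>. indicator {n} (U \<omega>) * (\<integral>\<^sup>+\<omega>'. path_prod L (skeleton_path x B b n (\<lambda>k\<in>{1..n}. (\<tau> k \<omega>, \<xi> k \<omega>)) \<omega>') \<partial>M) \<partial>M)"
  proof (rule nn_integral_cong)
    fix \<omega>
    have fst: "fst (skeleton U \<tau> \<xi> \<omega>) = U \<omega>" by (simp add: skeleton_def)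
    show "(\<integral>\<^sup>+\<omega>'. ?F (skeleton U \<tau> \<xi> \<omega>) \<omega>' \<partial>M) = indicator {n} (U \<omega>) *
      (\<integral>\<^sup>+\<omega>'. path_prod L (skeleton_path x B b n (\<lambda>k\<in>{1..n}. (\<tau> k \<omega>, \<xi> k \<omega>)) \<omega>') \<partial>M)"
      by (cases "U \<omega> = n") (simp_all add: fst sk)
  qed
  finally show ?thesis .
qed

section \<open>The series terms as iterated space-time kernels\<close>

definition dyson_kernel ::
  "(R3 \<Rightarrow> ennreal) \<Rightarrow> real \<Rightarrow> (real \<times> (R3 \<Rightarrow> ennreal)) list \<Rightarrow> real \<times> R3 \<Rightarrow> real \<times> R3 \<Rightarrow> ennreal" where
  "dyson_kernel q t L w y = indicator {fst w<..<t} (fst y) *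
     (bm_op (fst w) (tests_between (fst w) (fst y) L) (heat_to (fst y) (snd y)) (snd w) * q (snd y))"

lemma measurable_fst_snd_borel[measurable]:
  "fst \<in> borel_measurable (borel :: (real \<times> R3) measure)" "snd \<in> borel_measurable (borel :: (real \<times> R3) measure)"
  by (auto intro!: borel_measurable_continuous_onI continuous_intros)

lemma measurable_dyson_kernel:
  assumes [measurable]: "q \<in> borel_measurable borel"
    and L: "\<And>u f. (u, f) \<in> set L \<Longrightarrow> f \<in> borel_measurable borel"
  shows "(\<lambda>(w, y). dyson_kernel q t L w y) \<in> borel_measurable (borel \<Otimes>\<^sub>M borel)"
proof -
  let ?K = "(borel :: (real \<times> R3) measure) \<Otimes>\<^sub>M (borel :: (real \<times> R3) measure)"
  have *: "(\<lambda>(p, s, x). bm_op s (tests_between (fst (fst p)) (fst (snd p)) L)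
      (heat_to (fst (snd p)) (snd (snd p))) x) \<in> borel_measurable (?K \<Otimes>\<^sub>M borel \<Otimes>\<^sub>M borel)"
    by (rule measurable_bm_op_filter) (use L in auto)
  have "(\<lambda>p. (p, fst (fst p), snd (fst p))) \<in> ?K \<rightarrow>\<^sub>M ?K \<Otimes>\<^sub>M borel \<Otimes>\<^sub>M borel"
    by measurable
  from measurable_compose[OF this *]
  have [measurable]: "(\<lambda>p. bm_op (fst (fst p)) (tests_between (fst (fst p)) (fst (snd p)) L)
      (heat_to (fst (snd p)) (snd (snd p))) (snd (fst p))) \<in> borel_measurable ?K"
    by (simp add: split_beta')
  have [measurable]: "(\<lambda>p. indicator {fst (fst p)<..<t} (fst (snd p)) :: ennreal) \<in> borel_measurable ?K"
    unfolding indicator_def by (simp add: greaterThanLessThan_iff)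
  show ?thesis
    unfolding dyson_kernel_def split_beta' by measurable
qed

lemma nn_integral_dyson_kernel:
  assumes q[measurable]: "q \<in> borel_measurable borel"
    and L: "\<And>u f. (u, f) \<in> set L \<Longrightarrow> f \<in> borel_measurable borel"
  shows "(\<integral>\<^sup>+y. dyson_kernel q t L w y * dyson q t L m (fst y) (snd y) \<partial>lborel) = dyson q t L (Suc m) (fst w) (snd w)"
proof -
  have mK: "dyson_kernel q t L w \<in> borel_measurable borel"
    using measurable_compose[OF measurable_Pair1'[of w borel borel] measurable_dyson_kernel[OF q L, where t=t]] by simp
  have mD: "(\<lambda>p. dyson q t L m (fst p) (snd p)) \<in> borel_measurable (borel \<Otimes>\<^sub>M borel)"
    using measurable_dyson[OF q L, where t=t and m=m] by (simp add: split_beta')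
  have m: "(\<lambda>y. dyson_kernel q t L w y * dyson q t L m (fst y) (snd y)) \<in> borel_measurable (lborel \<Otimes>\<^sub>M lborel)"
    unfolding lborel_prod using mK mD by (simp add: borel_prod)
  have m2: "(\<lambda>y. dyson_kernel q t L w (u, y) * dyson q t L m u y) \<in> borel_measurable borel" for u
    using measurable_compose[OF measurable_Pair1'[of u lborel lborel] m] by simp
  have mB: "(\<lambda>y. bm_op (fst w) (tests_between (fst w) u L) (heat_to u y) (snd w) * (q y * dyson q t L m u y)) \<in> borel_measurable borel"
    if "u \<in> {fst w<..<t}" for u
    using m2[of u] that by (simp add: dyson_kernel_def mult.assoc)
  have "(\<integral>\<^sup>+y. dyson_kernel q t L w y * dyson q t L m (fst y) (snd y) \<partial>lborel) =
     (\<integral>\<^sup>+y. dyson_kernel q t L w y * dyson q t L m (fst y) (snd y) \<partial>(lborel \<Otimes>\<^sub>M lborel))"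
    by (simp add: lborel_prod)
  also have "\<dots> = (\<integral>\<^sup>+u. (\<integral>\<^sup>+y. dyson_kernel q t L w (u, y) * dyson q t L m u y \<partial>lborel) \<partial>lborel)"
    using lborel.nn_integral_fst[OF m] by simp
  also have "\<dots> = dyson q t L (Suc m) (fst w) (snd w)"
    unfolding dyson.simps
  proof (rule nn_integral_cong)
    fix u :: real
    show "(\<integral>\<^sup>+y. dyson_kernel q t L w (u, y) * dyson q t L m u y \<partial>lborel) =
      indicator {fst w<..<t} u * (\<integral>\<^sup>+y. bm_op (fst w) (tests_between (fst w) u L) (heat_to u y) (snd w) * (q y * dyson q t L m u y) \<partial>lborel)"
      by (cases "u \<in> {fst w<..<t}") (simp_all add: dyson_kernel_def mult.assoc)
  qed
  finally show ?thesis .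
qed

text \<open>Absorbing one kernel into the terminal function raises the order of the term by one, so
  the statement is proved for all orders \<open>m\<close> at once and later used with
  \<open>m = 0\<close>.\<close>

lemma kernel_iter_dyson:
  assumes q: "q \<in> borel_measurable borel" and L: "\<And>u f. (u, f) \<in> set L \<Longrightarrow> f \<in> borel_measurable borel"
  shows "kernel_iter lborel (\<lambda>_. dyson_kernel q t L) n (\<lambda>p. dyson q t L m (fst p) (snd p)) w = dyson q t L (n + m) (fst w) (snd w)"
proof (induction n arbitrary: m)
  case (Suc n)
  have "kernel_iter lborel (\<lambda>_. dyson_kernel q t L) (Suc n) (\<lambda>p. dyson q t L m (fst p) (snd p)) w =
     kernel_iter lborel (\<lambda>_. dyson_kernel q t L) n (\<lambda>p. dyson q t L (Suc m) (fst p) (snd p)) w"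
    by (simp only: kernel_iter.simps nn_integral_dyson_kernel[OF q L])
  also have "\<dots> = dyson q t L (n + Suc m) (fst w) (snd w)" by (rule Suc.IH)
  finally show ?case by simp
qed simp

section \<open>The law of the skeleton\<close>

lemma prod_ph:
  assumes \<epsilon>: "\<epsilon> > 0"
  shows "(\<Prod>k<n. ph \<epsilon> (t (Suc k) - t k) (X k) (X (Suc k))) =
    h \<epsilon> (X n) / h \<epsilon> (X 0) * (\<Prod>k<n. heat (t (Suc k) - t k) (X (Suc k) - X k) * (- V \<epsilon> (X (Suc k))))"
proof (induction n)
  case 0
  then show ?case using h_pos[OF \<epsilon>, of "X 0"] by simp
next
  case (Suc n)
  then show ?case
    using h_pos[OF \<epsilon>, of "X n"] h_pos[OF \<epsilon>, of "X 0"]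
    by (simp add: ph_def heat_commute[of _ "X n"] field_simps)
qed

text \<open>Writing \<open>(0, x)\<close> as point 0 merges the separate first factor with the
  product over later steps. The quotient of values of \<open>h\<close> left over by
  \<open>prod_ph\<close> cancels against the prefactor of the density.\<close>

lemma points_density_increasing:
  fixes z :: "nat \<Rightarrow> real \<times> R3" and x :: R3
  assumes \<epsilon>: "\<epsilon> > 0" and n: "n \<ge> 1"
  defines "\<tau> \<equiv> \<lambda>k. fst ((z(0 := (0, x))) k)" and "X \<equiv> \<lambda>k. snd ((z(0 := (0, x))) k)"
  assumes inc: "\<And>k. k < n \<Longrightarrow> \<tau> k < \<tau> (Suc k) \<and> \<tau> (Suc k) < t"
  shows "points_density \<epsilon> l t x q n z = 1 / q * (l ^ n / G \<epsilon> l t x) *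
    (\<Prod>k<n. heat (\<tau> (Suc k) - \<tau> k) (X (Suc k) - X k) * (- V \<epsilon> (X (Suc k))))"
proof -
  obtain m where m: "n = Suc m" using n by (cases n) auto
  have z: "z k = (\<tau> k, X k)" if "k \<ge> 1" for k using that by (simp add: \<tau>_def X_def)
  have 0: "\<tau> 0 = 0" "X 0 = x" by (simp_all add: \<tau>_def X_def)
  have cond: "0 \<le> fst (z 1) \<and> (\<forall>k\<in>{1..<n}. fst (z k) < fst (z (k + 1))) \<and> fst (z n) < t"
    using inc[of 0] inc[of m] inc 0 n by (auto simp: z m)
  have "(\<Prod>k=1..n-1. ph \<epsilon> (fst (z (k + 1)) - fst (z k)) (snd (z k)) (snd (z (k + 1)))) =
      (\<Prod>k<m. ph \<epsilon> (\<tau> (Suc (Suc k)) - \<tau> (Suc k)) (X (Suc k)) (X (Suc (Suc k))))"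
    by (simp add: m prod.atLeast1_atMost_eq z)
  then have "ph \<epsilon> (fst (z 1)) x (snd (z 1)) * (\<Prod>k=1..n-1. ph \<epsilon> (fst (z (k + 1)) - fst (z k)) (snd (z k)) (snd (z (k + 1)))) =
      (\<Prod>k<n. ph \<epsilon> (\<tau> (Suc k) - \<tau> k) (X k) (X (Suc k)))"
    unfolding m prod.lessThan_Suc_shift by (simp add: z 0)
  also have "\<dots> = h \<epsilon> (X n) / h \<epsilon> x * (\<Prod>k<n. heat (\<tau> (Suc k) - \<tau> k) (X (Suc k) - X k) * (- V \<epsilon> (X (Suc k))))"
    unfolding prod_ph[OF \<epsilon>] by (simp add: 0)
  finally have *: "ph \<epsilon> (fst (z 1)) x (snd (z 1)) * (\<Prod>k=1..n-1. ph \<epsilon> (fst (z (k + 1)) - fst (z k)) (snd (z k)) (snd (z (k + 1)))) =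
    h \<epsilon> (X n) / h \<epsilon> x * (\<Prod>k<n. heat (\<tau> (Suc k) - \<tau> k) (X (Suc k) - X k) * (- V \<epsilon> (X (Suc k))))" .
  have "points_density \<epsilon> l t x q n z = 1 / q * (l ^ n * h \<epsilon> x / (G \<epsilon> l t x * h \<epsilon> (snd (z n)))) *
      (ph \<epsilon> (fst (z 1)) x (snd (z 1)) * (\<Prod>k=1..n-1. ph \<epsilon> (fst (z (k + 1)) - fst (z k)) (snd (z k)) (snd (z (k + 1)))))"
    using cond by (simp add: points_density_def mult.assoc)
  also have "\<dots> = 1 / q * (l ^ n / G \<epsilon> l t x) *
    (\<Prod>k<n. heat (\<tau> (Suc k) - \<tau> k) (X (Suc k) - X k) * (- V \<epsilon> (X (Suc k))))"
    unfolding * using h_pos[OF \<epsilon>, of "X n"] h_pos[OF \<epsilon>, of x] z[OF n]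
    by (simp add: divide_simps)
  finally show ?thesis .
qed

lemma points_density_eq_0:
  fixes z :: "nat \<Rightarrow> real \<times> R3" and x :: R3
  assumes n: "n \<ge> 1"
  defines "\<tau> \<equiv> \<lambda>k. fst ((z(0 := (0, x))) k)"
  assumes bad: "\<not> (\<forall>k<n. \<tau> k < \<tau> (Suc k) \<and> \<tau> (Suc k) < t)"
  shows "points_density \<epsilon> l t x q n z = 0"
proof (rule ccontr)
  assume nz: "points_density \<epsilon> l t x q n z \<noteq> 0"
  have z: "fst (z k) = \<tau> k" if "k \<ge> 1" for k using that by (simp add: \<tau>_def)
  have 0: "\<tau> 0 = 0" by (simp add: \<tau>_def)
  have cond: "0 \<le> fst (z 1)" "\<forall>k\<in>{1..<n}. fst (z k) < fst (z (k + 1))" "fst (z n) < t"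
    and ph0: "ph \<epsilon> (fst (z 1)) x (snd (z 1)) \<noteq> 0"
    using nz by (auto simp: points_density_def split: if_splits)
  \<comment> \<open>the density admits \<open>t\<^sub>1 = 0\<close>, but \<open>heat 0 x = 0\<close>\<close>
  have "fst (z 1) \<noteq> 0"
    using ph0 by (auto simp: ph_def heat_zero)
  then have inc: "\<tau> k < \<tau> (Suc k)" if "k < n" for k
    using cond(1,2) that z 0 by (cases k) auto
  have "\<tau> (Suc k) < t" if "k < n" for k
    using strict_chain_le[of n \<tau> "Suc k" n] inc that cond(3) z[OF n] by simp
  with inc bad show False by auto
qed

text \<open>The exceptional set for one index is a box with a side \<open>S\<close> times the whole
  space, which is null because \<open>S\<close> is finite. The other sides have infinite measure,
  but in \<open>ennreal\<close> the product is still 0.\<close>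

lemma AE_PiM_lborel_time_notin:
  assumes I: "finite I" and S: "finite S"
  shows "AE z in Pi\<^sub>M I (\<lambda>_. lborel :: (real \<times> R3) measure). \<forall>k\<in>I. fst (z k) \<notin> S"
proof -
  interpret product_sigma_finite "\<lambda>_. lborel :: (real \<times> R3) measure" ..
  have "AE z in Pi\<^sub>M I (\<lambda>_. lborel :: (real \<times> R3) measure). fst (z k) \<notin> S" if k: "k \<in> I" for k
  proof (rule AE_I)
    let ?A = "\<lambda>i. if i = k then S \<times> UNIV else UNIV :: (real \<times> R3) set"
    have "S \<times> (UNIV :: R3 set) \<in> sets (borel \<Otimes>\<^sub>M borel)"
      using S by (intro pair_measureI) (auto intro: borel_closed finite_imp_closed)
    then have "S \<times> (UNIV :: R3 set) \<in> sets borel"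
      by (simp only: borel_prod)
    then have meas: "?A i \<in> sets lborel" for i
      by simp
    have "emeasure lborel (S \<times> (UNIV :: R3 set)) = emeasure lborel S * emeasure lborel (UNIV :: R3 set)"
      using S by (subst lborel_prod[symmetric], subst lborel.emeasure_pair_measure_Times) (auto intro!: finite_imp_closed borel_closed)
    also have "\<dots> = 0" using S by (simp add: emeasure_lborel_countable countable_finite)
    finally show "emeasure (Pi\<^sub>M I (\<lambda>_. lborel)) (Pi\<^sub>E I ?A) = 0"
      unfolding emeasure_PiM[OF I meas] using I k by (intro prod_zero) auto
    show "Pi\<^sub>E I ?A \<in> sets (Pi\<^sub>M I (\<lambda>_. lborel))"
      by (rule sets_PiM_I_finite[OF I meas])
    show "{z \<in> space (Pi\<^sub>M I (\<lambda>_. lborel)). \<not> fst (z k) \<notin> S} \<subseteq> Pi\<^sub>E I ?A"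
      by (auto simp: space_PiM PiE_iff mem_Times_iff extensional_def)
  qed
  then show ?thesis using I by (intro AE_finite_allI) auto
qed

lemma measurable_nn_integral_skeleton_path:
  fixes B :: "real \<Rightarrow> 'w \<Rightarrow> R3" and b :: "nat \<Rightarrow> real \<Rightarrow> 'w \<Rightarrow> R3"
  assumes M: "prob_space M" and ind: "prob_space.indep_sets M (part_sigma M U \<tau> \<xi> B b) UNIV"
    and B: "standard_brownian_motion M B" and b: "\<And>k. standard_brownian_bridge M (b k)"
    and L: "\<And>u f. (u, f) \<in> set L \<Longrightarrow> f \<in> borel_measurable borel" "sorted_wrt (<) (0 # map fst L)"
  shows "(\<lambda>z. \<integral>\<^sup>+\<omega>. path_prod L (skeleton_path x B b n z \<omega>) \<partial>M) \<in> borel_measurable (Pi\<^sub>M {1..n} (\<lambda>_. lborel))"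
proof -
  interpret prob_space M by fact
  let ?K = "Pi\<^sub>M {1..n} (\<lambda>_. lborel :: (real \<times> R3) measure)"
  have "(\<lambda>z. z k) \<in> borel_measurable ?K" if "1 \<le> k" "k \<le> n" for k
    using measurable_component_singleton[of k "{1..n}" "\<lambda>_. lborel :: (real \<times> R3) measure"] that by simp
  from measurable_path_prod_skeleton_path[OF B b this L, where x=x and U=U and \<tau>=\<tau> and \<xi>=\<xi>]
  have 1: "(\<lambda>(z, \<omega>). path_prod L (skeleton_path x B b n z \<omega>)) \<in> borel_measurable (?K \<Otimes>\<^sub>M rest_sigma M U \<tau> \<xi> B b)"
    by simp
  have [measurable]: "(\<lambda>\<omega>. \<omega>) \<in> M \<rightarrow>\<^sub>M rest_sigma M U \<tau> \<xi> B b"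
    using indep_var_skeleton_rest[OF M ind] by (rule indep_var_rv2)
  have "(\<lambda>p. (fst p, snd p)) \<in> ?K \<Otimes>\<^sub>M M \<rightarrow>\<^sub>M ?K \<Otimes>\<^sub>M rest_sigma M U \<tau> \<xi> B b"
    by (intro measurable_Pair measurable_fst measurable_compose[OF measurable_snd]) fact
  from measurable_compose[OF this 1]
  have [measurable]: "(\<lambda>p. path_prod L (skeleton_path x B b n (fst p) (snd p))) \<in> borel_measurable (?K \<Otimes>\<^sub>M M)"
    by simp
  show ?thesis by measurable
qed

text \<open>The probability \<open>q\<close> of the event cancels the normalisation
  \<open>1 / q\<close> in the density of the points. The heat kernels of that density undo the
  conditioning of the bridges, and what remains is a chain of \<open>dyson_kernel\<close>
  steps.\<close>

lemma nn_integral_W_event_dyson: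
  fixes B :: "real \<Rightarrow> 'w \<Rightarrow> R3" and b :: "nat \<Rightarrow> real \<Rightarrow> 'w \<Rightarrow> R3"
  assumes \<epsilon>: "\<epsilon> > 0" and l: "l \<ge> 0" and G: "G \<epsilon> l t x > 0"
    and M: "prob_space M" and ind: "prob_space.indep_sets M (part_sigma M U \<tau> \<xi> B b) UNIV"
    and U: "U \<in> measurable M (count_space UNIV)"
    and start: "\<forall>\<omega>\<in>space M. \<tau> 0 \<omega> = 0 \<and> \<xi> 0 \<omega> = x"
    and points: "\<forall>k. \<tau> k \<in> borel_measurable M \<and> \<xi> k \<in> borel_measurable M"
    and B: "standard_brownian_motion M B" and b: "\<And>k. standard_brownian_bridge M (b k)"
    and L: "\<And>u f. (u, f) \<in> set L \<Longrightarrow> f \<in> borel_measurable borel" "sorted_wrt (<) (0 # map fst L)"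
    and n: "n \<ge> 1" and q: "q = measure M {\<omega> \<in> space M. U \<omega> = n}" "q > 0"
    and dist: "distributed (uniform_measure M {\<omega> \<in> space M. U \<omega> = n})
        (Pi\<^sub>M {1..n} (\<lambda>_. lborel)) (\<lambda>\<omega>. \<lambda>k\<in>{1..n}. (\<tau> k \<omega>, \<xi> k \<omega>))
        (\<lambda>z. ennreal (points_density \<epsilon> l t x q n z))"
  shows "(\<integral>\<^sup>+\<omega>. indicator {n} (U \<omega>) * path_prod L (W U \<tau> \<xi> B b \<omega>) \<partial>M) =
    ennreal (l ^ n / G \<epsilon> l t x) * dyson (\<lambda>y. ennreal (- V \<epsilon> y)) t L n 0 x"
proof -
  interpret prob_space M by fact
  define v where "v y = ennreal (- V \<epsilon> y)" for y
  have v[measurable]: "v \<in> borel_measurable borel"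
    unfolding v_def using measurable_V[OF \<epsilon>] by measurable
  have V: "- V \<epsilon> y \<ge> 0" for y using V_neg[OF \<epsilon>, of y] by simp
  let ?A = "{\<omega> \<in> space M. U \<omega> = n}"
  let ?Z = "\<lambda>\<omega>. \<lambda>k\<in>{1..n}. (\<tau> k \<omega>, \<xi> k \<omega>)"
  let ?P = "Pi\<^sub>M {1..n} (\<lambda>_. lborel) :: (nat \<Rightarrow> real \<times> R3) measure"
  let ?c = "ennreal (l ^ n / G \<epsilon> l t x)"
  define \<Psi> where "\<Psi> z = (\<integral>\<^sup>+\<omega>. path_prod L (skeleton_path x B b n z \<omega>) \<partial>M)" for z
  have \<Psi>: "\<Psi> \<in> borel_measurable ?P"
    unfolding \<Psi>_def by (rule measurable_nn_integral_skeleton_path[OF M ind B b L])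
  have A: "?A \<in> sets M"
    using measurable_sets[OF U, of "{n}"] by (simp add: vimage_def Int_def conj_commute)
  have eA: "emeasure M ?A = ennreal q" by (simp add: q emeasure_eq_measure)
  have "random_variable borel (\<lambda>\<omega>. (\<tau> k \<omega>, \<xi> k \<omega>))" for k
    using points by (intro borel_measurable_Pair) auto
  then have Z: "?Z \<in> M \<rightarrow>\<^sub>M ?P"
    by (intro measurable_restrict) simp
  have \<Psi>Z: "(\<lambda>\<omega>. \<Psi> (?Z \<omega>)) \<in> borel_measurable M"
    by (rule measurable_compose[OF Z \<Psi>])
  let ?Y = "\<lambda>z. z(0 := (0, x))"
  let ?D = "\<lambda>z. (\<Prod>k<n. dyson_kernel v t L (?Y z k) (?Y z (Suc k))) * dyson v t L 0 (fst (?Y z n)) (snd (?Y z n))"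
  have mK: "(\<lambda>(w, y). dyson_kernel v t L w y) \<in> borel_measurable (lborel \<Otimes>\<^sub>M lborel)"
    using measurable_dyson_kernel[OF v L(1), where t=t] by (simp add: lborel_prod borel_prod)
  have mD: "(\<lambda>p. dyson v t L 0 (fst p) (snd p)) \<in> borel_measurable lborel"
    using measurable_dyson[OF v L(1), where t=t and m=0] by (simp add: split_beta' borel_prod)
  have "(\<integral>\<^sup>+\<omega>. indicator {n} (U \<omega>) * path_prod L (W U \<tau> \<xi> B b \<omega>) \<partial>M) = (\<integral>\<^sup>+\<omega>. indicator {n} (U \<omega>) * \<Psi> (?Z \<omega>) \<partial>M)"
    unfolding \<Psi>_def by (rule nn_integral_W_event[OF M ind start B b L])
  also have "\<dots> = (\<integral>\<^sup>+\<omega>. \<Psi> (?Z \<omega>) * indicator ?A \<omega> \<partial>M)"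
    by (intro nn_integral_cong) (auto simp: indicator_def)
  also have "\<dots> = ennreal q * (\<integral>\<^sup>+\<omega>. \<Psi> (?Z \<omega>) \<partial>uniform_measure M ?A)"
    unfolding nn_integral_uniform_measure[OF \<Psi>Z A] eA
    using q(2) by (simp add: ennreal_times_divide mult_divide_eq_ennreal mult.commute[of "ennreal q"])
  also have "(\<integral>\<^sup>+\<omega>. \<Psi> (?Z \<omega>) \<partial>uniform_measure M ?A) = (\<integral>\<^sup>+z. ennreal (points_density \<epsilon> l t x q n z) * \<Psi> z \<partial>?P)"
    by (rule distributed_nn_integral[OF dist \<Psi>, symmetric])
  also have "ennreal q * \<dots> = (\<integral>\<^sup>+z. ennreal q * (ennreal (points_density \<epsilon> l t x q n z) * \<Psi> z) \<partial>?P)"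
    by (intro nn_integral_cmult[symmetric] borel_measurable_times_ennreal distributed_borel_measurable[OF dist] \<Psi>)
  also have "\<dots> = (\<integral>\<^sup>+z. ?c * ?D z \<partial>?P)"
  proof (rule nn_integral_cong_AE)
    have "AE z in ?P. \<forall>k\<in>{1..n}. fst (z k) \<notin> fst ` set L"
      by (rule AE_PiM_lborel_time_notin) auto
    then show "AE z in ?P. ennreal q * (ennreal (points_density \<epsilon> l t x q n z) * \<Psi> z) = ?c * ?D z"
    proof eventually_elim
      case (elim z)
      define s where "s k = fst (?Y z k)" for k
      define X where "X k = snd (?Y z k)" for k
      show ?case
      proof (cases "\<forall>k<n. s k < s (Suc k) \<and> s (Suc k) < t")
        case True
        let ?h = "\<lambda>k. heat (s (Suc k) - s k) (X (Suc k) - X k)"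
        let ?b = "\<lambda>k. bm_op (s k) (tests_between (s k) (s (Suc k)) L) (heat_to (s (Suc k)) (X (Suc k))) (X k)"
        have pd: "points_density \<epsilon> l t x q n z = 1 / q * (l ^ n / G \<epsilon> l t x) * (\<Prod>k<n. ?h k * (- V \<epsilon> (X (Suc k))))"
          unfolding s_def X_def
          by (rule points_density_increasing[OF \<epsilon> n]) (use True in \<open>simp add: s_def\<close>)
        have sp: "(\<Prod>k<n. ennreal (?h k)) * \<Psi> z = (\<Prod>k<n. ?b k) * dyson v t L 0 (s n) (X n)"
          unfolding \<Psi>_def dyson.simps s_def X_def
          by (rule nn_integral_skeleton_path[OF M ind B b L]) (use True elim in \<open>auto simp: s_def\<close>)
        have "q * points_density \<epsilon> l t x q n z = l ^ n / G \<epsilon> l t x * (\<Prod>k<n. ?h k * (- V \<epsilon> (X (Suc k))))"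
          unfolding pd using q(2) by simp
        moreover have "0 \<le> (\<Prod>k<n. ?h k * (- V \<epsilon> (X (Suc k))))"
          by (intro prod_nonneg mult_nonneg_nonneg heat_nonneg V)
        ultimately have "ennreal q * ennreal (points_density \<epsilon> l t x q n z) = ?c * ennreal (\<Prod>k<n. ?h k * (- V \<epsilon> (X (Suc k))))"
          using q(2) l G by (simp add: ennreal_mult'[symmetric])
        also have "ennreal (\<Prod>k<n. ?h k * (- V \<epsilon> (X (Suc k)))) = (\<Prod>k<n. v (X (Suc k))) * (\<Prod>k<n. ennreal (?h k))"
        proof -
          have "ennreal (\<Prod>k<n. ?h k * (- V \<epsilon> (X (Suc k)))) = (\<Prod>k<n. ennreal (?h k * (- V \<epsilon> (X (Suc k)))))"
            by (rule prod_ennreal[symmetric]) (intro mult_nonneg_nonneg heat_nonneg V)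
          also have "\<dots> = (\<Prod>k<n. v (X (Suc k)) * ennreal (?h k))"
            unfolding v_def ennreal_mult[OF heat_nonneg V] by (simp only: mult.commute)
          finally show ?thesis by (simp only: prod.distrib)
        qed
        finally have "ennreal q * (ennreal (points_density \<epsilon> l t x q n z) * \<Psi> z) =
            ?c * ((\<Prod>k<n. v (X (Suc k))) * ((\<Prod>k<n. ennreal (?h k)) * \<Psi> z))"
          by (simp only: mult.assoc[symmetric])
        also have "\<dots> = ?c * ((\<Prod>k<n. v (X (Suc k))) * ((\<Prod>k<n. ?b k) * dyson v t L 0 (s n) (X n)))"
          by (simp only: sp)
        also have "\<dots> = ?c * ((\<Prod>k<n. ?b k * v (X (Suc k))) * dyson v t L 0 (s n) (X n))"
          by (simp only: prod.distrib mult.assoc mult.commute mult.left_commute)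
        also have "(\<Prod>k<n. ?b k * v (X (Suc k))) = (\<Prod>k<n. dyson_kernel v t L (?Y z k) (?Y z (Suc k)))"
          using True by (intro prod.cong refl) (simp add: dyson_kernel_def s_def X_def)
        finally show ?thesis by (simp only: s_def X_def)
      next
        case False
        \<comment> \<open>Times out of order, or not before \<open>t\<close>, annihilate both sides:
          the density is zero, and so is the kernel of step \<open>k\<close> because of its
          indicator.\<close>
        then obtain k where k: "k < n" "\<not> (s k < s (Suc k) \<and> s (Suc k) < t)" by auto
        have "points_density \<epsilon> l t x q n z = 0"
          by (rule points_density_eq_0[OF n]) (use False in \<open>simp add: s_def\<close>)
        moreover have "(\<Prod>k<n. dyson_kernel v t L (?Y z k) (?Y z (Suc k))) = 0"
        proof (rule prod_zero)
          have "dyson_kernel v t L (?Y z k) (?Y z (Suc k)) = 0"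
          proof -
            have "indicator {s k<..<t} (s (Suc k)) = (0 :: ennreal)"
              using k(2) by (simp add: indicator_def)
            then show ?thesis by (simp only: dyson_kernel_def s_def mult_zero_left)
          qed
          then show "\<exists>k\<in>{..<n}. dyson_kernel v t L (?Y z k) (?Y z (Suc k)) = 0"
            by (rule bexI[of _ k]) (use k(1) in simp)
        qed simp
        ultimately show ?thesis by (simp only: ennreal_0 mult_zero_left mult_zero_right)
      qed
    qed
  qed
  also have "\<dots> = ?c * (\<integral>\<^sup>+z. ?D z \<partial>?P)"
    by (rule nn_integral_cmult, rule measurable_PiM_chain[where K="\<lambda>_. dyson_kernel v t L" and g="\<lambda>p. dyson v t L 0 (fst p) (snd p)"])
      (use mK mD in auto)
  also have "(\<integral>\<^sup>+z. ?D z \<partial>?P) = kernel_iter lborel (\<lambda>_. dyson_kernel v t L) n (\<lambda>p. dyson v t L 0 (fst p) (snd p)) (0, x)"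
    by (rule nn_integral_PiM_chain[where K="\<lambda>_. dyson_kernel v t L" and g="\<lambda>p. dyson v t L 0 (fst p) (snd p)", OF lborel.sigma_finite_measure_axioms])
      (use mK mD in auto)
  also have "\<dots> = dyson v t L n 0 x"
    by (simp only: kernel_iter_dyson[OF v L(1)] add_0_right fst_conv snd_conv)
  finally show ?thesis by (simp only: v_def[abs_def])
qed

section \<open>The law of the interpolated path\<close>

text \<open>The density of the points vanishes unless the times increase strictly. Off this event
  the path is identically 0, so this is what makes it start at \<open>x\<close> almost
  surely.\<close>

lemma AE_skeleton_increasing:
  assumes M: "prob_space M" and U: "U \<in> measurable M (count_space UNIV)"
    and start: "\<forall>\<omega>\<in>space M. \<tau> 0 \<omega> = 0 \<and> \<xi> 0 \<omega> = x"
    and points_law: "\<forall>n\<ge>1. measure M {\<omega> \<in> space M. U \<omega> = n} > 0 \<longrightarrow>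
      distributed (uniform_measure M {\<omega> \<in> space M. U \<omega> = n})
        (Pi\<^sub>M {1..n} (\<lambda>_. lborel)) (\<lambda>\<omega>. \<lambda>k\<in>{1..n}. (\<tau> k \<omega>, \<xi> k \<omega>))
        (\<lambda>z. ennreal (points_density \<epsilon> l t x (measure M {\<omega> \<in> space M. U \<omega> = n}) n z))"
  shows "AE \<omega> in M. \<forall>k<U \<omega>. \<tau> k \<omega> < \<tau> (Suc k) \<omega>"
proof -
  interpret prob_space M by fact
  have "AE \<omega> in M. U \<omega> = n \<longrightarrow> (\<forall>k<n. \<tau> k \<omega> < \<tau> (Suc k) \<omega>)" for n
  proof (cases "n = 0")
    case False
    let ?A = "{\<omega> \<in> space M. U \<omega> = n}"
    let ?P = "Pi\<^sub>M {1..n} (\<lambda>_. lborel) :: (nat \<Rightarrow> real \<times> R3) measure"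
    let ?s = "\<lambda>z k. fst ((z(0 := (0, x))) k) :: real"
    have A: "?A \<in> sets M"
      using measurable_sets[OF U, of "{n}"] by (simp add: vimage_def Int_def conj_commute)
    show ?thesis
    proof (cases "measure M ?A > 0")
      case True
      let ?d = "points_density \<epsilon> l t x (measure M ?A) n"
      have dist: "distributed (uniform_measure M ?A) ?P (\<lambda>\<omega>. \<lambda>k\<in>{1..n}. (\<tau> k \<omega>, \<xi> k \<omega>)) (\<lambda>z. ennreal (?d z))"
        using points_law True False by simp
      have meas: "Measurable.pred ?P (\<lambda>z. \<forall>k<n. ?s z k < ?s z (Suc k))"
      proof -
        have less: "Measurable.pred K (\<lambda>z. f z < g z)"
          if [measurable]: "f \<in> borel_measurable K" "g \<in> borel_measurable K"
          for f g :: "(nat \<Rightarrow> real \<times> R3) \<Rightarrow> real" and K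
          by measurable
        have s: "(\<lambda>z. ?s z k) \<in> borel_measurable ?P" if "k \<le> n" for k
          using measurable_compose[OF measurable_PiM_coord[of "(0, x)" "lborel :: (real \<times> R3) measure" k n, OF _ that], of fst borel]
          by (simp add: measurable_fst_snd_borel)
        have "Measurable.pred ?P (\<lambda>z. ?s z k < ?s z (Suc k))" if "k < n" for k
          using that by (intro less s) auto
        then have "Measurable.pred ?P (\<lambda>z. k < n \<longrightarrow> ?s z k < ?s z (Suc k))" for k
          by (cases "k < n") simp_all
        then show ?thesis by (rule pred_intros_countable)
      qed
      have "AE z in ?P. 0 < ennreal (?d z) \<longrightarrow> (\<forall>k<n. ?s z k < ?s z (Suc k))"
      proof (rule AE_I2, rule impI)
        fix z :: "nat \<Rightarrow> real \<times> R3" assume "0 < ennreal (?d z)"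
        then have "?d z \<noteq> 0" by auto
        with points_density_eq_0[of n z x t \<epsilon> l "measure M ?A"] False
        show "\<forall>k<n. ?s z k < ?s z (Suc k)" by fastforce
      qed
      then have "AE \<omega> in uniform_measure M ?A. \<forall>k<n. ?s (\<lambda>k\<in>{1..n}. (\<tau> k \<omega>, \<xi> k \<omega>)) k < ?s (\<lambda>k\<in>{1..n}. (\<tau> k \<omega>, \<xi> k \<omega>)) (Suc k)"
        using True by (subst prob_space.distributed_AE2[OF prob_space_uniform_measure dist meas])
          (simp_all add: emeasure_eq_measure)
      then have "AE \<omega> in M. \<omega> \<in> ?A \<longrightarrow> (\<forall>k<n. ?s (\<lambda>k\<in>{1..n}. (\<tau> k \<omega>, \<xi> k \<omega>)) k < ?s (\<lambda>k\<in>{1..n}. (\<tau> k \<omega>, \<xi> k \<omega>)) (Suc k))"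
        using True by (subst (asm) AE_uniform_measure) (auto simp: emeasure_eq_measure less_top[symmetric])
      then show ?thesis
        using AE_space
      proof eventually_elim
        case (elim \<omega>)
        have "?s (\<lambda>k\<in>{1..n}. (\<tau> k \<omega>, \<xi> k \<omega>)) k = \<tau> k \<omega>" if "k \<le> n" for k
          using start elim(2) that by simp
        then show ?case using elim by auto
      qed
    next
      case False
      then have "emeasure M ?A = 0"
        by (simp add: emeasure_eq_measure zero_less_measure_iff)
      then have "AE \<omega> in M. \<omega> \<notin> ?A"
        using A by (intro AE_not_in) auto
      then show ?thesis using AE_space by eventually_elim auto
    qed
  qed simp
  then have "AE \<omega> in M. \<forall>n. U \<omega> = n \<longrightarrow> (\<forall>k<n. \<tau> k \<omega> < \<tau> (Suc k) \<omega>)"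
    unfolding AE_all_countable by blast
  then show ?thesis by eventually_elim simp
qed

text \<open>The nonnegative differences sum to 0. Subtracting the common total is legitimate in
  \<open>ennreal\<close> because it is finite.\<close>

lemma suminf_ennreal_eq_of_le:
  fixes p a :: "nat \<Rightarrow> ennreal"
  assumes le: "\<And>n. p n \<le> a n" and p: "(\<Sum>n. p n) = 1" and a: "(\<Sum>n. a n) = 1"
  shows "p n = a n"
proof -
  have "(\<Sum>n. a n) = (\<Sum>n. (a n - p n) + p n)"
    using le by (simp add: diff_add_cancel_ennreal)
  also have "\<dots> = (\<Sum>n. a n - p n) + (\<Sum>n. p n)"
    by (rule suminf_add[symmetric]) (rule summableI)+
  finally have "(\<Sum>n. a n - p n) + 1 = 1" using a p by simp
  then have "(\<Sum>n. a n - p n) = 1 - 1"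
    by (metis ennreal_add_diff_cancel_right ennreal_one_neq_top infinity_ennreal_def)
  then have "a n - p n \<le> 0"
    using sum_le_suminf[of "\<lambda>n. a n - p n" "{n}"] by (simp add: summableI)
  then have "a n \<le> p n"
    by (simp add: diff_eq_0_iff_ennreal)
  then show ?thesis using le[of n] by simp
qed

text \<open>Both laws are compared on test products, which suffices by
  \<open>path_measure_eqI\<close>: splitting over \<open>U\<close> on one side and expanding the
  weight on the other gives the same series. \<open>U0\<close> supplies the one mass for which there
  are no points whose density could normalise it.\<close>

lemma W_law_nonneg:
  fixes M :: "'w measure" and B :: "real \<Rightarrow> 'w \<Rightarrow> R3" and b :: "nat \<Rightarrow> real \<Rightarrow> 'w \<Rightarrow> R3"
  assumes \<epsilon>: "\<epsilon> > 0" and t: "t \<ge> 0" and l: "l \<ge> 0"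
    and M: "prob_space M"
    and U: "U \<in> measurable M (count_space UNIV)"
    and U0: "measure M {\<omega> \<in> space M. U \<omega> = 0} = 1 / G \<epsilon> l t x"
    and points: "\<forall>k. \<tau> k \<in> borel_measurable M \<and> \<xi> k \<in> borel_measurable M"
    and start: "\<forall>\<omega>\<in>space M. \<tau> 0 \<omega> = 0 \<and> \<xi> 0 \<omega> = x"
    and points_law: "\<forall>n\<ge>1. measure M {\<omega> \<in> space M. U \<omega> = n} > 0 \<longrightarrow>
      distributed (uniform_measure M {\<omega> \<in> space M. U \<omega> = n})
        (Pi\<^sub>M {1..n} (\<lambda>_. lborel)) (\<lambda>\<omega>. \<lambda>k\<in>{1..n}. (\<tau> k \<omega>, \<xi> k \<omega>))
        (\<lambda>z. ennreal (points_density \<epsilon> l t x (measure M {\<omega> \<in> space M. U \<omega> = n}) n z))"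
    and B: "standard_brownian_motion M B"
    and b: "\<And>k. standard_brownian_bridge M (b k)"
    and ind: "prob_space.indep_sets M (part_sigma M U \<tau> \<xi> B b) UNIV"
  shows "W U \<tau> \<xi> B b \<in> measurable M path_space \<and>
    distr M path_space (W U \<tau> \<xi> B b) = gibbs \<epsilon> l t x"
proof -
  interpret prob_space M by fact
  define v where "v y = ennreal (- V \<epsilon> y)" for y
  have v[measurable]: "v \<in> borel_measurable borel"
    unfolding v_def using measurable_V[OF \<epsilon>] by measurable
  have wien: "is_wiener x (wiener x)" by (rule is_wiener_wiener[OF B])
  have sets_wiener: "sets (wiener x) = sets path_space" using wien by (simp add: is_wiener_def)
  note G = gibbs_weight_integrable(2)[OF \<epsilon> t wien, of l]
  let ?W = "W U \<tau> \<xi> B b"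
  let ?A = "\<lambda>n. {\<omega> \<in> space M. U \<omega> = n}"
  have A: "?A n \<in> sets M" for n
    using measurable_sets[OF U, of "{n}"] by (simp add: vimage_def Int_def conj_commute)
  have contW: "continuous_on {0..} (?W \<omega>)" if "\<omega> \<in> space M" for \<omega>
    using that B b start
    by (intro continuous_W) (auto simp: standard_brownian_motion_def standard_brownian_bridge_def)
  have Wm: "?W \<in> M \<rightarrow>\<^sub>M path_space"
  proof (rule measurable_path_spaceI)
    show "(\<lambda>\<omega>. ?W \<omega> s) \<in> borel_measurable M" if "s \<ge> 0" for s
      by (rule measurable_W[OF U]) (use points B b that in \<open>auto simp: standard_brownian_motion_def standard_brownian_bridge_def\<close>)
    show "?W \<omega> \<in> extensional {0..} \<and> continuous_on {0..} (?W \<omega>)" if "\<omega> \<in> space M" for \<omega>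
      using contW[OF that] by (simp add: W_def)
  qed
  have event: "(\<integral>\<^sup>+\<omega>. indicator {n} (U \<omega>) * path_prod L (?W \<omega>) \<partial>M) = ennreal (l ^ n / G \<epsilon> l t x) * dyson v t L n 0 x"
    if L: "\<And>u f. (u, f) \<in> set L \<Longrightarrow> f \<in> borel_measurable borel" "sorted_wrt (<) (0 # map fst L)"
      and pos: "measure M (?A n) > 0" for L n
  proof (cases "n = 0")
    case False
    show ?thesis
      unfolding v_def[abs_def]
      by (rule nn_integral_W_event_dyson[OF \<epsilon> l G M ind U start points B b L _ refl pos])
        (use False points_law pos in auto)
  next
    case True
    \<comment> \<open>Without points there is a single extensional function on the empty index set,
      so the skeleton does not depend on the outcome.\<close>
    let ?z = "(\<lambda>k\<in>{1..0}. undefined) :: nat \<Rightarrow> real \<times> R3"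
    let ?\<Psi> = "\<integral>\<^sup>+\<omega>'. path_prod L (skeleton_path x B b 0 ?z \<omega>') \<partial>M"
    have "(\<integral>\<^sup>+\<omega>. indicator {0} (U \<omega>) * path_prod L (?W \<omega>) \<partial>M) =
      (\<integral>\<^sup>+\<omega>. indicator {0} (U \<omega>) * (\<integral>\<^sup>+\<omega>'. path_prod L (skeleton_path x B b 0 (\<lambda>k\<in>{1..0}. (\<tau> k \<omega>, \<xi> k \<omega>)) \<omega>') \<partial>M) \<partial>M)"
      by (rule nn_integral_W_event[OF M ind start B b L])
    also have "\<dots> = (\<integral>\<^sup>+\<omega>. ?\<Psi> * indicator (?A 0) \<omega> \<partial>M)"
      by (intro nn_integral_cong) (auto simp: indicator_def restrict_def)
    also have "\<dots> = ?\<Psi> * ennreal (1 / G \<epsilon> l t x)"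
      using A[of 0] U0 by (simp add: nn_integral_cmult_indicator emeasure_eq_measure)
    also have "?\<Psi> = dyson v t L 0 0 x"
      using nn_integral_skeleton_path[OF M ind B b L, where n=0 and z="?z" and x=x] by simp
    finally show ?thesis using True by (simp add: mult.commute)
  qed
  have null: "(\<integral>\<^sup>+\<omega>. indicator {n} (U \<omega>) * f \<omega> \<partial>M) = 0" if "\<not> measure M (?A n) > 0" for n and f :: "'w \<Rightarrow> ennreal"
  proof -
    have "emeasure M (?A n) = 0"
      using that by (simp add: emeasure_eq_measure zero_less_measure_iff)
    then have "AE \<omega> in M. \<omega> \<notin> ?A n"
      using A by (intro AE_not_in) auto
    then have "AE \<omega> in M. indicator {n} (U \<omega>) * f \<omega> = 0"
      using AE_space by eventually_elim auto
    then have "(\<integral>\<^sup>+\<omega>. indicator {n} (U \<omega>) * f \<omega> \<partial>M) = (\<integral>\<^sup>+\<omega>. 0 \<partial>M)"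
      by (rule nn_integral_cong_AE)
    then show ?thesis by simp
  qed
  have meas_ind: "(\<lambda>\<omega>. indicator {n} (U \<omega>) :: ennreal) \<in> borel_measurable M" for n
    by (rule measurable_compose[OF U]) simp
  have split: "(\<integral>\<^sup>+\<omega>. f \<omega> \<partial>M) = (\<Sum>n. \<integral>\<^sup>+\<omega>. indicator {n} (U \<omega>) * f \<omega> \<partial>M)"
    if f: "f \<in> borel_measurable M" for f :: "'w \<Rightarrow> ennreal"
  proof -
    have "f \<omega> = (\<Sum>n. indicator {n} (U \<omega>) * f \<omega>)" for \<omega>
      by (subst suminf_finite[of "{U \<omega>}"]) auto
    then have "(\<integral>\<^sup>+\<omega>. f \<omega> \<partial>M) = (\<integral>\<^sup>+\<omega>. (\<Sum>n. indicator {n} (U \<omega>) * f \<omega>) \<partial>M)"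
      by simp
    also have "\<dots> = (\<Sum>n. \<integral>\<^sup>+\<omega>. indicator {n} (U \<omega>) * f \<omega> \<partial>M)"
      by (rule nn_integral_suminf) (use f meas_ind in auto)
    finally show ?thesis .
  qed
  have series: "ennreal (1 / G \<epsilon> l t x) * (\<integral>\<^sup>+w. path_prod L w * ennreal (gibbs_weight \<epsilon> l t w) \<partial>wiener x) =
      (\<Sum>n. ennreal (l ^ n / G \<epsilon> l t x) * dyson v t L n 0 x)"
    if L: "\<And>u f. (u, f) \<in> set L \<Longrightarrow> f \<in> borel_measurable borel" "sorted_wrt (<) (0 # map fst L)" for L
  proof -
    have "ennreal (1 / G \<epsilon> l t x) * (\<integral>\<^sup>+w. path_prod L w * ennreal (gibbs_weight \<epsilon> l t w) \<partial>wiener x) =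
      (\<Sum>n. ennreal (1 / G \<epsilon> l t x) * (ennreal (l ^ n) * dyson v t L n 0 x))"
    proof -
      have "(\<integral>\<^sup>+w. path_prod L w * ennreal (gibbs_weight \<epsilon> l t w) \<partial>wiener x) = (\<Sum>n. ennreal (l ^ n) * dyson v t L n 0 x)"
        unfolding v_def[abs_def] by (rule nn_integral_gibbs_weight[OF \<epsilon> t l wien L])
      then show ?thesis by simp
    qed
    also have "\<dots> = (\<Sum>n. ennreal (l ^ n / G \<epsilon> l t x) * dyson v t L n 0 x)"
      using G l by (simp add: mult.assoc[symmetric] ennreal_mult[symmetric])
    finally show ?thesis .
  qed
  \<comment> \<open>The points are only normalised on events of positive probability. The other masses vanish as well,
    because \<open>U\<close> and the series both have total mass one.\<close>
  have mass: "(\<integral>\<^sup>+\<omega>. indicator {n} (U \<omega>) \<partial>M) = ennreal (l ^ n / G \<epsilon> l t x) * dyson v t [] n 0 x" for n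
  proof (rule suminf_ennreal_eq_of_le)
    show "(\<integral>\<^sup>+\<omega>. indicator {n} (U \<omega>) \<partial>M) \<le> ennreal (l ^ n / G \<epsilon> l t x) * dyson v t [] n 0 x" for n
      using event[of "[]" n] null[of n "\<lambda>_. 1"] by (cases "measure M (?A n) > 0") auto
    show "(\<Sum>n. \<integral>\<^sup>+\<omega>. indicator {n} (U \<omega>) \<partial>M) = 1"
      using split[of "\<lambda>_. 1"] by (simp add: emeasure_space_1)
    have "ennreal (1 / G \<epsilon> l t x) * ennreal (G \<epsilon> l t x) = 1"
      using G by (simp add: ennreal_mult[symmetric])
    then show "(\<Sum>n. ennreal (l ^ n / G \<epsilon> l t x) * dyson v t [] n 0 x) = 1"
      using series[of "[]"] ennreal_G[OF \<epsilon> t wien, of l] by simp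
  qed
  have all: "(\<integral>\<^sup>+\<omega>. indicator {n} (U \<omega>) * path_prod L (?W \<omega>) \<partial>M) = ennreal (l ^ n / G \<epsilon> l t x) * dyson v t L n 0 x"
    if L: "\<And>u f. (u, f) \<in> set L \<Longrightarrow> f \<in> borel_measurable borel" "sorted_wrt (<) (0 # map fst L)" for L n
  proof (cases "measure M (?A n) > 0")
    case False
    have zero: "ennreal (l ^ n / G \<epsilon> l t x) * dyson v t [] n 0 x = 0"
      using mass[of n] null[OF False, of "\<lambda>_. 1"] by simp
    have "ennreal (l ^ n / G \<epsilon> l t x) * dyson v t L n 0 x = 0"
    proof (cases "ennreal (l ^ n / G \<epsilon> l t x) = 0")
      case False
      have occ: "(\<lambda>w. occupation v t w n 0) \<in> borel_measurable (wiener x)"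
        using measurable_compose[OF _ measurable_occupation[OF v], of "\<lambda>w. (0, w)" path_space t n]
        by (simp add: measurable_cong_sets[OF sets_wiener refl])
      \<comment> \<open>A vanishing mass forces the nonnegative \<open>occupation\<close> to vanish
        almost everywhere, and then so does its product with any tests, even where these are
        infinite.\<close>
      have "(\<integral>\<^sup>+w. occupation v t w n 0 \<partial>wiener x) = 0"
        using False zero dyson_eq_wiener[OF wien v, of "[]" t n] by simp
      then have "AE w in wiener x. occupation v t w n 0 = 0"
        using occ by (simp add: nn_integral_0_iff_AE)
      then have "AE w in wiener x. path_prod L w * occupation v t w n 0 = 0"
        by eventually_elim simp
      then have "(\<integral>\<^sup>+w. path_prod L w * occupation v t w n 0 \<partial>wiener x) = (\<integral>\<^sup>+w. 0 \<partial>wiener x)"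
        by (rule nn_integral_cong_AE)
      moreover have "dyson v t L n 0 x = (\<integral>\<^sup>+w. path_prod L w * occupation v t w n 0 \<partial>wiener x)"
        by (rule dyson_eq_wiener[OF wien v L])
      ultimately show ?thesis by simp
    qed simp
    then show ?thesis using null[OF False] by simp
  qed (rule event[OF L])
  have gw: "(\<lambda>w. ennreal (1 / G \<epsilon> l t x * gibbs_weight \<epsilon> l t w)) \<in> borel_measurable (wiener x)"
    using measurable_gibbs_weight[OF \<epsilon>, of l t] by (simp add: measurable_cong_sets[OF sets_wiener refl])
  have gibbs_int: "(\<integral>\<^sup>+w. f w \<partial>gibbs \<epsilon> l t x) = ennreal (1 / G \<epsilon> l t x) * (\<integral>\<^sup>+w. f w * ennreal (gibbs_weight \<epsilon> l t w) \<partial>wiener x)"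
    if f: "f \<in> borel_measurable path_space" for f
  proof -
    have f': "f \<in> borel_measurable (wiener x)"
      using f by (simp add: measurable_cong_sets[OF sets_wiener refl])
    have g': "(\<lambda>w. ennreal (gibbs_weight \<epsilon> l t w)) \<in> borel_measurable (wiener x)"
      using measurable_gibbs_weight[OF \<epsilon>, of l t] by (simp add: measurable_cong_sets[OF sets_wiener refl])
    have m: "ennreal (1 / G \<epsilon> l t x * gibbs_weight \<epsilon> l t w) = ennreal (1 / G \<epsilon> l t x) * ennreal (gibbs_weight \<epsilon> l t w)" for w
      using G by (intro ennreal_mult) (simp_all add: gibbs_weight_def)
    have "(\<integral>\<^sup>+w. f w \<partial>gibbs \<epsilon> l t x) = (\<integral>\<^sup>+w. ennreal (1 / G \<epsilon> l t x) * (f w * ennreal (gibbs_weight \<epsilon> l t w)) \<partial>wiener x)"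
      unfolding gibbs_def nn_integral_density[OF gw f'] unfolding m by (simp only: mult_ac)
    also have "\<dots> = ennreal (1 / G \<epsilon> l t x) * (\<integral>\<^sup>+w. f w * ennreal (gibbs_weight \<epsilon> l t w) \<partial>wiener x)"
      by (rule nn_integral_cmult) (use f' g' in auto)
    finally show ?thesis .
  qed
  have "distr M path_space ?W = gibbs \<epsilon> l t x"
  proof (rule path_measure_eqI[where x=x])
    show "prob_space (distr M path_space ?W)" by (rule prob_space_distr[OF Wm])
    show "sets (gibbs \<epsilon> l t x) = sets path_space" by (simp add: gibbs_def sets_wiener)
    show "prob_space (gibbs \<epsilon> l t x)"
    proof
      have "emeasure (gibbs \<epsilon> l t x) (space (gibbs \<epsilon> l t x)) = (\<integral>\<^sup>+w. 1 \<partial>gibbs \<epsilon> l t x)" by simp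
      also have "\<dots> = 1"
        unfolding gibbs_int[OF borel_measurable_const] using ennreal_G[OF \<epsilon> t wien, of l] G
        by (simp add: ennreal_mult[symmetric])
      finally show "emeasure (gibbs \<epsilon> l t x) (space (gibbs \<epsilon> l t x)) = 1" .
    qed
    have ev0: "(\<lambda>w. w 0) \<in> borel_measurable path_space" by (rule measurable_path_space_eval) simp
    have "AE w in wiener x. w 0 = x" using wien by (simp add: is_wiener_def)
    then show "AE w in gibbs \<epsilon> l t x. w 0 = x"
      unfolding gibbs_def AE_density[OF gw] by eventually_elim simp
    have "AE \<omega> in M. ?W \<omega> 0 = x"
      using AE_skeleton_increasing[OF M U start points_law] AE_space
    proof eventually_elim
      case (elim \<omega>)
      have st: "\<tau> 0 \<omega> = 0" "\<xi> 0 \<omega> = x" "B 0 \<omega> = 0" "b 0 0 \<omega> = 0"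
        using start elim(2) B b[of 0] by (auto simp: standard_brownian_motion_def standard_brownian_bridge_def)
      show ?case
      proof (cases "U \<omega> = 0")
        case True
        then show ?thesis using W_tail[of U \<omega> \<tau> 0 \<xi> B b] st by simp
      next
        case False
        then show ?thesis
          using W_bridge[of U \<omega> \<tau> 0 0 \<xi> B b] elim(1) elim(1)[rule_format, of 0] st by (simp add: bridge_interp_def)
      qed
    qed
    then show "AE w in distr M path_space ?W. w 0 = x"
      using ev0 by (subst AE_distr_iff[OF Wm]) auto
    fix L :: "(real \<times> (R3 \<Rightarrow> ennreal)) list"
    assume L': "sorted_wrt (<) (0 # map fst L)" "\<And>u f. (u, f) \<in> set L \<Longrightarrow> f \<in> borel_measurable borel"
    note L = L'(2,1)
    have mL: "(\<lambda>w. path_prod L w) \<in> borel_measurable path_space"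
      using L by (intro measurable_path_prod_path_space) force
    have "(\<integral>\<^sup>+w. path_prod L w \<partial>distr M path_space ?W) = (\<integral>\<^sup>+\<omega>. path_prod L (?W \<omega>) \<partial>M)"
      using mL by (intro nn_integral_distr[OF Wm]) simp
    also have "\<dots> = (\<Sum>n. \<integral>\<^sup>+\<omega>. indicator {n} (U \<omega>) * path_prod L (?W \<omega>) \<partial>M)"
      by (rule split[OF measurable_compose[OF Wm mL]])
    also have "\<dots> = (\<Sum>n. ennreal (l ^ n / G \<epsilon> l t x) * dyson v t L n 0 x)"
      by (simp only: all[OF L])
    also have "\<dots> = ennreal (1 / G \<epsilon> l t x) * (\<integral>\<^sup>+w. path_prod L w * ennreal (gibbs_weight \<epsilon> l t w) \<partial>wiener x)"
      by (rule series[OF L, symmetric])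
    also have "\<dots> = (\<integral>\<^sup>+w. path_prod L w \<partial>gibbs \<epsilon> l t x)"
      by (rule gibbs_int[OF mL, symmetric])
    finally show "(\<integral>\<^sup>+w. path_prod L w \<partial>distr M path_space ?W) = (\<integral>\<^sup>+w. path_prod L w \<partial>gibbs \<epsilon> l t x)" .
  qed simp
  with Wm show ?thesis by simp
qed

section \<open>Negative coupling\<close>

text \<open>Integrating the conditional probability of the first step gives the law of
  \<open>X 1\<close>, since \<open>X 0 = a\<close> almost surely. The chain condition speaks of the
  real numbers \<open>measure (K a) A\<close> only, so finiteness of \<open>K a\<close> has to be
  derived before they determine it.\<close>

lemma markov_chain_first_step:
  assumes chain: "markov_chain N borel K a X" and K: "sets (K a) = sets borel"
  shows "distr N borel (X 1) = K a"
proof -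
  interpret prob_space N using chain by (simp add: markov_chain_def)
  have X: "X n \<in> borel_measurable N" for n using chain by (simp add: markov_chain_def)
  let ?F = "vimage_algebra (space N) (\<lambda>\<omega>. \<lambda>k\<in>{..0}. X k \<omega>) (Pi\<^sub>M {..0} (\<lambda>_. borel))"
  have "(\<lambda>\<omega>. \<lambda>k\<in>{..0}. X k \<omega>) \<in> N \<rightarrow>\<^sub>M Pi\<^sub>M {..0} (\<lambda>_. borel)"
    using X by (intro measurable_restrict) auto
  then have "sets ?F \<subseteq> sets N"
    by (rule sets_image_in_sets[OF refl])
  then have F: "subalgebra N ?F"
    by (simp add: subalgebra_def)
  interpret finite_measure_subalgebra N ?F
    by unfold_locales (rule F)
  have measure_eq: "measure N (X 1 -` A \<inter> space N) = measure (K a) A" if A: "A \<in> sets borel" for A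
  proof -
    let ?B = "X 1 -` A \<inter> space N"
    have B: "?B \<in> sets N" using measurable_sets[OF X A] .
    have ce: "AE \<omega> in N. real_cond_exp N ?F (indicator ?B) \<omega> = measure (K (X 0 \<omega>)) A"
      using chain A unfolding markov_chain_def One_nat_def by blast
    have X0: "AE \<omega> in N. X 0 \<omega> = a"
      using chain unfolding markov_chain_def by blast
    have "measure N ?B = (\<integral>\<omega>. indicator ?B \<omega> \<partial>N)"
      using B by simp
    also have "\<dots> = (\<integral>\<omega>. real_cond_exp N ?F (indicator ?B) \<omega> \<partial>N)"
      by (rule real_cond_exp_int(2)[symmetric]) (use B in \<open>simp add: integrable_indicator_iff emeasure_eq_measure\<close>)
    also have "\<dots> = (\<integral>\<omega>. measure (K a) A \<partial>N)"
    proof (rule integral_cong_AE)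
      show "AE \<omega> in N. real_cond_exp N ?F (indicator ?B) \<omega> = measure (K a) A"
        using ce X0 by eventually_elim simp
    qed auto
    finally show ?thesis by (simp add: prob_space)
  qed
  have spK: "space (K a) = UNIV" using sets_eq_imp_space_eq[OF K] by simp
  have "measure (K a) UNIV = 1"
    using measure_eq[of UNIV] by (simp add: prob_space)
  \<comment> \<open>\<open>measure\<close> is 0 on a set of infinite mass, so the value 1 rules this
    out.\<close>
  then have fin: "emeasure (K a) UNIV \<noteq> \<infinity>"
    by (auto simp: measure_def)
  interpret K: finite_measure "K a"
    by (rule finite_measureI) (use fin spK in simp)
  show ?thesis
  proof (rule measure_eqI)
    fix A assume "A \<in> sets (distr N borel (X 1))"
    then have A: "A \<in> sets borel" by simp
    then show "emeasure (distr N borel (X 1)) A = emeasure (K a) A"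
      using measure_eq[OF A] X by (simp add: emeasure_distr emeasure_eq_measure K.emeasure_eq_measure)
  qed (simp add: K)
qed

lemma nn_integral_heat_translate:
  assumes "prob_space M" "gaussian_increments M B" "u > 0"
  shows "(\<integral>\<^sup>+y. heat u (x - y) \<partial>lborel) = 1"
proof -
  have "(\<integral>\<^sup>+y. heat u (x - y) \<partial>lborel) = (\<integral>\<^sup>+y. heat u (y - x) \<partial>lborel)"
    by (simp add: heat_commute)
  also have "\<dots> = (\<integral>\<^sup>+y. heat u ((x + y) - x) \<partial>lborel)"
    by (rule nn_integral_lborel_shift[symmetric]) measurable
  also have "\<dots> = 1" using nn_integral_heat[OF assms] by simp
  finally show ?thesis .
qed

text \<open>The weight is \<open>l\<close> times a positive constant times an expectation, which
  must be shown to be positive and finite: an infinite expectation would be read as 0 and the sign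
  would be lost.\<close>

lemma U_weight_1_neg:
  assumes \<epsilon>: "\<epsilon> > 0" and t: "t > 0" and l: "l < 0" and G: "G \<epsilon> l t x > 0"
    and heat: "\<And>u. u > 0 \<Longrightarrow> (\<integral>\<^sup>+y. heat u (x - y) \<partial>lborel) = 1"
    and chain: "markov_chain N borel (ph_kernel \<epsilon>) (0, x) (\<lambda>n \<omega>. (T n \<omega>, S n \<omega>))"
  shows "U_weight \<epsilon> l t x N T S 1 < 0"
proof -
  interpret prob_space N using chain by (simp add: markov_chain_def)
  note [measurable] = measurable_V[OF \<epsilon>] measurable_h[OF \<epsilon>]
  let ?X = "\<lambda>\<omega>. (T 1 \<omega>, S 1 \<omega>)"
  let ?d = "\<lambda>p :: real \<times> R3. ennreal (indicator {0<..} (fst p) * ph \<epsilon> (fst p) x (snd p))"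
  define f where "f p = indicator {..t} (fst p) / h \<epsilon> (snd p)" for p :: "real \<times> R3"
  have f_nonneg: "f p \<ge> 0" for p using h_pos[OF \<epsilon>, of "snd p"] by (simp add: f_def)
  have [measurable]: "f \<in> borel_measurable borel" unfolding f_def by measurable
  have d[measurable]: "?d \<in> borel_measurable borel" unfolding ph_def by measurable
  have X: "?X \<in> borel_measurable N"
    using chain unfolding markov_chain_def by blast
  have kern: "ph_kernel \<epsilon> (0, x) = distr (density lborel ?d) borel (\<lambda>p. p)"
    by (simp add: ph_kernel_def split_beta')
  have law: "distr N borel ?X = ph_kernel \<epsilon> (0, x)"
    using markov_chain_first_step[OF chain] by (simp add: kern)
  define J where "J = (\<integral>\<^sup>+p. ?d p * ennreal (f p) \<partial>lborel)"
  have J: "(\<integral>\<^sup>+\<omega>. ennreal (f (?X \<omega>)) \<partial>N) = J"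
  proof -
    have "(\<integral>\<^sup>+\<omega>. ennreal (f (?X \<omega>)) \<partial>N) = (\<integral>\<^sup>+p. ennreal (f p) \<partial>distr N borel ?X)"
      using X by (subst nn_integral_distr) auto
    also have "\<dots> = J"
      unfolding law kern J_def by (subst nn_integral_distr) (auto simp: nn_integral_density)
    finally show ?thesis .
  qed
  obtain C where C: "C > 0" "\<And>y. - V \<epsilon> y \<le> C" using V_bounded[OF \<epsilon>] by blast
  \<comment> \<open>The \<open>h \<epsilon> y\<close> in the transition density cancels the
    denominator of \<open>f\<close>. What is left is a heat kernel with bounded weight, so
    \<open>J\<close> is at most \<open>C * t / h \<epsilon> x\<close>.\<close>
  have dens: "ph \<epsilon> u x y / h \<epsilon> y = heat u (x - y) * (- V \<epsilon> y) / h \<epsilon> x" for u y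
    using h_pos[OF \<epsilon>, of y] by (simp add: ph_def)
  have df: "?d (u, y) * ennreal (f (u, y)) = indicator {0<..t} u * ennreal (heat u (x - y) * (- V \<epsilon> y) / h \<epsilon> x)" for u y
  proof -
    have "0 \<le> heat u (x - y) * (- V \<epsilon> y) / h \<epsilon> x * h \<epsilon> y"
      using heat_nonneg[of u "x - y"] V_neg[OF \<epsilon>, of y] h_pos[OF \<epsilon>, of x] h_pos[OF \<epsilon>, of y]
      by (intro mult_nonneg_nonneg divide_nonneg_pos) auto
    then have "ph \<epsilon> u x y \<ge> 0" by (simp add: ph_def)
    then show ?thesis
      using h_pos[OF \<epsilon>, of y] unfolding dens[symmetric] f_def
      by (auto simp: indicator_def ennreal_mult[symmetric])
  qed
  have "J = (\<integral>\<^sup>+p. ?d p * ennreal (f p) \<partial>(lborel \<Otimes>\<^sub>M lborel))"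
    unfolding J_def by (simp add: lborel_prod)
  also have "\<dots> = (\<integral>\<^sup>+u. (\<integral>\<^sup>+y. ?d (u, y) * ennreal (f (u, y)) \<partial>lborel) \<partial>lborel)"
    by (rule lborel.nn_integral_fst[symmetric]) (simp add: lborel_prod)
  also have "\<dots> \<le> (\<integral>\<^sup>+u. (\<integral>\<^sup>+y. ennreal (C / h \<epsilon> x) * (indicator {0<..t} u * ennreal (heat u (x - y))) \<partial>lborel) \<partial>lborel)"
  proof (intro nn_integral_mono)
    fix u :: real and y :: R3
    have "heat u (x - y) * (- V \<epsilon> y) / h \<epsilon> x \<le> C / h \<epsilon> x * heat u (x - y)"
      using C(2)[of y] heat_nonneg[of u "x - y"] h_pos[OF \<epsilon>, of x] mult_left_mono[OF C(2)[of y], of "heat u (x - y)"]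
      by (simp add: divide_simps mult.commute)
    then have "ennreal (heat u (x - y) * (- V \<epsilon> y) / h \<epsilon> x) \<le> ennreal (C / h \<epsilon> x) * ennreal (heat u (x - y))"
      using C(1) h_pos[OF \<epsilon>, of x] by (simp add: ennreal_mult'[symmetric] ennreal_leI)
    then show "?d (u, y) * ennreal (f (u, y)) \<le> ennreal (C / h \<epsilon> x) * (indicator {0<..t} u * ennreal (heat u (x - y)))"
      unfolding df by (simp add: indicator_def)
  qed
  also have "\<dots> = (\<integral>\<^sup>+u. ennreal (C / h \<epsilon> x) * indicator {0<..t} u \<partial>lborel)"
  proof (rule nn_integral_cong)
    fix u :: real
    show "(\<integral>\<^sup>+y. ennreal (C / h \<epsilon> x) * (indicator {0<..t} u * ennreal (heat u (x - y))) \<partial>lborel) = ennreal (C / h \<epsilon> x) * indicator {0<..t} u"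
      by (cases "u \<in> {0<..t}") (simp_all add: nn_integral_cmult heat)
  qed
  also have "\<dots> < \<infinity>"
    using t by (simp add: nn_integral_cmult_indicator ennreal_mult_less_top)
  finally have fin: "J < \<infinity>" .
  have "J \<noteq> 0"
  \<comment> \<open>A zero integral would make the integrand vanish almost everywhere, but it is
    strictly positive on \<open>{0<..t} \<times> UNIV\<close>, which has positive measure.\<close>
  proof
    assume "J = 0"
    then have "AE p in lborel. ?d p * ennreal (f p) = 0"
      unfolding J_def by (subst (asm) nn_integral_0_iff_AE) auto
    then have "AE p in lborel. p \<notin> {0<..t} \<times> (UNIV :: R3 set)"
    proof eventually_elim
      case (elim p)
      obtain u y where p: "p = (u, y)" by (cases p)
      show ?case
      proof
        assume "p \<in> {0<..t} \<times> UNIV"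
        then have u: "u \<in> {0<..t}" by (simp add: p)
        then have pos: "heat u (x - y) * (- V \<epsilon> y) / h \<epsilon> x > 0"
          using heat_pos[of u "x - y"] V_neg[OF \<epsilon>, of y] h_pos[OF \<epsilon>, of x]
          by (intro divide_pos_pos mult_pos_pos) auto
        have "indicator {0<..t} u * ennreal (heat u (x - y) * (- V \<epsilon> y) / h \<epsilon> x) = 0"
          using elim by (simp only: p df)
        then have "heat u (x - y) * (- V \<epsilon> y) / h \<epsilon> x \<le> 0"
          using u by (simp add: ennreal_eq_0_iff)
        with pos show False by linarith
      qed
    qed
    moreover have "{0<..t} \<times> (UNIV :: R3 set) \<in> sets (borel \<Otimes>\<^sub>M borel)"
      by (intro pair_measureI) auto
    then have "{0<..t} \<times> (UNIV :: R3 set) \<in> sets borel"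
      by (simp only: borel_prod)
    ultimately have "emeasure lborel ({0<..t} \<times> (UNIV :: R3 set)) = 0"
      by (subst AE_iff_measurable[symmetric, where P="\<lambda>p. p \<notin> {0<..t} \<times> UNIV" and N="{0<..t} \<times> UNIV"]) auto
    moreover have "emeasure lborel ({0<..t} \<times> (UNIV :: R3 set)) = emeasure lborel {0<..t} * emeasure lborel (UNIV :: R3 set)"
      by (subst lborel_prod[symmetric], subst lborel.emeasure_pair_measure_Times) auto
    ultimately show False using t by simp
  qed
  have E: "(\<integral>\<omega>. f (?X \<omega>) \<partial>N) = enn2real J"
    using X f_nonneg unfolding J[symmetric] by (intro integral_eq_nn_integral) auto
  have "enn2real J > 0" using \<open>J \<noteq> 0\<close> fin by (simp add: enn2real_positive_iff zero_less_iff_neq_zero)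
  then have "l * (h \<epsilon> x * enn2real J) < 0"
    using l h_pos[OF \<epsilon>, of x] by (intro mult_neg_pos mult_pos_pos)
  then have "1 / G \<epsilon> l t x * (l * (h \<epsilon> x * enn2real J)) < 0"
    by (rule mult_pos_neg[rotated]) (use G in simp)
  moreover have "U_weight \<epsilon> l t x N T S 1 = 1 / G \<epsilon> l t x * (l * (h \<epsilon> x * (\<integral>\<omega>. f (?X \<omega>) \<partial>N)))"
    by (simp add: U_weight_def f_def mult.assoc)
  ultimately show ?thesis by (simp only: E)
qed

lemma points_density_time_0:
  assumes n: "n \<ge> 1"
  shows "points_density \<epsilon> l 0 x q n z = 0"
proof (rule points_density_eq_0[OF n, where x=x], rule notI)
  let ?\<tau> = "\<lambda>k. fst ((z(0 := (0, x))) k)"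
  assume "\<forall>k<n. ?\<tau> k < ?\<tau> (Suc k) \<and> ?\<tau> (Suc k) < 0"
  from this[rule_format, of 0] n have "0 < fst (z 1) \<and> fst (z 1) < 0" by simp
  then show False by linarith
qed

lemma gibbs_weight_time_0: "gibbs_weight \<epsilon> l 0 w = 1"
proof -
  have "AE s in lborel. s \<noteq> (0 :: real)" by (rule AE_lborel_singleton)
  then have "AE s in lborel. indicator {0..0 :: real} s *\<^sub>R V \<epsilon> (w s) = 0"
    by eventually_elim simp
  then have "(LBINT s:{0..0}. V \<epsilon> (w s)) = 0"
    unfolding set_lebesgue_integral_def by (rule integral_eq_zero_AE)
  then show ?thesis by (simp add: gibbs_weight_def)
qed

theorem proposition1p6:
  fixes \<gamma> \<epsilon> l t :: real and x :: R3
    and N :: "'v measure" and T :: "nat \<Rightarrow> 'v \<Rightarrow> real" and S :: "nat \<Rightarrow> 'v \<Rightarrow> R3"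
    and M :: "'w measure" and U :: "'w \<Rightarrow> nat"
    and \<tau> :: "nat \<Rightarrow> 'w \<Rightarrow> real" and \<xi> :: "nat \<Rightarrow> 'w \<Rightarrow> R3"
    and B :: "real \<Rightarrow> 'w \<Rightarrow> R3" and b :: "nat \<Rightarrow> real \<Rightarrow> 'w \<Rightarrow> R3"
  assumes eps: "\<epsilon> > 0" and t: "t \<ge> 0" and l: "l = 1 + \<gamma> * \<epsilon>"
    and chain: "markov_chain N borel (ph_kernel \<epsilon>) (0, x) (\<lambda>n \<omega>. (T n \<omega>, S n \<omega>))"
    and M: "prob_space M"
    and U: "U \<in> measurable M (count_space UNIV)"
    and U_law: "\<forall>n. measure M {\<omega> \<in> space M. U \<omega> = n} = U_weight \<epsilon> l t x N T S n"
    and points: "\<forall>k. \<tau> k \<in> borel_measurable M \<and> \<xi> k \<in> borel_measurable M"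
    and start: "\<forall>\<omega>\<in>space M. \<tau> 0 \<omega> = 0 \<and> \<xi> 0 \<omega> = x"
    and points_law: "\<forall>n\<ge>1. measure M {\<omega> \<in> space M. U \<omega> = n} > 0 \<longrightarrow>
      distributed (uniform_measure M {\<omega> \<in> space M. U \<omega> = n})
        (Pi\<^sub>M {1..n} (\<lambda>_. lborel)) (\<lambda>\<omega>. \<lambda>k\<in>{1..n}. (\<tau> k \<omega>, \<xi> k \<omega>))
        (\<lambda>z. ennreal (points_density \<epsilon> l t x (measure M {\<omega> \<in> space M. U \<omega> = n}) n z))"
    and B: "standard_brownian_motion M B"
    and b: "\<forall>k. standard_brownian_bridge M (b k)"
    and indep: "prob_space.indep_sets M (part_sigma M U \<tau> \<xi> B b) UNIV"
  shows "W U \<tau> \<xi> B b \<in> measurable M path_space \<and>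
    distr M path_space (W U \<tau> \<xi> B b) = gibbs \<epsilon> l t x"
proof -
  note bridge = b[rule_format]
  have U0: "measure M {\<omega> \<in> space M. U \<omega> = 0} = 1 / G \<epsilon> l t x"
    using U_law by (simp add: U_weight_def)
  consider "l \<ge> 0" | "t = 0" | "l < 0" "t > 0" using t by linarith
  then show ?thesis
  proof cases
    case 1
    show ?thesis
      by (rule W_law_nonneg[OF eps t 1 M U U0 points start points_law B bridge indep])
  next
    case 2
    \<comment> \<open>At time 0 the weight is 1 and no increasing times fit below \<open>t\<close>,
      so the density of the points is 0 for every coupling. Replacing \<open>l\<close> by 0 leads
      back to the nonnegative case.\<close>
    have G: "G \<epsilon> l t x = G \<epsilon> 0 t x" and gibbs: "gibbs \<epsilon> l t x = gibbs \<epsilon> 0 t x"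
      by (simp_all add: 2 G_def gibbs_def gibbs_weight_time_0)
    have "\<forall>n\<ge>1. measure M {\<omega> \<in> space M. U \<omega> = n} > 0 \<longrightarrow>
      distributed (uniform_measure M {\<omega> \<in> space M. U \<omega> = n})
        (Pi\<^sub>M {1..n} (\<lambda>_. lborel)) (\<lambda>\<omega>. \<lambda>k\<in>{1..n}. (\<tau> k \<omega>, \<xi> k \<omega>))
        (\<lambda>z. ennreal (points_density \<epsilon> 0 t x (measure M {\<omega> \<in> space M. U \<omega> = n}) n z))"
      using points_law by (simp add: 2 points_density_time_0)
    from W_law_nonneg[OF eps t order.refl M U _ points start this B bridge indep] U0
    show ?thesis by (simp add: G gibbs)
  next
    \<comment> \<open>vacuous: the prescribed probability of \<open>U = 1\<close> is negative\<close>
    case 3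
    have wien: "is_wiener x (wiener x)" by (rule is_wiener_wiener[OF B])
    have "gaussian_increments M B" using B by (simp add: standard_brownian_motion_def)
    then have "(\<integral>\<^sup>+y. heat u (x - y) \<partial>lborel) = 1" if "u > 0" for u
      using that by (rule nn_integral_heat_translate[OF M])
    then have "U_weight \<epsilon> l t x N T S 1 < 0"
      by (rule U_weight_1_neg[OF eps 3(2,1) gibbs_weight_integrable(2)[OF eps t wien] _ chain])
    moreover have "U_weight \<epsilon> l t x N T S 1 \<ge> 0"
      using U_law measure_nonneg by metis
    ultimately show ?thesis by simp
  qed
qed

end
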